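(* Let $b>0$ and $c\le 0$ be the Bona-Smith coefficients, let $T>0$, let $w(x)=(1-x^2)^\mu$ for some $-1<\mu<1$, and let $h_i,v_i\in C[0,T]$, $i=1,2$. Consider the integral system $$\eta(x,t)=H(x,t)+\int_0^t A_D(u+\eta u)\,d\tau,\qquad u(x,t)=U(x,t)+\int_0^t A_D\Big(c\,\eta_{xx}+\eta+\frac{u^2}{2}\Big)d\tau, \qquad (\ast)$$ with $A_D$, $H$, $U$ as defined in the context. Then: (1) If $c<0$ and $\eta_0\in H^2_w$, $u_0\in H^1_w$, then $(\ast)$ has at most one solution $(\eta,u)\in C^2_T\times C^1_T$. (2) If $c=0$ and $\eta_0\in H^2_w$, $u_0\in H^2_w$, then $(\ast)$ has at most one solution $(\eta,u)\in C^2_T\times C^2_T$.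
   Context: Coefficients: $b=\frac{3\theta^2-1}{6}>0$, $c=\frac{2-3\theta^2}{3}\le 0$, with $2/3\le\theta^2\le 1$. Weighted spaces: $\Omega=(-1,1)$; for $-1<\mu<1$ and $w(x)=(1-x^2)^\mu$, $L^2_w$ is the space of functions on $\Omega$ square integrable with respect to $w\,dx$, with norm $\|\phi\|_{0,w}=\big(\int_{-1}^1\phi^2 w\,dx\big)^{1/2}$. For an integer $k\ge 0$, $H^k_w$ is the space of functions whose derivatives up to order $k$ are in $L^2_w$, with norm $\|\phi\|_{k,w}^2=\sum_{j=0}^k\|\phi^{(j)}\|_{0,w}^2$ ($H^0_w=L^2_w$). $C^m_T$ is the space of continuous functions $f:[0,T]\to H^m_w$ with norm $\|f\|_{C^m_T}=\max_{0\le t\le T}\|f(t)\|_{m,w}$. The operator $A_D$: let $w_1(x)=\sinh\frac{1+x}{\sqrt b}$, $w_2(x)=\sinh\frac{1-x}{\sqrt b}$, $W=w_1w_2'-w_1'w_2$ (a constant), and let $G$ be the Green function $$G(x,\xi)=-\frac{1}{bW}\begin{cases} w_1(\xi)w_2(x), & -1\le\xi\le x,\\ w_1(x)w_2(\xi), & x<\xi\le 1.\end{cases}$$ Then $(A_Df)(x)=\int_{-1}^1 G_\xi(x,\xi)f(\xi)\,d\xi$; this is the solution $v$ of $v-bv''=-f'$ on $[-1,1]$, $v(-1)=v(1)=0$. The functions $H,U$: with $\alpha=\sinh(2/\sqrt b)$, $$H(x,t)=\eta_0(x)+\frac{w_2(x)}{\alpha}(h_1(t)-h_1(0))+\frac{w_1(x)}{\alpha}(h_2(t)-h_2(0)),$$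 $$U(x,t)=u_0(x)+\frac{w_2(x)}{\alpha}(v_1(t)-v_1(0))+\frac{w_1(x)}{\alpha}(v_2(t)-v_2(0)).$$ *)

theory Defs
  imports "HOL-Analysis.Analysis"
begin

abbreviation \<Omega> :: "real set" where
  "\<Omega> \<equiv> {-1<..<1}"


subsection \<open>Weak derivatives on \<open>\<Omega>\<close>\<close>

definition test_function :: "(real \<Rightarrow> real) \<Rightarrow> bool" where
  "test_function \<phi> \<longleftrightarrow>
     (\<forall>k x. (deriv ^^ k) \<phi> differentiable (at x)) \<and>
     compact (closure {x. \<phi> x \<noteq> 0}) \<and> closure {x. \<phi> x \<noteq> 0} \<subseteq> \<Omega>"

definition locally_integrable :: "(real \<Rightarrow> real) \<Rightarrow> bool" where
  "locally_integrable f \<longleftrightarrow> (\<forall>K. compact K \<and> K \<subseteq> \<Omega> \<longrightarrow> integrable (lebesgue_on K) f)"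

definition has_weak_deriv :: "nat \<Rightarrow> (real \<Rightarrow> real) \<Rightarrow> (real \<Rightarrow> real) \<Rightarrow> bool" where
  "has_weak_deriv k f g \<longleftrightarrow>
     locally_integrable f \<and> locally_integrable g \<and>
     (\<forall>\<phi>. test_function \<phi> \<longrightarrow>
        (LINT x|lebesgue_on \<Omega>. f x * (deriv ^^ k) \<phi> x) =
        (-1) ^ k * (LINT x|lebesgue_on \<Omega>. g x * \<phi> x))"

text \<open>A representative of the weak derivative. It is determined only up to null sets, and it is
  unspecified if there is none; below it is used only under integrals over \<open>\<Omega>\<close>.\<close>

definition weak_deriv :: "nat \<Rightarrow> (real \<Rightarrow> real) \<Rightarrow> real \<Rightarrow> real" where
  "weak_deriv k f = (if k = 0 then f else (SOME g. has_weak_deriv k f g))"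


subsection \<open>Weighted Sobolev spaces\<close>

text \<open>Elements are functions, not equivalence classes: two functions that agree almost everywhere
  on \<open>\<Omega>\<close> represent the same element, and values outside \<open>\<Omega>\<close> are irrelevant.\<close>

definition weight :: "real \<Rightarrow> real \<Rightarrow> real" where
  "weight \<mu> x = (1 - x\<^sup>2) powr \<mu>"

definition L2w :: "real \<Rightarrow> (real \<Rightarrow> real) set" where
  "L2w \<mu> = {f. f \<in> borel_measurable (lebesgue_on \<Omega>) \<and>
                integrable (lebesgue_on \<Omega>) (\<lambda>x. (f x)\<^sup>2 * weight \<mu> x)}"

definition L2w_norm :: "real \<Rightarrow> (real \<Rightarrow> real) \<Rightarrow> real" where
  "L2w_norm \<mu> f = sqrt (LINT x|lebesgue_on \<Omega>. (f x)\<^sup>2 * weight \<mu> x)"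

definition Hw :: "real \<Rightarrow> nat \<Rightarrow> (real \<Rightarrow> real) set" where
  "Hw \<mu> k = {f \<in> L2w \<mu>. \<forall>j\<in>{1..k}. \<exists>g\<in>L2w \<mu>. has_weak_deriv j f g}"

definition Hw_norm :: "real \<Rightarrow> nat \<Rightarrow> (real \<Rightarrow> real) \<Rightarrow> real" where
  "Hw_norm \<mu> k f = sqrt (\<Sum>j\<le>k. (L2w_norm \<mu> (weak_deriv j f))\<^sup>2)"

text \<open>The space \<open>C\<^sup>m\<^sub>T\<close>. Functions of space and time are curried with time first, so that
  \<open>f t\<close> is the element \<open>f(\<cdot>, t)\<close> of \<open>Hw \<mu> m\<close>.\<close>

definition CT :: "real \<Rightarrow> nat \<Rightarrow> real \<Rightarrow> (real \<Rightarrow> real \<Rightarrow> real) set" where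
  "CT \<mu> m T = {f. (\<forall>t\<in>{0..T}. f t \<in> Hw \<mu> m) \<and>
     (\<forall>t\<in>{0..T}. ((\<lambda>s. Hw_norm \<mu> m (\<lambda>x. f s x - f t x)) \<longlongrightarrow> 0) (at t within {0..T}))}"


subsection \<open>The operator \<open>A\<^sub>D\<close>\<close>

definition w1 :: "real \<Rightarrow> real \<Rightarrow> real" where
  "w1 b x = sinh ((1 + x) / sqrt b)"

definition w2 :: "real \<Rightarrow> real \<Rightarrow> real" where
  "w2 b x = sinh ((1 - x) / sqrt b)"

definition Wronskian :: "real \<Rightarrow> real \<Rightarrow> real" where
  "Wronskian b x = w1 b x * deriv (w2 b) x - deriv (w1 b) x * w2 b x"

lemma Wronskian_const:
  assumes "b > 0"
  shows "Wronskian b x = - sinh (2 / sqrt b) / sqrt b"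
proof -
  have d1: "deriv (w1 b) x = cosh ((1 + x) / sqrt b) / sqrt b"
    unfolding w1_def using assms
    by (intro DERIV_imp_deriv) (auto intro!: derivative_eq_intros simp: real_div_sqrt field_simps)
  have d2: "deriv (w2 b) x = - cosh ((1 - x) / sqrt b) / sqrt b"
    unfolding w2_def using assms
    by (intro DERIV_imp_deriv) (auto intro!: derivative_eq_intros simp: real_div_sqrt field_simps)
  have "sinh (2 / sqrt b) = sinh ((1 + x) / sqrt b + (1 - x) / sqrt b)"
    by (simp add: add_divide_distrib [symmetric])
  then show ?thesis
    unfolding Wronskian_def d1 d2 sinh_add w1_def w2_def
    by (simp add: add_divide_distrib [symmetric] algebra_simps)
qed

text \<open>By the previous lemma the Wronskian does not depend on the point at which it is evaluated.\<close>

definition Green :: "real \<Rightarrow> real \<Rightarrow> real \<Rightarrow> real" where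
  "Green b x \<xi> = - 1 / (b * Wronskian b x) *
     (if \<xi> \<le> x then w1 b \<xi> * w2 b x else w1 b x * w2 b \<xi>)"

text \<open>\<open>Green b x\<close> has a kink at \<open>x\<close>; the (unspecified) value of \<open>deriv\<close> at that one point does not
  affect the integral.\<close>

definition A_D :: "real \<Rightarrow> (real \<Rightarrow> real) \<Rightarrow> real \<Rightarrow> real" where
  "A_D b f x = (LINT \<xi>|lebesgue_on \<Omega>. deriv (\<lambda>y. Green b x y) \<xi> * f \<xi>)"


subsection \<open>The integral system\<close>

text \<open>\<open>H\<close> and \<open>U\<close> have the same form: \<open>H(x,t)\<close> is \<open>data_term b \<eta>0 h1 h2 t x\<close> and
  \<open>U(x,t)\<close> is \<open>data_term b u0 v1 v2 t x\<close>.\<close>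

definition data_term ::
  "real \<Rightarrow> (real \<Rightarrow> real) \<Rightarrow> (real \<Rightarrow> real) \<Rightarrow> (real \<Rightarrow> real) \<Rightarrow> real \<Rightarrow> real \<Rightarrow> real" where
  "data_term b f0 g1 g2 t x =
     f0 x + w2 b x / sinh (2 / sqrt b) * (g1 t - g1 0)
          + w1 b x / sinh (2 / sqrt b) * (g2 t - g2 0)"

text \<open>The equations are identities between elements of function spaces, hence required for almost
  every \<open>x\<close> at every time. The time integrals are taken pointwise in \<open>x\<close>: \<open>A_D b f x\<close> depends only
  on the class of \<open>f\<close>, and for \<open>\<eta>\<close>, \<open>u\<close> in the spaces considered the integrands are continuous
  in \<open>\<tau>\<close>.\<close>

definition solves_system ::
  "real \<Rightarrow> real \<Rightarrow> real \<Rightarrow> (real \<Rightarrow> real) \<Rightarrow> (real \<Rightarrow> real) \<Rightarrow>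
   (real \<Rightarrow> real) \<Rightarrow> (real \<Rightarrow> real) \<Rightarrow> (real \<Rightarrow> real) \<Rightarrow> (real \<Rightarrow> real) \<Rightarrow>
   (real \<Rightarrow> real \<Rightarrow> real) \<Rightarrow> (real \<Rightarrow> real \<Rightarrow> real) \<Rightarrow> bool" where
  "solves_system b c T \<eta>0 u0 h1 h2 v1 v2 \<eta> u \<longleftrightarrow>
     (\<forall>t\<in>{0..T}.
        (AE x in lebesgue_on \<Omega>. \<eta> t x = data_term b \<eta>0 h1 h2 t x +
           integral {0..t} (\<lambda>\<tau>. A_D b (\<lambda>\<xi>. u \<tau> \<xi> + \<eta> \<tau> \<xi> * u \<tau> \<xi>) x)) \<and>
        (AE x in lebesgue_on \<Omega>. u t x = data_term b u0 v1 v2 t x +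
           integral {0..t} (\<lambda>\<tau>. A_D b
             (\<lambda>\<xi>. c * weak_deriv 2 (\<eta> \<tau>) \<xi> + \<eta> \<tau> \<xi> + (u \<tau> \<xi>)\<^sup>2 / 2) x)))"

end

theory Submission
  imports Defs
begin

text \<open>For \<open>\<mu> < 1\<close> the weight satisfies \<open>1/w \<in> L\<^sup>1\<close>, so a function in \<open>Hw \<mu> 1\<close> has an integrable weak
  derivative and hence a continuous representative on \<open>[-1,1]\<close>, controlled by the norm; elements of
  \<open>C\<^sup>m\<^sub>T\<close> with \<open>m \<ge> 1\<close> are therefore represented by functions continuous in space and time.

  For two solutions let \<open>e\<close> and \<open>v\<close> be the differences of their components. Then \<open>e = \<integral> A\<^sub>D f\<close> and
  \<open>v = \<integral> (c A\<^sub>D e\<^sub>x\<^sub>x + A\<^sub>D q)\<close> (integrals over \<open>[0,t]\<close>), where \<open>f\<close> and \<open>q\<close> are bounded by a constant times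
  \<open>\<bar>e\<bar> + \<bar>v\<bar>\<close>. Write \<open>F\<close> for the time integral of \<open>f\<close>, so that \<open>e = A\<^sub>D F\<close>. Its first derivative in \<open>x\<close> is
  bounded by \<open>sup \<bar>F\<bar>\<close>, and integrating \<open>A\<^sub>D e\<^sub>x\<^sub>x\<close> by parts once bounds it by \<open>sup \<bar>F\<bar>\<close> as well. Thus the
  estimate closes in the supremum norm, with the same argument for \<open>c < 0\<close> and \<open>c = 0\<close>: for large
  \<open>\<lambda>\<close> a bound \<open>\<bar>e\<bar>, \<bar>v\<bar> \<le> K exp (\<lambda>t)\<close> implies the same bound with \<open>K/2\<close>, so \<open>e = v = 0\<close>.\<close>

subsection \<open>Test functions\<close>

text \<open>Two obstacles shape the proof. The first is \<open>c * A_D e_xx\<close>: a supremum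
  bound on \<open>e\<close> says nothing about its second derivative. Since \<open>A_D\<close> acts
  like an antiderivative in space, applying it, differentiating twice and applying it again has
  order zero in the time-integrated flux \<open>F\<close>; no spatial regularity of \<open>F\<close>
  beyond continuity enters, and the norms of the solution space are used only to obtain continuous
  representatives. The second is that \<open>weak_deriv 2\<close> is an arbitrary choice, known only
  through integrals against test functions. Before it can be integrated by parts it has to be
  recognised, almost everywhere, as the derivative of the classical function
  \<open>(A_D F)'\<close>. This is what du Bois-Reymond's lemma is for, and with it the explicit
  bump functions. The factor 1/2 arises because the time integral of \<open>exp (l * \<tau>)\<close>
  gains 1/l, while all other constants are collected in \<open>D\<close>;
  \<open>l = 2 * D + 1\<close> makes \<open>D / l\<close> at most 1/2. Repeated halving from a crude
  bound takes the place of a Gronwall inequality.\<close>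

definition diff_upto :: "nat \<Rightarrow> (real \<Rightarrow> real) \<Rightarrow> bool" where
  "diff_upto k f \<longleftrightarrow> (\<forall>j\<le>k. \<forall>x. (deriv ^^ j) f differentiable (at x))"

definition smooth :: "(real \<Rightarrow> real) \<Rightarrow> bool" where
  "smooth f \<longleftrightarrow> (\<forall>k x. (deriv ^^ k) f differentiable (at x))"

lemma smooth_iff_diff_upto: "smooth f \<longleftrightarrow> (\<forall>k. diff_upto k f)"
  unfolding smooth_def diff_upto_def by blast

lemma diff_upto_0: "diff_upto 0 f \<longleftrightarrow> (\<forall>x. f differentiable (at x))"
  unfolding diff_upto_def by simp

text \<open>Smoothness speaks of all orders at once and offers nothing to induct on. This recursion
  through the innermost derivative does, so each closure property is proved for
  \<open>diff_upto k\<close> with the functions left arbitrary.\<close>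

lemma diff_upto_Suc:
  "diff_upto (Suc k) f \<longleftrightarrow> (\<forall>x. f differentiable (at x)) \<and> diff_upto k (deriv f)"
proof -
  have "(\<forall>j\<le>Suc k. P j) \<longleftrightarrow> P 0 \<and> (\<forall>j\<le>k. P (Suc j))" for P
    by (metis Suc_le_mono le0 not0_implies_Suc)
  then show ?thesis
    unfolding diff_upto_def by (simp add: funpow_Suc_right del: funpow.simps)
qed

lemma diff_upto_mono: "diff_upto k f \<Longrightarrow> j \<le> k \<Longrightarrow> diff_upto j f"
  unfolding diff_upto_def by auto

lemma diff_upto_const: "diff_upto k (\<lambda>x. c)"
  by (induction k arbitrary: c) (auto simp: diff_upto_0 diff_upto_Suc)

lemma diff_upto_add: "diff_upto k f \<Longrightarrow> diff_upto k g \<Longrightarrow> diff_upto k (\<lambda>x. f x + g x)"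
proof (induction k arbitrary: f g)
  case 0
  then show ?case by (auto simp: diff_upto_0)
next
  case (Suc k)
  then have "deriv (\<lambda>x. f x + g x) = (\<lambda>x. deriv f x + deriv g x)"
    by (auto simp: diff_upto_Suc field_differentiable_def real_differentiable_def fun_eq_iff)
  with Suc show ?case by (auto simp: diff_upto_Suc)
qed

lemma diff_upto_mult: "diff_upto k f \<Longrightarrow> diff_upto k g \<Longrightarrow> diff_upto k (\<lambda>x. f x * g x)"
proof (induction k arbitrary: f g)
  case 0
  then show ?case by (auto simp: diff_upto_0)
next
  case (Suc k)
  \<comment> \<open>The product rule also keeps the undifferentiated factors, so these are needed at
    order \<open>k\<close> too.\<close>
  have "diff_upto k f" "diff_upto k g"
    using Suc.prems by (auto elim: diff_upto_mono)
  moreover have "deriv (\<lambda>x. f x * g x) = (\<lambda>x. f x * deriv g x + deriv f x * g x)"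
    using Suc.prems
    by (auto simp: diff_upto_Suc field_differentiable_def real_differentiable_def fun_eq_iff)
  ultimately show ?case using Suc by (auto simp: diff_upto_Suc intro!: diff_upto_add)
qed

lemma diff_upto_affine: "diff_upto k f \<Longrightarrow> diff_upto k (\<lambda>x. f (p * x + q))"
proof (induction k arbitrary: f)
  case 0
  have "(\<lambda>x. p * x + q) differentiable at x" for x
    by (intro derivative_intros)
  with 0 show ?case unfolding diff_upto_0
    using differentiable_compose[of f "\<lambda>x. p * x + q"] by blast
next
  case (Suc k)
  have *: "((\<lambda>x. f (p * x + q)) has_real_derivative (deriv f (p * x + q) * p)) (at x)" for x
  proof (rule DERIV_chain2[where f = f])
    show "(f has_real_derivative deriv f (p * x + q)) (at (p * x + q))"
      using Suc.prems by (metis DERIV_imp_deriv diff_upto_Suc real_differentiable_def)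
  qed (auto intro!: derivative_eq_intros)
  then have "deriv (\<lambda>x. f (p * x + q)) = (\<lambda>x. deriv f (p * x + q) * p)"
    by (auto simp: fun_eq_iff DERIV_imp_deriv)
  with * Suc show ?case
    by (auto simp: diff_upto_Suc real_differentiable_def intro!: diff_upto_mult diff_upto_const)
qed

lemma smooth_const: "smooth (\<lambda>x. c)"
  and smooth_add: "smooth f \<Longrightarrow> smooth g \<Longrightarrow> smooth (\<lambda>x. f x + g x)"
  and smooth_mult: "smooth f \<Longrightarrow> smooth g \<Longrightarrow> smooth (\<lambda>x. f x * g x)"
  and smooth_affine: "smooth f \<Longrightarrow> smooth (\<lambda>x. f (p * x + q))"
  by (auto simp: smooth_iff_diff_upto diff_upto_const diff_upto_add diff_upto_mult diff_upto_affine)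

lemma smooth_has_deriv: "smooth f \<Longrightarrow> (f has_real_derivative deriv f x) (at x)"
  unfolding smooth_iff_diff_upto by (metis DERIV_imp_deriv diff_upto_0 real_differentiable_def)

lemma smooth_deriv: "smooth f \<Longrightarrow> smooth (deriv f)"
  unfolding smooth_iff_diff_upto using diff_upto_Suc by blast

lemma smooth_continuous: "smooth f \<Longrightarrow> continuous_on S f"
  using smooth_has_deriv by (intro continuous_at_imp_continuous_on) (blast intro: DERIV_isCont)

lemma smooth_antideriv:
  assumes "smooth f" "\<And>x. (F has_real_derivative f x) (at x)"
  shows "smooth F"
proof -
  have "deriv F = f" using assms(2) by (auto simp: fun_eq_iff DERIV_imp_deriv)
  then have "diff_upto k F" for k
    using assms by (cases k) (auto simp: diff_upto_0 diff_upto_Suc smooth_iff_diff_upto real_differentiable_def)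
  then show ?thesis by (simp add: smooth_iff_diff_upto)
qed

section \<open>Explicit smooth functions and the closure properties of test functions\<close>

definition flat :: "nat \<Rightarrow> real \<Rightarrow> real" where
  "flat m x = (if x > 0 then exp (- 1 / x) / x ^ m else 0)"

text \<open>With y = 1/x this is the decay of y^m / exp y at infinity.\<close>

lemma flat_tendsto_0: "(flat m \<longlongrightarrow> 0) (at_right 0)"
proof -
  have "((\<lambda>y. y ^ m / exp y) \<longlongrightarrow> (0::real)) at_top" by (rule tendsto_power_div_exp_0)
  then have "((\<lambda>x. inverse x ^ m / exp (inverse x)) \<longlongrightarrow> (0::real)) (at_right 0)"
    by (rule filterlim_compose) (rule filterlim_inverse_at_top_right)
  then show ?thesis
    by (rule Lim_transform_eventually)
      (auto simp: eventually_at_filter flat_def exp_minus field_simps)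
qed

text \<open>The index \<open>m\<close> is there to close the family under differentiation: the
  exponential contributes 1/x^2 and the power contributes -m/x. Smoothness of exp(-1/x) then follows
  by induction for all \<open>m\<close> together.\<close>

lemma flat_has_deriv:
  "(flat m has_real_derivative (flat (m + 2) x - real m * flat (m + 1) x)) (at x)"
proof -
  consider "x > 0" | "x < 0" | "x = 0" by linarith
  then show ?thesis
  proof cases
    case 1
    have "((\<lambda>x. exp (- 1 / x) / x ^ m) has_real_derivative (flat (m + 2) x - real m * flat (m + 1) x)) (at x)"
    proof (cases m)
      case 0
      with 1 show ?thesis
        by (auto intro!: derivative_eq_intros simp: flat_def power2_eq_square)
    next
      case (Suc j)
      have "((\<lambda>x. x ^ m) has_real_derivative real m * x ^ j) (at x)"
        using DERIV_pow[of m x] Suc by simp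
      with 1 show ?thesis
        by (auto intro!: derivative_eq_intros simp: flat_def divide_simps power2_eq_square)
          (simp add: Suc algebra_simps power_add)
    qed
    then show ?thesis
      by (rule has_field_derivative_transform_within_open[of _ _ _ "{0<..}"])
        (use 1 in \<open>auto simp: flat_def\<close>)
  next
    case 2
    have "((\<lambda>x. 0) has_real_derivative (flat (m + 2) x - real m * flat (m + 1) x)) (at x)"
      using 2 by (auto simp: flat_def)
    then show ?thesis
      by (rule has_field_derivative_transform_within_open[of _ _ _ "{..<0}"])
        (use 2 in \<open>auto simp: flat_def\<close>)
  next
    case 3
    \<comment> \<open>To the right of 0 the difference quotient is itself
      \<open>flat (Suc m)\<close>, whose limit is known; to the left it is 0.\<close>
    have "((\<lambda>h. flat m h / h) \<longlongrightarrow> 0) (at 0)"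
    proof (rule filterlim_split_at_real)
      show "((\<lambda>h. flat m h / h) \<longlongrightarrow> 0) (at_left 0)"
        by (rule tendsto_eventually) (auto simp: eventually_at_filter flat_def)
      show "((\<lambda>h. flat m h / h) \<longlongrightarrow> 0) (at_right 0)"
        by (rule Lim_transform_eventually[OF flat_tendsto_0[of "Suc m"]])
          (auto simp: eventually_at_filter flat_def)
    qed
    then show ?thesis
      using 3 by (simp add: DERIV_def flat_def)
  qed
qed

lemma smooth_flat: "smooth (flat m)"
proof -
  have "diff_upto k (flat m)" for k
  proof (induction k arbitrary: m)
    case 0
    show ?case using flat_has_deriv by (auto simp: diff_upto_0 real_differentiable_def)
  next
    case (Suc k)
    have eq: "deriv (flat m) = (\<lambda>x. flat (m + 2) x + (- real m) * flat (m + 1) x)"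
      using DERIV_imp_deriv[OF flat_has_deriv[of m]] by (auto simp: fun_eq_iff)
    have "diff_upto k (deriv (flat m))"
      unfolding eq by (intro diff_upto_add diff_upto_mult diff_upto_const Suc.IH)
    then show ?case
      using flat_has_deriv by (auto simp: diff_upto_Suc real_differentiable_def)
  qed
  then show ?thesis by (simp add: smooth_iff_diff_upto)
qed

text \<open>A compact subset of the open interval lies between its minimum and maximum, so the
  closure of the support can be replaced by two end points that are easy to carry along.\<close>

lemma test_function_iff:
  "test_function \<phi> \<longleftrightarrow> smooth \<phi> \<and> (\<exists>a b. -1 < a \<and> a < b \<and> b < 1 \<and> (\<forall>x. x \<notin> {a..b} \<longrightarrow> \<phi> x = 0))"
    (is "?l \<longleftrightarrow> ?r")
proof
  assume l: ?l
  let ?K = "closure {x. \<phi> x \<noteq> 0}"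
  have K: "compact ?K" "?K \<subseteq> \<Omega>" using l by (auto simp: test_function_def)
  have "\<exists>a b. -1 < a \<and> a < b \<and> b < 1 \<and> (\<forall>x. x \<notin> {a..b} \<longrightarrow> \<phi> x = 0)"
  proof (cases "?K = {}")
    case True
    then have "\<phi> x = 0" for x by auto
    then show ?thesis by (intro exI[of _ 0] exI[of _ "1/2"]) auto
  next
    case False
    obtain m where m: "m \<in> ?K" "\<forall>y\<in>?K. m \<le> y" using compact_attains_inf[OF K(1) False] by blast
    obtain M where M: "M \<in> ?K" "\<forall>y\<in>?K. y \<le> M" using compact_attains_sup[OF K(1) False] by blast
    have *: "x \<in> {m..M}" if "\<phi> x \<noteq> 0" for x
      using that m(2) M(2) closure_subset[of "{x. \<phi> x \<noteq> 0}"] by auto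
    have "-1 < m" "M < 1" "m \<le> M" using m M K(2) by auto
    \<comment> \<open>Moving the right end from \<open>M\<close> towards 1 keeps the interval
      nondegenerate even if \<open>m = M\<close>.\<close>
    then have "-1 < m" "m < (M + 1) / 2" "(M + 1) / 2 < 1" "{m..M} \<subseteq> {m..(M + 1) / 2}" by auto
    with * show ?thesis by blast
  qed
  with l show ?r by (auto simp: test_function_def smooth_def)
next
  assume ?r
  then obtain a b where ab: "-1 < a" "a < b" "b < 1" "\<And>x. x \<notin> {a..b} \<Longrightarrow> \<phi> x = 0"
    and s: "smooth \<phi>" by blast
  have "closure {x. \<phi> x \<noteq> 0} \<subseteq> {a..b}"
    by (rule closure_minimal) (use ab(4) in blast, simp)
  moreover from this have "compact (closure {x. \<phi> x \<noteq> 0})"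
    by (meson bounded_closed_interval bounded_subset closed_closure compact_eq_bounded_closed)
  moreover have "{a..b} \<subseteq> \<Omega>" using ab by auto
  ultimately show ?l using s
    unfolding test_function_def smooth_def by (meson subset_trans)
qed

lemma deriv_eq_0_outside:
  assumes "\<And>x. x \<notin> {a..b::real} \<Longrightarrow> \<phi> x = (0::real)" "x \<notin> {a..b}"
  shows "deriv \<phi> x = 0"
proof (rule DERIV_imp_deriv)
  show "(\<phi> has_real_derivative 0) (at x)"
    by (rule has_field_derivative_transform_within_open[of "\<lambda>x. 0" _ _ "-{a..b}"])
      (use assms in auto)
qed

lemma test_function_deriv:
  assumes "test_function \<phi>"
  shows "test_function (deriv \<phi>)"
proof -
  obtain a b where ab: "-1 < a" "a < b" "b < 1" "\<And>x. x \<notin> {a..b} \<Longrightarrow> \<phi> x = 0"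
    using assms test_function_iff by auto
  have "\<forall>x. x \<notin> {a..b} \<longrightarrow> deriv \<phi> x = 0"
    using deriv_eq_0_outside[of a b \<phi>] ab(4) by blast
  with ab(1-3) assms show ?thesis
    unfolding test_function_iff using smooth_deriv by blast
qed

lemma test_function_add:
  assumes "test_function \<phi>" "test_function \<psi>"
  shows "test_function (\<lambda>x. \<phi> x + \<psi> x)"
proof -
  obtain a b where 1: "-1 < a" "a < b" "b < 1" "\<And>x. x \<notin> {a..b} \<Longrightarrow> \<phi> x = 0"
    using assms(1) test_function_iff by auto
  obtain a' b' where 2: "-1 < a'" "a' < b'" "b' < 1" "\<And>x. x \<notin> {a'..b'} \<Longrightarrow> \<psi> x = 0"
    using assms(2) test_function_iff by auto
  have "\<forall>x. x \<notin> {min a a'..max b b'} \<longrightarrow> \<phi> x + \<psi> x = 0"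
    using 1(4) 2(4) by (metis add_0 atLeastAtMost_iff max.cobounded1 max.cobounded2 min.cobounded1 min.cobounded2 order_trans)
  moreover have "-1 < min a a'" "min a a' < max b b'" "max b b' < 1" using 1 2 by auto
  moreover have "smooth (\<lambda>x. \<phi> x + \<psi> x)" using assms by (simp add: test_function_iff smooth_add)
  ultimately show ?thesis unfolding test_function_iff by blast
qed

lemma test_function_cmult: "test_function \<phi> \<Longrightarrow> test_function (\<lambda>x. c * \<phi> x)"
  by (fastforce simp: test_function_iff intro: smooth_mult smooth_const)

text \<open>Steepening both flanks by the factor \<open>Suc n\<close> makes these functions, with
  values in [0,1] and zero outside [a,b], converge pointwise to the indicator of (a,b). This is the
  form that dominated convergence needs.\<close>

definition bump :: "real \<Rightarrow> real \<Rightarrow> nat \<Rightarrow> real \<Rightarrow> real" where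
  "bump a b n x = flat 0 (real (Suc n) * (x - a)) * flat 0 (real (Suc n) * (b - x))"

lemma test_function_bump:
  assumes "-1 < a" "a < b" "b < 1"
  shows "test_function (bump a b n)"
proof -
  let ?m = "real (Suc n)"
  have "smooth (\<lambda>x. flat 0 (?m * x + - ?m * a) * flat 0 (- ?m * x + ?m * b))"
    by (intro smooth_mult smooth_affine smooth_flat)
  also have "(\<lambda>x. flat 0 (?m * x + - ?m * a) * flat 0 (- ?m * x + ?m * b)) = bump a b n"
    by (auto simp: bump_def fun_eq_iff algebra_simps)
  finally have "smooth (bump a b n)" .
  moreover have "\<forall>x. x \<notin> {a..b} \<longrightarrow> bump a b n x = 0"
    by (auto simp: bump_def flat_def zero_less_mult_iff)
  ultimately show ?thesis unfolding test_function_iff using assms by blast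
qed

lemma bump_bounds: "0 \<le> bump a b n x" "bump a b n x \<le> 1"
proof -
  have *: "0 \<le> flat 0 x" "flat 0 x \<le> 1" for x by (auto simp: flat_def)
  show "0 \<le> bump a b n x" "bump a b n x \<le> 1"
    unfolding bump_def using * by (auto intro!: mult_le_one)
qed

lemma bump_tendsto: "(\<lambda>n. bump a b n x) \<longlonglongrightarrow> indicator {a<..<b} x"
proof -
  have flat: "(\<lambda>n. flat 0 (real (Suc n) * y)) \<longlonglongrightarrow> (if y > 0 then 1 else 0)" for y
  proof (cases "y > 0")
    case True
    have "(\<lambda>n. exp (- (1 / y) * inverse (real (Suc n)))) \<longlonglongrightarrow> exp (- (1 / y) * 0)"
      by (intro tendsto_intros LIMSEQ_inverse_real_of_nat)
    moreover have "(\<lambda>n. exp (- (1 / y) * inverse (real (Suc n)))) = (\<lambda>n. flat 0 (real (Suc n) * y))"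
      using True by (auto simp: flat_def fun_eq_iff zero_less_mult_iff inverse_eq_divide simp del: of_nat_Suc)
    ultimately show ?thesis using True by simp
  next
    case False
    then show ?thesis by (simp add: flat_def zero_less_mult_iff)
  qed
  have "(\<lambda>n. bump a b n x) \<longlonglongrightarrow> (if x - a > 0 then 1 else 0) * (if b - x > 0 then 1 else 0)"
    unfolding bump_def by (intro tendsto_mult flat)
  then show ?thesis by (auto simp: indicator_def split: if_splits)
qed

subsection \<open>The fundamental lemma of the calculus of variations\<close>

text \<open>The positive and the negative part of \<open>h\<close> are densities of two measures
  that agree on all half-lines (x, infinity), hence are equal; so the two parts agree almost
  everywhere, which forces both to vanish.\<close>

lemma AE_zero_if_tail_integrals_zero:
  fixes h :: "real \<Rightarrow> real"
  assumes h: "integrable lebesgue h"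
    and 0: "\<And>x. (LINT y|lebesgue. indicator {x<..} y * h y) = 0"
  shows "AE x in lebesgue. h x = 0"
proof -
  \<comment> \<open>The uniqueness theorem for measures on half-lines is about Borel measures, hence
    the Borel representative.\<close>
  obtain g where g[measurable]: "g \<in> borel_measurable lborel" and hg: "AE x in lborel. h x = g x"
    using completion_ex_borel_measurable_real[OF borel_measurable_integrable[OF h]] by blast
  have hg': "AE x in lebesgue. h x = g x" by (rule AE_completion[OF hg])
  have "integrable lebesgue g"
    using h hg' g by (subst integrable_cong_AE[of g _ h]) (auto simp: measurable_completion)
  then have gi: "integrable lborel g" by (subst (asm) integrable_completion) auto
  have tail: "(LINT y|lborel. indicator {x<..} y * g y) = 0" for x
  proof -
    have "(LINT y|lborel. indicator {x<..} y * g y) = (LINT y|lebesgue. indicator {x<..} y * g y)"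
      by (subst integral_completion) auto
    also have "\<dots> = (LINT y|lebesgue. indicator {x<..} y * h y)"
      using hg' h by (intro integral_cong_AE borel_measurable_times) (auto simp: measurable_completion)
    finally show ?thesis using 0 by simp
  qed
  \<comment> \<open>\<open>ennreal\<close> sends negative reals to 0, so these densities are the
    positive and the negative part of \<open>g\<close>.\<close>
  let ?M = "density lborel (\<lambda>x. ennreal (g x))" and ?N = "density lborel (\<lambda>x. ennreal (- g x))"
  have "?M = ?N"
  proof (rule measure_eqI_lessThan)
    fix x :: real
    let ?k = "\<lambda>y. indicator {x<..} y * g y"
    have k: "integrable lborel ?k" using gi by (auto intro: integrable_real_mult_indicator simp: mult.commute)
    have fin: "(\<integral>\<^sup>+ y. ennreal (?k y) \<partial>lborel) < \<infinity>" "(\<integral>\<^sup>+ y. ennreal (- ?k y) \<partial>lborel) < \<infinity>"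
      using real_integrable_def[of lborel ?k] k by (auto simp: less_top)
    have M: "emeasure ?M {x<..} = (\<integral>\<^sup>+ y. ennreal (?k y) \<partial>lborel)"
      by (subst emeasure_density) (auto intro!: nn_integral_cong simp: indicator_def)
    have N: "emeasure ?N {x<..} = (\<integral>\<^sup>+ y. ennreal (- ?k y) \<partial>lborel)"
      by (subst emeasure_density) (auto intro!: nn_integral_cong simp: indicator_def)
    show "emeasure ?M {x<..} < \<infinity>" using fin M by simp
    have "enn2real (\<integral>\<^sup>+ y. ennreal (?k y) \<partial>lborel) = enn2real (\<integral>\<^sup>+ y. ennreal (- ?k y) \<partial>lborel)"
      using real_lebesgue_integral_def[OF k] tail[of x] by simp
    then show "emeasure ?M {x<..} = emeasure ?N {x<..}"
      using fin unfolding M N by (metis ennreal_enn2real infinity_ennreal_def)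
  qed auto
  then have "AE x in lborel. ennreal (g x) = ennreal (- g x)"
    by (intro sigma_finite_measure.density_unique[OF sigma_finite_lborel]) auto
  then have "AE x in lborel. g x = 0"
  proof eventually_elim
    case (elim x)
    show ?case
    proof (rule ccontr)
      assume "g x \<noteq> 0"
      then consider "g x > 0" | "- g x > 0" by linarith
      then show False by cases (use elim in \<open>auto simp: ennreal_neg ennreal_eq_0_iff\<close>)
    qed
  qed
  then have "AE x in lborel. h x = 0" using hg by eventually_elim simp
  then show ?thesis by (rule AE_completion)
qed

lemma locally_integrable_indicator:
  assumes "locally_integrable h" "-1 < a" "b < 1"
  shows "integrable lebesgue (\<lambda>x. indicator {a..b} x * h x)"
proof -
  have "{a..b} \<subseteq> \<Omega>" using assms by auto
  then have "integrable (lebesgue_on {a..b}) h"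
    using assms unfolding locally_integrable_def by simp
  then show ?thesis by (subst (asm) integrable_restrict_space) auto
qed

lemma integral_eq_indicator_integral:
  fixes h \<phi> :: "real \<Rightarrow> real"
  assumes "-1 < a" "b < 1" "\<And>x. x \<notin> {a..b} \<Longrightarrow> \<phi> x = 0"
  shows "(LINT x|lebesgue_on \<Omega>. h x * \<phi> x) = (LINT x|lebesgue. (indicator {a..b} x * h x) * \<phi> x)"
proof -
  have "(LINT x|lebesgue_on \<Omega>. h x * \<phi> x) = (LINT x|lebesgue. indicator \<Omega> x *\<^sub>R (h x * \<phi> x))"
    by (subst integral_restrict_space) auto
  also have "\<dots> = (LINT x|lebesgue. (indicator {a..b} x * h x) * \<phi> x)"
    using assms by (intro Bochner_Integration.integral_cong) (auto simp: indicator_def)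
  finally show ?thesis .
qed

lemma continuous_measurable_lebesgue:
  "continuous_on UNIV (f :: real \<Rightarrow> real) \<Longrightarrow> f \<in> borel_measurable lebesgue"
  by (simp add: borel_measurable_continuous_onI measurable_completion)

lemma test_function_bounded:
  assumes "test_function \<phi>"
  obtains B where "\<And>x. \<bar>\<phi> x\<bar> \<le> B"
proof -
  obtain a b where s: "smooth \<phi>" and ab: "-1 < a" "a < b" "b < 1" "\<And>x. x \<notin> {a..b} \<Longrightarrow> \<phi> x = 0"
    using assms test_function_iff by auto
  have "compact (\<phi> ` {a..b})" by (intro compact_continuous_image smooth_continuous s) simp
  then obtain B where B: "\<And>x. x \<in> {a..b} \<Longrightarrow> \<bar>\<phi> x\<bar> \<le> B"
    by (metis bounded_real compact_imp_bounded imageI)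
  have "\<bar>\<phi> x\<bar> \<le> max B 0" for x using B[of x] ab(4)[of x] by (cases "x \<in> {a..b}") auto
  then show thesis using that by blast
qed

lemma test_function_measurable: "test_function \<phi> \<Longrightarrow> \<phi> \<in> borel_measurable lebesgue"
  by (auto simp: test_function_iff intro!: continuous_measurable_lebesgue smooth_continuous)

lemma integrable_mult_bounded:
  fixes h \<phi> :: "'a \<Rightarrow> real"
  assumes "integrable M h" "\<phi> \<in> borel_measurable M" "\<And>x. x \<in> space M \<Longrightarrow> \<bar>\<phi> x\<bar> \<le> B"
  shows "integrable M (\<lambda>x. h x * \<phi> x)"
proof (rule Bochner_Integration.integrable_bound)
  show "integrable M (\<lambda>x. \<bar>h x\<bar> * B)" using assms by auto
  show "AE x in M. norm (h x * \<phi> x) \<le> norm (\<bar>h x\<bar> * B)"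
  proof (rule AE_I2)
    fix x assume "x \<in> space M"
    then have "\<bar>\<phi> x\<bar> \<le> \<bar>B\<bar>" using assms(3)[of x] by auto
    then show "norm (h x * \<phi> x) \<le> norm (\<bar>h x\<bar> * B)"
      by (simp add: abs_mult mult_left_mono)
  qed
qed (use assms in auto)

lemma locally_integrable_mult_test:
  assumes "locally_integrable h" "test_function \<phi>"
  shows "integrable (lebesgue_on \<Omega>) (\<lambda>x. h x * \<phi> x)"
proof -
  obtain a b where ab: "-1 < a" "a < b" "b < 1" "\<And>x. x \<notin> {a..b} \<Longrightarrow> \<phi> x = 0"
    using assms test_function_iff by auto
  obtain B where B: "\<And>x. \<bar>\<phi> x\<bar> \<le> B" using test_function_bounded[OF assms(2)] by blast
  have "integrable lebesgue (\<lambda>x. (indicator {a..b} x * h x) * \<phi> x)"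
    by (intro integrable_mult_bounded[where B = B] locally_integrable_indicator assms ab test_function_measurable B)
  also have "(\<lambda>x. (indicator {a..b} x * h x) * \<phi> x) = (\<lambda>x. indicator \<Omega> x *\<^sub>R (h x * \<phi> x))"
    using ab by (auto simp: fun_eq_iff indicator_def)
  finally show ?thesis by (subst integrable_restrict_space) auto
qed

text \<open>Bumps approximate indicators of intervals, so testing against them makes the integral of
  \<open>h\<close> over every interval compactly inside \<open>\<Omega>\<close> vanish; the tail
  criterion then applies to \<open>h\<close> cut off to [c,d].\<close>

lemma fundamental_lemma:
  assumes h: "locally_integrable h"
    and 0: "\<And>\<phi>. test_function \<phi> \<Longrightarrow> (LINT x|lebesgue_on \<Omega>. h x * \<phi> x) = 0"
  shows "AE x in lebesgue_on \<Omega>. h x = 0"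
proof -
  have on_Icc: "AE x in lebesgue. indicator {c..d} x * h x = 0" if cd: "-1 < c" "d < 1" for c d
  proof (rule AE_zero_if_tail_integrals_zero)
    show hi: "integrable lebesgue (\<lambda>x. indicator {c..d} x * h x)"
      using locally_integrable_indicator[OF h cd] .
    fix x
    \<comment> \<open>Up to end points, the half-line beyond \<open>x\<close> meets [c,d] in (a,d),
      and this is empty when \<open>a\<close> reaches \<open>d\<close>.\<close>
    define a where "a = max x c"
    have a: "-1 < a" "c \<le> a" using cd by (auto simp: a_def)
    show "(LINT y|lebesgue. indicator {x<..} y * (indicator {c..d} y * h y)) = 0"
    proof (cases "a < d")
      case True
      let ?s = "\<lambda>n y. (indicator {a..d} y * h y) * bump a d n y"
      have ha: "integrable lebesgue (\<lambda>x. indicator {a..d} x * h x)"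
        using locally_integrable_indicator[OF h a(1) cd(2)] .
      have "(\<lambda>n. LINT y|lebesgue. ?s n y) \<longlonglongrightarrow> (LINT y|lebesgue. (indicator {a..d} y * h y) * indicator {a<..<d} y)"
      proof (rule integral_dominated_convergence)
        show "integrable lebesgue (\<lambda>y. \<bar>indicator {a..d} y * h y\<bar>)" using ha by auto
        show "AE y in lebesgue. (\<lambda>n. ?s n y) \<longlonglongrightarrow> (indicator {a..d} y * h y) * indicator {a<..<d} y"
          by (intro AE_I2 tendsto_mult tendsto_const bump_tendsto)
        show "AE y in lebesgue. norm (?s n y) \<le> \<bar>indicator {a..d} y * h y\<bar>" for n
          using bump_bounds[of a d n] by (intro AE_I2) (auto simp: abs_mult indicator_def intro!: mult_left_le)
        show "?s n \<in> borel_measurable lebesgue" for n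
          using ha test_function_measurable[OF test_function_bump[OF a(1) True cd(2)]]
          by (intro borel_measurable_times[OF borel_measurable_integrable]) auto
        show "(\<lambda>y. (indicator {a..d} y * h y) * indicator {a<..<d} y) \<in> borel_measurable lebesgue"
          by (intro borel_measurable_times[OF borel_measurable_integrable[OF ha]] borel_measurable_indicator) simp
      qed
      moreover have "(LINT y|lebesgue. ?s n y) = 0" for n
      proof -
        have "bump a d n y = 0" if "y \<notin> {a..d}" for y
          using that by (auto simp: bump_def flat_def zero_less_mult_iff)
        then show ?thesis
          using 0[OF test_function_bump[OF a(1) True cd(2), of n]]
            integral_eq_indicator_integral[OF a(1) cd(2), of "bump a d n" h] by simp
      qed
      ultimately have *: "(LINT y|lebesgue. (indicator {a..d} y * h y) * indicator {a<..<d} y) = 0"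
        by (simp add: LIMSEQ_const_iff)
      have "AE y in lebesgue. y \<noteq> d \<and> y \<noteq> c"
        by (intro AE_conjI AE_completion AE_lborel_singleton)
      then have "AE y in lebesgue. indicator {x<..} y * (indicator {c..d} y * h y)
             = (indicator {a..d} y * h y) * indicator {a<..<d} y"
        by eventually_elim (auto simp: indicator_def a_def)
      then have "(LINT y|lebesgue. indicator {x<..} y * (indicator {c..d} y * h y))
             = (LINT y|lebesgue. (indicator {a..d} y * h y) * indicator {a<..<d} y)"
        by (intro integral_cong_AE borel_measurable_times[OF borel_measurable_integrable[OF ha] borel_measurable_indicator]
            borel_measurable_times[OF borel_measurable_indicator borel_measurable_integrable[OF hi]]) auto
      with * show ?thesis by simp
    next
      case False
      have "AE y in lebesgue. y \<noteq> d"
        by (intro AE_completion AE_lborel_singleton)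
      then have "AE y in lebesgue. indicator {x<..} y * (indicator {c..d} y * h y) = 0"
        by eventually_elim (use False in \<open>auto simp: indicator_def a_def\<close>)
      then show ?thesis by (rule integral_eq_zero_AE)
    qed
  qed
  \<comment> \<open>Countably many compact intervals exhaust \<open>\<Omega>\<close>, so the
    exceptional sets still add up to a null set.\<close>
  have "AE x in lebesgue. \<forall>n. indicator {- 1 + 1 / real (Suc n)..1 - 1 / real (Suc n)} x * h x = 0"
    unfolding AE_all_countable by (intro allI on_Icc) auto
  then have "AE x in lebesgue. x \<in> \<Omega> \<longrightarrow> h x = 0"
  proof eventually_elim
    case (elim x)
    show ?case
    proof
      assume "x \<in> \<Omega>"
      then have "min (1 + x) (1 - x) > 0" by auto
      then obtain n where "inverse (real (Suc n)) < min (1 + x) (1 - x)"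
        using reals_Archimedean by blast
      then have "x \<in> {- 1 + 1 / real (Suc n)..1 - 1 / real (Suc n)}"
        by (auto simp: inverse_eq_divide)
      with elim[rule_format, of n] show "h x = 0" by (simp add: indicator_def)
    qed
  qed
  then show ?thesis by (subst AE_restrict_space_iff) auto
qed

subsection \<open>Weak derivatives and integration by parts\<close>

lemma integrable_imp_locally_integrable:
  assumes "integrable (lebesgue_on \<Omega>) f"
  shows "locally_integrable f"
  unfolding locally_integrable_def
proof (intro allI impI)
  fix K :: "real set" assume K: "compact K \<and> K \<subseteq> \<Omega>"
  then have "K \<in> sets lebesgue" by (simp add: borel_compact)
  moreover have "integrable lebesgue (\<lambda>x. indicator \<Omega> x *\<^sub>R f x)"
    using assms by (subst (asm) integrable_restrict_space) auto
  ultimately have "integrable lebesgue (\<lambda>x. indicator K x *\<^sub>R (indicator \<Omega> x *\<^sub>R f x))"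
    by (rule integrable_mult_indicator)
  also have "(\<lambda>x. indicator K x *\<^sub>R (indicator \<Omega> x *\<^sub>R f x)) = (\<lambda>x. indicator K x *\<^sub>R f x)"
    using K by (auto simp: indicator_def fun_eq_iff)
  finally show "integrable (lebesgue_on K) f"
    using \<open>K \<in> sets lebesgue\<close> by (subst integrable_restrict_space) auto
qed

lemma locally_integrable_diff:
  "locally_integrable f \<Longrightarrow> locally_integrable g \<Longrightarrow> locally_integrable (\<lambda>x. f x - g x)"
  unfolding locally_integrable_def by auto

lemma test_function_funpow_deriv: "test_function \<phi> \<Longrightarrow> test_function ((deriv ^^ k) \<phi>)"
  by (induction k) (auto intro: test_function_deriv)

lemma has_weak_deriv_diff:
  assumes "has_weak_deriv k f g" "has_weak_deriv k f' g'"
  shows "has_weak_deriv k (\<lambda>x. f x - f' x) (\<lambda>x. g x - g' x)"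
  unfolding has_weak_deriv_def
proof (intro conjI allI impI)
  show "locally_integrable (\<lambda>x. f x - f' x)" "locally_integrable (\<lambda>x. g x - g' x)"
    using assms by (auto simp: has_weak_deriv_def intro: locally_integrable_diff)
  fix \<phi> assume \<phi>: "test_function \<phi>"
  have "(LINT x|lebesgue_on \<Omega>. (f x - f' x) * (deriv ^^ k) \<phi> x)
      = (LINT x|lebesgue_on \<Omega>. f x * (deriv ^^ k) \<phi> x) - (LINT x|lebesgue_on \<Omega>. f' x * (deriv ^^ k) \<phi> x)"
    using assms \<phi> unfolding left_diff_distrib
    by (intro Bochner_Integration.integral_diff locally_integrable_mult_test test_function_funpow_deriv)
      (auto simp: has_weak_deriv_def)
  also have "\<dots> = (-1) ^ k * ((LINT x|lebesgue_on \<Omega>. g x * \<phi> x) - (LINT x|lebesgue_on \<Omega>. g' x * \<phi> x))"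
    using assms \<phi> by (simp add: has_weak_deriv_def right_diff_distrib)
  also have "(LINT x|lebesgue_on \<Omega>. g x * \<phi> x) - (LINT x|lebesgue_on \<Omega>. g' x * \<phi> x)
     = (LINT x|lebesgue_on \<Omega>. (g x - g' x) * \<phi> x)"
    using assms \<phi> unfolding left_diff_distrib
    by (intro Bochner_Integration.integral_diff[symmetric] locally_integrable_mult_test)
      (auto simp: has_weak_deriv_def)
  finally show "(LINT x|lebesgue_on \<Omega>. (f x - f' x) * (deriv ^^ k) \<phi> x)
     = (-1) ^ k * (LINT x|lebesgue_on \<Omega>. (g x - g' x) * \<phi> x)" .
qed

text \<open>This is what makes the choice in \<open>weak_deriv\<close> harmless: the chosen function
  agrees almost everywhere with any weak derivative known by other means.\<close>

lemma has_weak_deriv_unique: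
  assumes "has_weak_deriv k f g" "has_weak_deriv k f g'"
  shows "AE x in lebesgue_on \<Omega>. g x = g' x"
proof -
  have "AE x in lebesgue_on \<Omega>. g x - g' x = 0"
  proof (rule fundamental_lemma)
    fix \<phi> assume \<phi>: "test_function \<phi>"
    show "(LINT x|lebesgue_on \<Omega>. (g x - g' x) * \<phi> x) = 0"
      using has_weak_deriv_diff[OF assms] \<phi> by (auto simp: has_weak_deriv_def)
  qed (use assms in \<open>auto simp: has_weak_deriv_def intro: locally_integrable_diff\<close>)
  then show ?thesis by eventually_elim simp
qed

lemma has_weak_deriv_cong_AE:
  assumes "has_weak_deriv k f g" "AE x in lebesgue_on \<Omega>. f x = f' x" "locally_integrable f'"
  shows "has_weak_deriv k f' g"
  unfolding has_weak_deriv_def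
proof (intro conjI allI impI)
  fix \<phi> assume \<phi>: "test_function \<phi>"
  have "(LINT x|lebesgue_on \<Omega>. f' x * (deriv ^^ k) \<phi> x) = (LINT x|lebesgue_on \<Omega>. f x * (deriv ^^ k) \<phi> x)"
    by (intro integral_cong_AE borel_measurable_integrable locally_integrable_mult_test test_function_funpow_deriv)
      (use assms \<phi> in \<open>auto simp: has_weak_deriv_def\<close>)
  then show "(LINT x|lebesgue_on \<Omega>. f' x * (deriv ^^ k) \<phi> x) = (-1) ^ k * (LINT x|lebesgue_on \<Omega>. g x * \<phi> x)"
    using assms \<phi> by (auto simp: has_weak_deriv_def)
qed (use assms in \<open>auto simp: has_weak_deriv_def\<close>)

section \<open>Integrals over the open and the closed interval, du Bois-Reymond's lemma, integration
  by parts\<close>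

lemma integrable_lebesgue_on_Icc:
  fixes f :: "real \<Rightarrow> real"
  assumes "integrable (lebesgue_on \<Omega>) f" "-1 \<le> a" "b \<le> 1"
  shows "integrable (lebesgue_on {a..b}) f"
proof -
  have "set_integrable lebesgue \<Omega> f"
    using assms(1) unfolding set_integrable_def by (subst (asm) integrable_restrict_space) auto
  then have "f absolutely_integrable_on {-1..1}"
    using absolutely_integrable_on_open_interval[where a="-1" and b=1 and f=f] by (simp add: box_real cbox_interval)
  then have "f absolutely_integrable_on {a..b}"
    by (rule set_integrable_subset) (use assms in auto)
  then show ?thesis
    unfolding set_integrable_def by (subst integrable_restrict_space) auto
qed

text \<open>The bridge from Lebesgue integrals over the open interval, in which weak derivatives and
  \<open>A_D\<close> are stated, to gauge integrals over the closed one, where the fundamental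
  theorem of calculus and splitting of intervals are available.\<close>

lemma LINT_Omega_eq_integral:
  fixes f :: "real \<Rightarrow> real"
  assumes "integrable (lebesgue_on \<Omega>) f"
  shows "(LINT x|lebesgue_on \<Omega>. f x) = integral {-1..1} f"
  using lebesgue_integral_eq_integral[OF assms] by (simp add: integral_open_interval_real)

lemma continuous_integrable_Omega:
  fixes f :: "real \<Rightarrow> real"
  assumes "continuous_on {-1..1} f"
  shows "integrable (lebesgue_on \<Omega>) f"
proof -
  have "f absolutely_integrable_on {-1..1}"
    using absolutely_integrable_continuous_real[OF assms] .
  then have "f absolutely_integrable_on \<Omega>"
    by (rule set_integrable_subset) auto
  then show ?thesis
    unfolding set_integrable_def by (subst integrable_restrict_space) auto
qed

lemma test_function_continuous: "test_function \<phi> \<Longrightarrow> continuous_on S \<phi>"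
  by (auto simp: test_function_iff intro: smooth_continuous)

text \<open>The primitive from -1 vanishes to the left of the support for trivial reasons, and to
  the right exactly because the mean is zero; hence it has compact support again.\<close>

lemma test_function_antideriv:
  assumes \<zeta>: "test_function \<zeta>" and 0: "integral {-1..1} \<zeta> = 0"
  shows "\<exists>X. test_function X \<and> deriv X = \<zeta>"
proof -
  obtain a b where s: "smooth \<zeta>" and ab: "-1 < a" "a < b" "b < 1" "\<And>x. x \<notin> {a..b} \<Longrightarrow> \<zeta> x = 0"
    using \<zeta> test_function_iff by auto
  define X where "X x = integral {-1..x} \<zeta>" for x
  have int: "\<zeta> integrable_on {c..d}" for c d
    by (intro integrable_continuous_interval smooth_continuous s)
  have left: "X x = 0" if "x \<le> a" for x
  proof -
    have "X x = integral {-1..x} (\<lambda>x. 0)"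
      unfolding X_def by (rule integral_spike[of "{a}"]) (use ab that in auto)
    then show ?thesis by simp
  qed
  have right: "X x = 0" if "x \<ge> b" for x
  proof -
    have "integral {b..y} \<zeta> = 0" if "y \<ge> b" for y
    proof -
      have "integral {b..y} \<zeta> = integral {b..y} (\<lambda>x. 0)"
        by (rule integral_spike[of "{b}"]) (use ab that in auto)
      then show ?thesis by simp
    qed
    moreover have "X y = X b + integral {b..y} \<zeta>" if "y \<ge> b" for y
      unfolding X_def using that ab int by (intro Henstock_Kurzweil_Integration.integral_combine[symmetric]) auto
    moreover have "X 1 = 0" using 0 by (simp add: X_def)
    ultimately show ?thesis using that ab by (metis add.right_neutral less_imp_le)
  qed
  have X: "(X has_real_derivative \<zeta> x) (at x)" for x
  proof (cases "x < a")
    case True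
    then have "((\<lambda>x. 0) has_real_derivative \<zeta> x) (at x)" using ab by simp
    then show ?thesis
      by (rule has_field_derivative_transform_within_open[of _ _ _ "{..<a}"]) (use True left in auto)
  next
    case False
    have "(X has_real_derivative \<zeta> x) (at x within {-1..x+1})"
      unfolding X_def using False ab by (intro integral_has_real_derivative smooth_continuous s) auto
    then show ?thesis using False ab by (subst (asm) at_within_interior) auto
  qed
  have "test_function X"
    unfolding test_function_iff using ab left right smooth_antideriv[OF s X]
    by (metis atLeastAtMost_iff linorder_le_cases)
  moreover have "deriv X = \<zeta>" using X by (auto simp: fun_eq_iff DERIV_imp_deriv)
  ultimately show ?thesis by blast
qed

lemma test_function_unit_mass: "\<exists>\<phi>. test_function \<phi> \<and> integral {-1..1} \<phi> = 1"
proof -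
  let ?\<beta> = "bump (-1/2) (1/2) 0"
  have t: "test_function ?\<beta>" by (rule test_function_bump) auto
  have c: "continuous_on S ?\<beta>" for S by (rule test_function_continuous[OF t])
  have "integral {-1..1} ?\<beta> \<noteq> 0"
  proof
    assume "integral {-1..1} ?\<beta> = 0"
    then have "?\<beta> 0 = 0"
      using integral_eq_0_iff[OF c, of "-1" 1] bump_bounds by auto
    then show False by (simp add: bump_def flat_def)
  qed
  then show ?thesis
    using test_function_cmult[OF t, of "1 / integral {-1..1} ?\<beta>"]
    by (intro exI[of _ "\<lambda>x. 1 / integral {-1..1} ?\<beta> * ?\<beta> x"]) simp
qed

text \<open>Every test function is the derivative of a test function plus a multiple of one fixed
  \<open>\<beta>\<close> of unit mass. The derivative is annihilated by \<open>h\<close>, so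
  \<open>h\<close> acts like the constant obtained by testing it against \<open>\<beta>\<close>, and
  the fundamental lemma finishes.\<close>

lemma du_Bois_Reymond:
  assumes h: "locally_integrable h"
    and 0: "\<And>\<phi>. test_function \<phi> \<Longrightarrow> (LINT x|lebesgue_on \<Omega>. h x * deriv \<phi> x) = 0"
  shows "\<exists>c. AE x in lebesgue_on \<Omega>. h x = c"
proof -
  obtain \<beta> where \<beta>: "test_function \<beta>" "integral {-1..1} \<beta> = 1" using test_function_unit_mass by blast
  define c where "c = (LINT x|lebesgue_on \<Omega>. h x * \<beta> x)"
  have lc: "locally_integrable (\<lambda>x. c)"
    by (intro integrable_imp_locally_integrable continuous_integrable_Omega) auto
  have "AE x in lebesgue_on \<Omega>. h x - c = 0"
  proof (rule fundamental_lemma)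
    show "locally_integrable (\<lambda>x. h x - c)" by (intro locally_integrable_diff h lc)
    fix \<psi> assume \<psi>: "test_function \<psi>"
    define m where "m = integral {-1..1} \<psi>"
    \<comment> \<open>Subtracting \<open>m\<close> times the unit mass removes the mean, so what
      remains has an antiderivative among test functions.\<close>
    have "test_function (\<lambda>x. \<psi> x + (- m) * \<beta> x)"
      by (intro test_function_add test_function_cmult \<psi> \<beta>)
    moreover have "integral {-1..1} (\<lambda>x. \<psi> x + (- m) * \<beta> x) = 0"
      by (subst Henstock_Kurzweil_Integration.integral_add)
        (auto simp: m_def \<beta> intro!: integrable_continuous_interval continuous_intros test_function_continuous[OF \<psi>] test_function_continuous[OF \<beta>(1)])
    ultimately obtain X where X: "test_function X" "deriv X = (\<lambda>x. \<psi> x + (- m) * \<beta> x)"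
      using test_function_antideriv by blast
    have i: "integrable (lebesgue_on \<Omega>) (\<lambda>x. h x * \<psi> x)" "integrable (lebesgue_on \<Omega>) (\<lambda>x. h x * \<beta> x)"
       "integrable (lebesgue_on \<Omega>) (\<lambda>x. c * \<psi> x)"
      by (intro locally_integrable_mult_test h lc \<psi> \<beta>)+
    have "0 = (LINT x|lebesgue_on \<Omega>. h x * \<psi> x - m * (h x * \<beta> x))"
      using 0[OF X(1)] unfolding X(2) by (simp add: algebra_simps)
    also have "\<dots> = (LINT x|lebesgue_on \<Omega>. h x * \<psi> x) - m * c"
      using i by (simp add: c_def)
    also have "m = (LINT x|lebesgue_on \<Omega>. \<psi> x)"
      unfolding m_def
      by (intro LINT_Omega_eq_integral[symmetric] continuous_integrable_Omega test_function_continuous \<psi>)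
    finally have "(LINT x|lebesgue_on \<Omega>. h x * \<psi> x) = (LINT x|lebesgue_on \<Omega>. c * \<psi> x)"
      by simp
    then show "(LINT x|lebesgue_on \<Omega>. (h x - c) * \<psi> x) = 0"
      unfolding left_diff_distrib Bochner_Integration.integral_diff[OF i(1,3)] by simp
  qed
  then show ?thesis by (intro exI[of _ c]) (auto elim: eventually_mono)
qed

text \<open>As \<open>g\<close> is merely integrable, its primitive need not be differentiable
  everywhere and the product rule is not at hand. Instead, Fubini is applied to
  \<open>g y * \<phi>' x\<close> on the triangle y <= x: the integral over y produces the primitive,
  the one over x produces \<open>\<phi> b - \<phi> y\<close>.\<close>

lemma integration_by_parts_indefinite:
  fixes g \<phi> \<phi>' :: "real \<Rightarrow> real"
  assumes g: "integrable (lebesgue_on {a..b}) g" and ab: "a \<le> b"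
    and \<phi>: "\<And>x. x \<in> {a..b} \<Longrightarrow> (\<phi> has_real_derivative \<phi>' x) (at x within {a..b})"
    and \<phi>': "continuous_on {a..b} \<phi>'"
  shows "integral {a..b} (\<lambda>x. g x * \<phi> x)
       = integral {a..b} g * \<phi> b - integral {a..b} (\<lambda>x. integral {a..x} g * \<phi>' x)"
proof -
  let ?M = "lebesgue_on {a..b}"
  interpret finite_measure ?M by (rule finite_measure_lebesgue_on) simp
  interpret pair_sigma_finite ?M ?M ..
  have [measurable]: "g \<in> borel_measurable ?M" using g by auto
  have [measurable]: "\<phi>' \<in> borel_measurable ?M"
    by (rule continuous_imp_measurable_on_sets_lebesgue[OF \<phi>']) simp
  have [measurable]: "(\<lambda>x. x) \<in> borel_measurable ?M"
    by (rule continuous_imp_measurable_on_sets_lebesgue) auto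
  have "compact (\<phi>' ` {a..b})" by (intro compact_continuous_image \<phi>') simp
  then obtain B where B: "\<And>x. x \<in> {a..b} \<Longrightarrow> \<bar>\<phi>' x\<bar> \<le> B"
    by (metis bounded_real compact_imp_bounded imageI)
  have \<phi>c: "continuous_on {a..b} \<phi>"
    using \<phi> by (meson DERIV_continuous continuous_on_eq_continuous_within)
  let ?f = "\<lambda>x y. if y \<le> x then g y * \<phi>' x else 0"
  have gp: "integrable (?M \<Otimes>\<^sub>M ?M) (\<lambda>(x, y). g y)"
    by (rule Fubini_integrable) (use g in auto)
  have f: "integrable (?M \<Otimes>\<^sub>M ?M) (\<lambda>(x, y). ?f x y)"
  proof (rule Bochner_Integration.integrable_bound)
    show "integrable (?M \<Otimes>\<^sub>M ?M) (\<lambda>p. B * (case p of (x, y) \<Rightarrow> g y))" using gp by auto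
    show "(\<lambda>(x, y). ?f x y) \<in> borel_measurable (?M \<Otimes>\<^sub>M ?M)" by measurable
    show "AE p in ?M \<Otimes>\<^sub>M ?M. norm (case p of (x, y) \<Rightarrow> ?f x y) \<le> norm (B * (case p of (x, y) \<Rightarrow> g y))"
    proof (rule AE_I2)
      fix p assume "p \<in> space (?M \<Otimes>\<^sub>M ?M)"
      then have "\<bar>\<phi>' (fst p)\<bar> \<le> B" using B by (auto simp: space_pair_measure)
      then have "\<bar>\<phi>' (fst p)\<bar> \<le> \<bar>B\<bar>" by simp
      then show "norm (case p of (x, y) \<Rightarrow> ?f x y) \<le> norm (B * (case p of (x, y) \<Rightarrow> g y))"
        by (auto simp: case_prod_beta abs_mult mult.commute[of "\<bar>B\<bar>"] intro!: mult_left_mono)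
    qed
  qed
  have int_if: "(LINT y|?M. (if y \<in> T then h y else 0)) = integral ({a..b} \<inter> T) h"
    if "integrable ?M h" "T \<in> sets lebesgue" for h :: "real \<Rightarrow> real" and T
  proof -
    have "integrable ?M (\<lambda>y. h y * indicator T y)"
      by (rule integrable_mult_bounded[where B = 1])
        (use that in \<open>simp_all add: measurable_restrict_space1 borel_measurable_indicator indicator_def del: borel_measurable_indicator_iff\<close>)
    also have "(\<lambda>y. h y * indicator T y) = (\<lambda>y. if y \<in> T then h y else 0)" by (auto simp: indicator_def)
    finally show ?thesis
      by (simp add: lebesgue_integral_eq_integral Henstock_Kurzweil_Integration.integral_restrict_Int Int_commute)
  qed
  have \<phi>'i: "integrable ?M \<phi>'"
    using absolutely_integrable_continuous_real[OF \<phi>'] unfolding set_integrable_def by (subst integrable_restrict_space) auto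
  have in1: "(LINT y|?M. ?f x y) = integral {a..x} g * \<phi>' x" if "x \<in> {a..b}" for x
  proof -
    have "(LINT y|?M. ?f x y) = (LINT y|?M. (if y \<in> {..x} then g y else 0) * \<phi>' x)"
      by (intro Bochner_Integration.integral_cong) auto
    also have "\<dots> = (LINT y|?M. (if y \<in> {..x} then g y else 0)) * \<phi>' x" by simp
    also have "(LINT y|?M. (if y \<in> {..x} then g y else 0)) = integral ({a..b} \<inter> {..x}) g"
      by (rule int_if[OF g]) simp
    also have "{a..b} \<inter> {..x} = {a..x}" using that by auto
    finally show ?thesis .
  qed
  have in2: "(LINT x|?M. ?f x y) = g y * (\<phi> b - \<phi> y)" if "y \<in> {a..b}" for y
  proof -
    have "(LINT x|?M. ?f x y) = (LINT x|?M. g y * (if x \<in> {y..} then \<phi>' x else 0))"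
      by (intro Bochner_Integration.integral_cong) auto
    also have "\<dots> = g y * (LINT x|?M. (if x \<in> {y..} then \<phi>' x else 0))" by simp
    also have "(LINT x|?M. (if x \<in> {y..} then \<phi>' x else 0)) = integral ({a..b} \<inter> {y..}) \<phi>'"
      by (rule int_if[OF \<phi>'i]) simp
    also have "{a..b} \<inter> {y..} = {y..b}" using that by auto
    also have "integral {y..b} \<phi>' = \<phi> b - \<phi> y"
    proof (rule integral_unique[OF fundamental_theorem_of_calculus])
      fix x assume "x \<in> {y..b}"
      then have "(\<phi> has_vector_derivative \<phi>' x) (at x within {a..b})"
        using \<phi> that by (simp add: has_real_derivative_iff_has_vector_derivative)
      then show "(\<phi> has_vector_derivative \<phi>' x) (at x within {y..b})"
        by (rule has_vector_derivative_within_subset) (use that in auto)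
    qed (use that in auto)
    finally show ?thesis .
  qed
  have g\<phi>: "integrable ?M (\<lambda>x. g x * \<phi> x)"
  proof -
    have "compact (\<phi> ` {a..b})" by (intro compact_continuous_image \<phi>c) simp
    then obtain C where C: "\<And>x. x \<in> {a..b} \<Longrightarrow> \<bar>\<phi> x\<bar> \<le> C"
      by (metis bounded_real compact_imp_bounded imageI)
    show ?thesis
      by (rule integrable_mult_bounded[OF g, of _ C])
        (use C in \<open>auto intro: continuous_imp_measurable_on_sets_lebesgue[OF \<phi>c]\<close>)
  qed
  have i1: "integrable ?M (\<lambda>x. integral {a..x} g * \<phi>' x)"
    using integrable_fst[OF f] by (rule Bochner_Integration.integrable_cong[THEN iffD1, rotated -1]) (simp_all add: in1)
  have "(LINT y|?M. (LINT x|?M. ?f x y)) = (LINT x|?M. (LINT y|?M. ?f x y))"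
    by (rule Fubini_integral[OF f])
  also have "(LINT x|?M. (LINT y|?M. ?f x y)) = (LINT x|?M. integral {a..x} g * \<phi>' x)"
    by (intro Bochner_Integration.integral_cong in1) auto
  also have "(LINT y|?M. (LINT x|?M. ?f x y)) = (LINT y|?M. g y * (\<phi> b - \<phi> y))"
    by (intro Bochner_Integration.integral_cong in2) auto
  also have "\<dots> = (LINT y|?M. g y) * \<phi> b - (LINT y|?M. g y * \<phi> y)"
    using g g\<phi> by (simp add: right_diff_distrib)
  finally show ?thesis
    using g g\<phi> i1 by (simp add: lebesgue_integral_eq_integral)
qed

subsection \<open>Weighted Sobolev spaces embed into continuous functions\<close>

lemma weight_pos: "x \<in> \<Omega> \<Longrightarrow> weight \<mu> x > 0"
proof -
  assume "x \<in> \<Omega>"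
  then have "\<bar>x\<bar> < 1" by auto
  then have "x\<^sup>2 < 1" by (simp add: abs_square_less_1)
  then show ?thesis by (simp add: weight_def)
qed

lemma weight_minus: "weight (- \<mu>) x = inverse (weight \<mu> x)"
  by (simp add: weight_def powr_minus)

text \<open>The substitution x = -1 + 2t gives 1 - x^2 = 4 t (1 - t), which turns the integral into
  a Beta integral with both parameters \<open>\<nu> + 1\<close>.\<close>

lemma integrable_weight:
  assumes "\<nu> > -1"
  shows "integrable (lebesgue_on \<Omega>) (weight \<nu>)"
proof -
  let ?f = "\<lambda>x. indicator {-1..1} x *\<^sub>R weight \<nu> x"
  have "set_integrable lborel {0..1} (\<lambda>t. t powr ((\<nu> + 1) - 1) * (1 - t) powr ((\<nu> + 1) - 1))"
    by (rule integrable_Beta) (use assms in auto)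
  then have "integrable lborel (\<lambda>t. 4 powr \<nu> * (indicator {0..1} t *\<^sub>R (t powr \<nu> * (1 - t) powr \<nu>)))"
    unfolding set_integrable_def by (intro integrable_mult_right) simp
  also have "(\<lambda>t. 4 powr \<nu> * (indicator {0..1} t *\<^sub>R (t powr \<nu> * (1 - t) powr \<nu>))) = (\<lambda>t. ?f (- 1 + 2 * t))"
  proof
    fix t :: real
    have "1 - (- 1 + 2 * t)\<^sup>2 = 4 * (t * (1 - t))" by (simp add: power2_eq_square algebra_simps)
    then show "4 powr \<nu> * (indicator {0..1} t *\<^sub>R (t powr \<nu> * (1 - t) powr \<nu>)) = ?f (- 1 + 2 * t)"
      by (auto simp: indicator_def weight_def powr_mult)
  qed
  finally have "integrable lborel ?f"
    by (subst (asm) lborel_integrable_real_affine_iff) auto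
  then have "integrable lebesgue ?f"
    by (subst integrable_completion) auto
  then have "set_integrable lebesgue {-1..1} (weight \<nu>)" by (simp add: set_integrable_def)
  then have "set_integrable lebesgue \<Omega> (weight \<nu>)"
    by (rule set_integrable_subset) auto
  then show ?thesis
    unfolding set_integrable_def by (subst integrable_restrict_space) auto
qed

lemma weight_measurable: "weight \<mu> \<in> borel_measurable (lebesgue_on \<Omega>)"
proof -
  have "weight \<mu> \<in> borel_measurable borel" unfolding weight_def by measurable
  then have "weight \<mu> \<in> borel_measurable lebesgue" by (simp add: measurable_completion)
  then show ?thesis by (rule measurable_restrict_space1)
qed

lemma L2w_imp_integrable:
  assumes f: "f \<in> L2w \<mu>" and \<mu>: "\<mu> < 1"
  shows "integrable (lebesgue_on \<Omega>) f" (is ?int)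
    and "(LINT x|lebesgue_on \<Omega>. \<bar>f x\<bar>) \<le> (1 + (LINT x|lebesgue_on \<Omega>. weight (- \<mu>) x)) / 2 * L2w_norm \<mu> f"
      (is "?I \<le> (1 + ?W) / 2 * ?N")
proof -
  have fm: "f \<in> borel_measurable (lebesgue_on \<Omega>)" and
    fi: "integrable (lebesgue_on \<Omega>) (\<lambda>x. (f x)\<^sup>2 * weight \<mu> x)" using f by (auto simp: L2w_def)
  have wi: "integrable (lebesgue_on \<Omega>) (weight (- \<mu>))" by (rule integrable_weight) (use \<mu> in auto)
  have AMGM: "\<bar>f x\<bar> \<le> ((f x)\<^sup>2 * weight \<mu> x / s + s * weight (- \<mu>) x) / 2" if "s > 0" "x \<in> \<Omega>" for x s
  proof -
    let ?w = "sqrt (weight \<mu> x / s)"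
    have w: "weight \<mu> x > 0" using weight_pos that by blast
    then have "?w > 0" using that by simp
    have expand: "(a * u - 1 / u)\<^sup>2 = a\<^sup>2 * u\<^sup>2 + 1 / u\<^sup>2 - 2 * a" if "u > 0" for a u :: real
      using that by (simp add: power2_eq_square field_simps)
    have "0 \<le> (\<bar>f x\<bar> * ?w - 1 / ?w)\<^sup>2" by simp
    also have "\<dots> = (f x)\<^sup>2 * ?w\<^sup>2 + 1 / ?w\<^sup>2 - 2 * \<bar>f x\<bar>"
      unfolding expand[OF \<open>?w > 0\<close>] by simp
    also have "?w\<^sup>2 = weight \<mu> x / s" using w that by simp
    finally show ?thesis using w that by (simp add: weight_minus field_simps)
  qed
  show ?int
  proof (rule Bochner_Integration.integrable_bound)
    show "integrable (lebesgue_on \<Omega>) (\<lambda>x. ((f x)\<^sup>2 * weight \<mu> x / 1 + 1 * weight (- \<mu>) x) / 2)"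
      using fi wi by simp
    show "AE x in lebesgue_on \<Omega>. norm (f x) \<le> norm (((f x)\<^sup>2 * weight \<mu> x / 1 + 1 * weight (- \<mu>) x) / 2)"
    proof (rule AE_I2)
      fix x assume "x \<in> space (lebesgue_on \<Omega>)"
      then show "norm (f x) \<le> norm (((f x)\<^sup>2 * weight \<mu> x / 1 + 1 * weight (- \<mu>) x) / 2)"
        using AMGM[of 1 x] by auto
    qed
  qed (rule fm)
  have N: "?N \<ge> 0" "?N\<^sup>2 = (LINT x|lebesgue_on \<Omega>. (f x)\<^sup>2 * weight \<mu> x)"
  proof -
    have "0 \<le> (LINT x|lebesgue_on \<Omega>. (f x)\<^sup>2 * weight \<mu> x)"
      by (rule Bochner_Integration.integral_nonneg) (auto intro!: mult_nonneg_nonneg less_imp_le[OF weight_pos])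
    then show "?N \<ge> 0" "?N\<^sup>2 = (LINT x|lebesgue_on \<Omega>. (f x)\<^sup>2 * weight \<mu> x)"
      by (auto simp: L2w_norm_def)
  qed
  have W: "?W \<ge> 0"
    by (rule Bochner_Integration.integral_nonneg) (auto intro!: less_imp_le[OF weight_pos])
  show "?I \<le> (1 + ?W) / 2 * ?N"
  proof (rule field_le_epsilon)
    fix e :: real assume "e > 0"
    \<comment> \<open>The ideal choice of s is the norm itself, which may be 0; adding
      \<open>d\<close> keeps s positive, and \<open>d\<close> is scaled so that its contribution is
      exactly \<open>e\<close>.\<close>
    define d where "d = e / ((1 + ?W) / 2)"
    have d: "d > 0" using \<open>e > 0\<close> W by (simp add: d_def)
    then have s: "?N + d > 0" using N by simp
    have "?I \<le> (LINT x|lebesgue_on \<Omega>. ((f x)\<^sup>2 * weight \<mu> x / (?N + d) + (?N + d) * weight (- \<mu>) x) / 2)"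
      by (intro Bochner_Integration.integral_mono) (use \<open>?int\<close> fi wi AMGM[OF s] in auto)
    also have "\<dots> = (?N\<^sup>2 / (?N + d) + (?N + d) * ?W) / 2"
      using fi wi by (simp add: N(2))
    also have "?N\<^sup>2 / (?N + d) \<le> ?N + d"
      using s d N(1) by (simp add: field_simps power2_eq_square)
    also have "(?N + d + (?N + d) * ?W) / 2 = (1 + ?W) / 2 * ?N + (1 + ?W) / 2 * d" by (simp add: field_simps)
    also have "(1 + ?W) / 2 * d = e" using W by (simp add: d_def)
    finally show "?I \<le> (1 + ?W) / 2 * ?N + e" by simp
  qed
qed

section \<open>Weighted Sobolev spaces: differences, almost everywhere equality, chosen weak
  derivatives\<close>

lemma L2w_diff:
  assumes "f \<in> L2w \<mu>" "g \<in> L2w \<mu>"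
  shows "(\<lambda>x. f x - g x) \<in> L2w \<mu>"
proof -
  have [measurable]: "f \<in> borel_measurable (lebesgue_on \<Omega>)" "g \<in> borel_measurable (lebesgue_on \<Omega>)"
    "weight \<mu> \<in> borel_measurable (lebesgue_on \<Omega>)"
    using assms weight_measurable by (auto simp: L2w_def)
  have "integrable (lebesgue_on \<Omega>) (\<lambda>x. (f x - g x)\<^sup>2 * weight \<mu> x)"
  proof (rule Bochner_Integration.integrable_bound)
    show "integrable (lebesgue_on \<Omega>) (\<lambda>x. 2 * ((f x)\<^sup>2 * weight \<mu> x) + 2 * ((g x)\<^sup>2 * weight \<mu> x))"
      using assms by (auto simp: L2w_def)
    show "AE x in lebesgue_on \<Omega>. norm ((f x - g x)\<^sup>2 * weight \<mu> x) \<le> norm (2 * ((f x)\<^sup>2 * weight \<mu> x) + 2 * ((g x)\<^sup>2 * weight \<mu> x))"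
    proof (rule AE_I2)
      fix x assume "x \<in> space (lebesgue_on \<Omega>)"
      then have w: "weight \<mu> x > 0" by (intro weight_pos) simp
      have "0 \<le> (f x + g x)\<^sup>2" by simp
      then have "(f x - g x)\<^sup>2 \<le> 2 * (f x)\<^sup>2 + 2 * (g x)\<^sup>2"
        by (simp add: power2_eq_square algebra_simps)
      then have "(f x - g x)\<^sup>2 * weight \<mu> x \<le> (2 * (f x)\<^sup>2 + 2 * (g x)\<^sup>2) * weight \<mu> x"
        using w by (intro mult_right_mono) auto
      then show "norm ((f x - g x)\<^sup>2 * weight \<mu> x) \<le> norm (2 * ((f x)\<^sup>2 * weight \<mu> x) + 2 * ((g x)\<^sup>2 * weight \<mu> x))"
        using w by (simp add: abs_mult algebra_simps)
    qed
  qed measurable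
  then show ?thesis by (simp add: L2w_def)
qed

lemma measurable_lebesgue_on_cong_AE:
  fixes f g :: "real \<Rightarrow> real"
  assumes "f \<in> borel_measurable (lebesgue_on S)" "AE x in lebesgue_on S. f x = g x" "S \<in> sets lebesgue"
  shows "g \<in> borel_measurable (lebesgue_on S)"
proof -
  have "(\<lambda>x. if x \<in> S then f x else 0) \<in> borel_measurable lebesgue"
    using assms by (simp add: borel_measurable_if)
  moreover have "AE x in lebesgue. (if x \<in> S then f x else 0) = (if x \<in> S then g x else 0)"
    using assms(2) by (subst (asm) AE_restrict_space_iff) (auto simp: assms(3) elim: eventually_mono)
  ultimately have "(\<lambda>x. if x \<in> S then g x else 0) \<in> borel_measurable lebesgue"
    by (rule borel_measurable_AE)
  then show ?thesis by (rule borel_measurable_if_D)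
qed

lemma L2w_cong_AE:
  assumes "f \<in> L2w \<mu>" "AE x in lebesgue_on \<Omega>. f x = g x"
  shows "g \<in> L2w \<mu>"
proof -
  have g[measurable]: "g \<in> borel_measurable (lebesgue_on \<Omega>)"
    using assms by (auto simp: L2w_def intro: measurable_lebesgue_on_cong_AE[of f])
  note [measurable] = weight_measurable
  have "integrable (lebesgue_on \<Omega>) (\<lambda>x. (f x)\<^sup>2 * weight \<mu> x)" using assms by (simp add: L2w_def)
  then have "integrable (lebesgue_on \<Omega>) (\<lambda>x. (g x)\<^sup>2 * weight \<mu> x)"
    by (rule integrable_cong_AE_imp) (use assms(2) in \<open>auto elim: eventually_mono\<close>)
  then show ?thesis using g by (simp add: L2w_def)
qed

text \<open>The choice in \<open>weak_deriv\<close> does not ask for membership in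
  \<open>L2w\<close>; it is inherited from the derivative provided by \<open>Hw\<close>, because the
  two agree almost everywhere.\<close>

lemma weak_deriv_in_L2w:
  assumes "f \<in> Hw \<mu> k" "1 \<le> j" "j \<le> k"
  shows "weak_deriv j f \<in> L2w \<mu>" "has_weak_deriv j f (weak_deriv j f)"
proof -
  have "\<exists>g\<in>L2w \<mu>. has_weak_deriv j f g" using assms by (auto simp: Hw_def)
  then obtain g where g: "g \<in> L2w \<mu>" "has_weak_deriv j f g" by blast
  then show w: "has_weak_deriv j f (weak_deriv j f)"
    using assms(2) someI[of "has_weak_deriv j f" g] by (simp add: weak_deriv_def)
  show "weak_deriv j f \<in> L2w \<mu>"
    by (rule L2w_cong_AE[OF g(1) has_weak_deriv_unique[OF g(2) w]])
qed

lemma L2w_norm_weak_deriv_le: "j \<le> k \<Longrightarrow> L2w_norm \<mu> (weak_deriv j f) \<le> Hw_norm \<mu> k f"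
  unfolding Hw_norm_def by (intro real_le_rsqrt member_le_sum) auto

lemma L2w_norm_le_Hw_norm: "L2w_norm \<mu> f \<le> Hw_norm \<mu> k f"
  using L2w_norm_weak_deriv_le[of 0 k \<mu> f] by (simp add: weak_deriv_def)

lemma Hw_norm_mono: "j \<le> k \<Longrightarrow> Hw_norm \<mu> j f \<le> Hw_norm \<mu> k f"
  unfolding Hw_norm_def by (intro real_sqrt_le_mono sum_mono2) auto

lemma Hw_mono: "j \<le> k \<Longrightarrow> Hw \<mu> k \<subseteq> Hw \<mu> j"
  by (auto simp: Hw_def)

lemma Hw_diff: "f \<in> Hw \<mu> k \<Longrightarrow> g \<in> Hw \<mu> k \<Longrightarrow> (\<lambda>x. f x - g x) \<in> Hw \<mu> k"
proof -
  assume f: "f \<in> Hw \<mu> k" and g: "g \<in> Hw \<mu> k"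
  have "\<exists>d\<in>L2w \<mu>. has_weak_deriv j (\<lambda>x. f x - g x) d" if "j \<in> {1..k}" for j
  proof -
    have "\<exists>d\<in>L2w \<mu>. has_weak_deriv j f d" "\<exists>d\<in>L2w \<mu>. has_weak_deriv j g d"
      using f g that by (auto simp: Hw_def)
    then obtain d d' where "d \<in> L2w \<mu>" "has_weak_deriv j f d" "d' \<in> L2w \<mu>" "has_weak_deriv j g d'"
      by blast
    then have "(\<lambda>x. d x - d' x) \<in> L2w \<mu>" "has_weak_deriv j (\<lambda>x. f x - g x) (\<lambda>x. d x - d' x)"
      by (auto intro: L2w_diff has_weak_deriv_diff)
    then show ?thesis by blast
  qed
  then show ?thesis using L2w_diff f g by (simp add: Hw_def)
qed

lemma weak_deriv_diff:
  assumes "f \<in> Hw \<mu> k" "g \<in> Hw \<mu> k" "1 \<le> j" "j \<le> k"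
  shows "AE x in lebesgue_on \<Omega>. weak_deriv j (\<lambda>x. f x - g x) x = weak_deriv j f x - weak_deriv j g x"
  by (rule has_weak_deriv_unique[OF weak_deriv_in_L2w(2)[OF Hw_diff[OF assms(1,2)] assms(3,4)]
     has_weak_deriv_diff[OF weak_deriv_in_L2w(2)[OF assms(1,3,4)] weak_deriv_in_L2w(2)[OF assms(2,3,4)]]])

section \<open>Continuous representatives, in space and then also in time\<close>

lemma indefinite_integral_continuous_on:
  fixes g :: "real \<Rightarrow> real"
  assumes "integrable (lebesgue_on \<Omega>) g"
  shows "continuous_on {-1..1} (\<lambda>x. integral {-1..x} g)"
  using integrable_lebesgue_on_Icc[OF assms, of "-1" 1]
  by (intro indefinite_integral_continuous_1 integrable_on_lebesgue_on) auto

text \<open>By parts, the primitive of \<open>g\<close> has weak derivative \<open>g\<close> as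
  well; the difference from \<open>f\<close> annihilates all derivatives of test functions and is
  therefore constant.\<close>

lemma has_weak_deriv_1_representative:
  assumes f: "has_weak_deriv 1 f g" and g: "integrable (lebesgue_on \<Omega>) g"
  shows "\<exists>c. AE x in lebesgue_on \<Omega>. f x = c + integral {-1..x} g"
proof -
  let ?P = "\<lambda>x. integral {-1..x} g"
  have gI: "integrable (lebesgue_on {-1..1}) g" by (rule integrable_lebesgue_on_Icc[OF g]) auto
  have Pc: "continuous_on {-1..1} ?P" by (rule indefinite_integral_continuous_on[OF g])
  have Pl: "locally_integrable ?P"
    by (intro integrable_imp_locally_integrable continuous_integrable_Omega Pc)
  have fl: "locally_integrable f" "locally_integrable g" using f by (auto simp: has_weak_deriv_def)
  have "\<exists>c. AE x in lebesgue_on \<Omega>. f x - ?P x = c"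
  proof (rule du_Bois_Reymond)
    show "locally_integrable (\<lambda>x. f x - ?P x)" by (intro locally_integrable_diff fl Pl)
    fix \<phi> assume \<phi>: "test_function \<phi>"
    have \<phi>': "test_function (deriv \<phi>)" by (rule test_function_deriv[OF \<phi>])
    obtain a b where ab: "-1 < a" "a < b" "b < 1" "\<And>x. x \<notin> {a..b} \<Longrightarrow> \<phi> x = 0" and s: "smooth \<phi>"
      using \<phi> test_function_iff by auto
    have "(LINT x|lebesgue_on \<Omega>. ?P x * deriv \<phi> x) = integral {-1..1} (\<lambda>x. ?P x * deriv \<phi> x)"
      by (intro LINT_Omega_eq_integral locally_integrable_mult_test Pl \<phi>')
    also have "\<dots> = - integral {-1..1} (\<lambda>x. g x * \<phi> x)"
      using integration_by_parts_indefinite[OF gI _ _ test_function_continuous[OF \<phi>'], of \<phi>]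
        smooth_has_deriv[OF s] ab by (simp add: has_field_derivative_at_within)
    also have "integral {-1..1} (\<lambda>x. g x * \<phi> x) = (LINT x|lebesgue_on \<Omega>. g x * \<phi> x)"
      by (intro LINT_Omega_eq_integral[symmetric] locally_integrable_mult_test fl \<phi>)
    finally have "(LINT x|lebesgue_on \<Omega>. ?P x * deriv \<phi> x) = (LINT x|lebesgue_on \<Omega>. f x * deriv \<phi> x)"
      using f \<phi> by (simp add: has_weak_deriv_def)
    then show "(LINT x|lebesgue_on \<Omega>. (f x - ?P x) * deriv \<phi> x) = 0"
      unfolding left_diff_distrib
      by (subst Bochner_Integration.integral_diff) (auto intro: locally_integrable_mult_test fl Pl \<phi>')
  qed
  then obtain c where "AE x in lebesgue_on \<Omega>. f x - ?P x = c" by blast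
  then show ?thesis by (intro exI[of _ c]) (auto elim: eventually_mono)
qed

text \<open>The representative is a constant plus the primitive of the weak derivative. The
  primitive is bounded by the L1 norm of the derivative; the constant is controlled by averaging,
  since the mean of the representative is bounded by the L1 norm of the function.\<close>

lemma Hw_embedding:
  assumes \<mu>: "\<mu> < 1"
  shows "\<exists>C\<ge>0. \<forall>f\<in>Hw \<mu> 1. \<exists>h. continuous_on {-1..1} h \<and> (AE x in lebesgue_on \<Omega>. f x = h x) \<and>
    (\<forall>x\<in>{-1..1}. \<bar>h x\<bar> \<le> C * Hw_norm \<mu> 1 f)"
proof -
  define K where "K = (1 + (LINT x|lebesgue_on \<Omega>. weight (- \<mu>) x)) / 2"
  have "K \<ge> 0" unfolding K_def
    by (auto intro!: add_nonneg_nonneg Bochner_Integration.integral_nonneg less_imp_le[OF weight_pos])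
  have "\<exists>h. continuous_on {-1..1} h \<and> (AE x in lebesgue_on \<Omega>. f x = h x) \<and>
      (\<forall>x\<in>{-1..1}. \<bar>h x\<bar> \<le> (3 * K) * Hw_norm \<mu> 1 f)" if f: "f \<in> Hw \<mu> 1" for f
  proof -
    define g where "g = weak_deriv 1 f"
    let ?N = "Hw_norm \<mu> 1 f"
    have g: "g \<in> L2w \<mu>" "has_weak_deriv 1 f g"
      using weak_deriv_in_L2w[OF f] by (auto simp: g_def)
    have gi: "integrable (lebesgue_on \<Omega>) g" by (rule L2w_imp_integrable[OF g(1) \<mu>])
    have gi': "integrable (lebesgue_on \<Omega>) (\<lambda>x. \<bar>g x\<bar>)" using gi by simp
    have f2: "f \<in> L2w \<mu>" using f by (simp add: Hw_def)
    have fi: "integrable (lebesgue_on \<Omega>) f" by (rule L2w_imp_integrable[OF f2 \<mu>])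
    have In: "(LINT x|lebesgue_on \<Omega>. \<bar>g x\<bar>) \<le> K * ?N" "(LINT x|lebesgue_on \<Omega>. \<bar>f x\<bar>) \<le> K * ?N"
      using L2w_imp_integrable(2)[OF g(1) \<mu>] L2w_imp_integrable(2)[OF f2 \<mu>]
        L2w_norm_weak_deriv_le[of 1 1 \<mu> f] L2w_norm_le_Hw_norm[of \<mu> f 1] \<open>K \<ge> 0\<close>
      unfolding K_def[symmetric] g_def[symmetric] by (meson le_refl mult_left_mono order_trans)+
    obtain c where c: "AE x in lebesgue_on \<Omega>. f x = c + integral {-1..x} g"
      using has_weak_deriv_1_representative[OF g(2) gi] by blast
    define h where "h x = c + integral {-1..x} g" for x
    have hc: "continuous_on {-1..1} h"
      unfolding h_def by (intro continuous_intros indefinite_integral_continuous_on gi)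
    have ac: "g absolutely_integrable_on {-1..1}"
      using integrable_lebesgue_on_Icc[OF gi, of "-1" 1]
      by (simp add: set_integrable_def integrable_restrict_space)
    have P: "\<bar>integral {-1..x} g\<bar> \<le> K * ?N" if "x \<in> {-1..1}" for x
    proof -
      have sub: "g absolutely_integrable_on {-1..x}"
        by (rule set_integrable_subset[OF ac]) (use that in auto)
      then have "g integrable_on {-1..x}" "(\<lambda>x. \<bar>g x\<bar>) integrable_on {-1..x}"
        by (auto simp: absolutely_integrable_on_def)
      then have "\<bar>integral {-1..x} g\<bar> \<le> integral {-1..x} (\<lambda>x. \<bar>g x\<bar>)"
        using Henstock_Kurzweil_Integration.integral_norm_bound_integral[of g _ "\<lambda>x. \<bar>g x\<bar>"] by simp
      also have "\<dots> \<le> integral {-1..1} (\<lambda>x. \<bar>g x\<bar>)"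
        using sub ac that unfolding absolutely_integrable_on_def by (intro integral_subset_le) auto
      also have "\<dots> = (LINT x|lebesgue_on \<Omega>. \<bar>g x\<bar>)" by (rule LINT_Omega_eq_integral[symmetric, OF gi'])
      finally show ?thesis using In by simp
    qed
    have "\<bar>h x\<bar> \<le> 3 * K * ?N" if x: "x \<in> {-1..1}" for x
    proof -
      \<comment> \<open>Averaging over y: \<open>h\<close> oscillates by at most 2KN, so 2|h(x)| <=
        KN + 4KN with N the norm. The constant 3K rounds up 5K/2.\<close>
      have "2 * \<bar>h x\<bar> = integral {-1..1} (\<lambda>y::real. \<bar>h x\<bar>)" by simp
      also have "\<dots> \<le> integral {-1..1} (\<lambda>y. \<bar>h y\<bar> + 2 * K * ?N)"
      proof (rule integral_le)
        fix y :: real assume y: "y \<in> {-1..1}"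
        show "\<bar>h x\<bar> \<le> \<bar>h y\<bar> + 2 * K * ?N" using P[OF x] P[OF y] by (auto simp: h_def)
      qed (auto intro!: integrable_continuous_interval continuous_intros hc)
      also have "\<dots> = integral {-1..1} (\<lambda>y. \<bar>h y\<bar>) + 4 * K * ?N"
        by (subst Henstock_Kurzweil_Integration.integral_add)
          (auto intro!: integrable_continuous_interval continuous_intros hc)
      also have "integral {-1..1} (\<lambda>y. \<bar>h y\<bar>) = (LINT y|lebesgue_on \<Omega>. \<bar>h y\<bar>)"
        by (intro LINT_Omega_eq_integral[symmetric] continuous_integrable_Omega continuous_intros hc)
      also have "\<dots> = (LINT y|lebesgue_on \<Omega>. \<bar>f y\<bar>)"
      proof (rule integral_cong_AE)
        show "AE y in lebesgue_on \<Omega>. \<bar>h y\<bar> = \<bar>f y\<bar>" using c by eventually_elim (simp add: h_def)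
      qed (use fi continuous_integrable_Omega[OF hc] in auto)
      finally show ?thesis using In by simp
    qed
    then show ?thesis using hc c by (intro exI[of _ h]) (auto simp: h_def)
  qed
  then show ?thesis using \<open>K \<ge> 0\<close> by (intro exI[of _ "3 * K"]) auto
qed

text \<open>The points of \<open>\<Omega>\<close> that violate the bound form an open null set,
  which is empty; the end points follow by continuity. This turns the almost everywhere identities
  of the system into estimates at every point.\<close>

lemma continuous_AE_bound:
  fixes h :: "real \<Rightarrow> real"
  assumes h: "continuous_on {-1..1} h" and ae: "AE x in lebesgue_on \<Omega>. \<bar>h x\<bar> \<le> B" and x: "x \<in> {-1..1}"
  shows "\<bar>h x\<bar> \<le> B"
proof -
  have "open {x \<in> \<Omega>. \<bar>h x\<bar> > B}"
  proof -
    have "continuous_on \<Omega> (\<lambda>x. \<bar>h x\<bar>)"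
      by (intro continuous_intros continuous_on_subset[OF h]) auto
    then have "openin (top_of_set \<Omega>) (\<Omega> \<inter> (\<lambda>x. \<bar>h x\<bar>) -` {B<..})"
      by (rule continuous_openin_preimage_gen) simp
    then have "open (\<Omega> \<inter> (\<lambda>x. \<bar>h x\<bar>) -` {B<..})" by (simp add: openin_open_eq)
    then show ?thesis by (simp add: Int_def vimage_def)
  qed
  moreover have "AE x\<in>{x \<in> \<Omega>. \<bar>h x\<bar> > B} in lebesgue. x \<in> {}"
    using ae by (subst (asm) AE_restrict_space_iff) (auto elim: eventually_mono)
  ultimately have "y \<notin> {x \<in> \<Omega>. \<bar>h x\<bar> > B}" for y
    using mem_closed_if_AE_lebesgue_open[of _ "{}" y] by blast
  then have *: "\<bar>h y\<bar> \<le> B" if "y \<in> \<Omega>" for y using that by force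
  have cl: "closure \<Omega> = {-1..1::real}" by simp
  show ?thesis
  proof (rule continuous_le_on_closure[of \<Omega> "\<lambda>x. \<bar>h x\<bar>"])
    show "continuous_on (closure \<Omega>) (\<lambda>x. \<bar>h x\<bar>)" unfolding cl by (intro continuous_intros h)
  qed (use x * in \<open>auto simp: cl\<close>)
qed

lemma continuous_AE_eq:
  fixes h h' :: "real \<Rightarrow> real"
  assumes "continuous_on {-1..1} h" "continuous_on {-1..1} h'" "AE x in lebesgue_on \<Omega>. h x = h' x" "x \<in> {-1..1}"
  shows "h x = h' x"
proof -
  have "\<bar>h x - h' x\<bar> \<le> 0"
  proof (rule continuous_AE_bound[OF _ _ assms(4)])
    show "continuous_on {-1..1} (\<lambda>x. h x - h' x)" by (intro continuous_intros assms)
    show "AE x in lebesgue_on \<Omega>. \<bar>h x - h' x\<bar> \<le> 0" using assms(3) by eventually_elim simp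
  qed
  then show ?thesis by simp
qed

text \<open>The embedding, applied to the difference of two time slices, bounds the supremum
  distance of their representatives by the norm distance. Continuity in time is thus uniform in x
  and combines with continuity of each slice.\<close>

lemma CT_representative:
  assumes f: "f \<in> CT \<mu> m T" and m: "1 \<le> m" and \<mu>: "\<mu> < 1"
  shows "\<exists>F. continuous_on ({0..T} \<times> {-1..1}) (\<lambda>(t, x). F t x) \<and>
    (\<forall>t\<in>{0..T}. AE x in lebesgue_on \<Omega>. f t x = F t x)"
proof -
  have fH: "f t \<in> Hw \<mu> 1" if "t \<in> {0..T}" for t
    using f that subsetD[OF Hw_mono[OF m]] unfolding CT_def by blast
  obtain C where "C \<ge> 0" and C: "\<And>f. f \<in> Hw \<mu> 1 \<Longrightarrow> \<exists>h. continuous_on {-1..1} h \<and> (AE x in lebesgue_on \<Omega>. f x = h x) \<and>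
    (\<forall>x\<in>{-1..1}. \<bar>h x\<bar> \<le> C * Hw_norm \<mu> 1 f)"
    using Hw_embedding[OF \<mu>] by blast
  have "\<forall>t\<in>{0..T}. \<exists>h. continuous_on {-1..1} h \<and> (AE x in lebesgue_on \<Omega>. f t x = h x)"
    using C fH by blast
  then obtain F where Fc: "\<And>t. t \<in> {0..T} \<Longrightarrow> continuous_on {-1..1} (F t)"
    and F: "\<And>t. t \<in> {0..T} \<Longrightarrow> AE x in lebesgue_on \<Omega>. f t x = F t x"
    using bchoice[of "{0..T}" "\<lambda>t h. continuous_on {-1..1} h \<and> (AE x in lebesgue_on \<Omega>. f t x = h x)"] by blast
  have lip: "\<bar>F s x - F t x\<bar> \<le> C * Hw_norm \<mu> m (\<lambda>x. f s x - f t x)"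
    if st: "s \<in> {0..T}" "t \<in> {0..T}" and x: "x \<in> {-1..1}" for s t x
  proof -
    obtain h where h: "continuous_on {-1..1} h" "AE x in lebesgue_on \<Omega>. f s x - f t x = h x"
      "\<bar>h x\<bar> \<le> C * Hw_norm \<mu> 1 (\<lambda>x. f s x - f t x)"
      using C[OF Hw_diff[OF fH[OF st(1)] fH[OF st(2)]]] x by blast
    have "AE x in lebesgue_on \<Omega>. F s x - F t x = h x"
      using F[OF st(1)] F[OF st(2)] h(2) by eventually_elim simp
    then have "F s x - F t x = h x"
      by (intro continuous_AE_eq[OF _ h(1) _ x, of "\<lambda>x. F s x - F t x"] continuous_intros Fc st)
    then show ?thesis
      using h(3) Hw_norm_mono[OF m, of \<mu> "\<lambda>x. f s x - f t x"] \<open>C \<ge> 0\<close>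
      by (metis mult_left_mono order_trans)
  qed
  have "((\<lambda>(t, x). F t x) \<longlongrightarrow> F t x) (at (t, x) within {0..T} \<times> {-1..1})"
    if t: "t \<in> {0..T}" and x: "x \<in> {-1..1}" for t x
  proof -
    let ?A = "at (t, x) within {0..T} \<times> {-1..1}"
    have l1: "continuous_on ({0..T} \<times> {-1..1}) (\<lambda>p. F t (snd p))"
      by (intro continuous_on_compose2[OF Fc[OF t]] continuous_intros) auto
    have "((\<lambda>p. F t (snd p)) \<longlongrightarrow> F t x) ?A"
      using l1 t x by (force simp: continuous_on_def)
    moreover have "((\<lambda>p. F (fst p) (snd p) - F t (snd p)) \<longlongrightarrow> 0) ?A"
    proof (rule tendstoI)
      fix e :: real assume "e > 0"
      have "((\<lambda>s. C * Hw_norm \<mu> m (\<lambda>x. f s x - f t x)) \<longlongrightarrow> C * 0) (at t within {0..T})"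
        using f t by (intro tendsto_intros) (simp add: CT_def)
      then have "\<forall>\<^sub>F s in at t within {0..T}. dist (C * Hw_norm \<mu> m (\<lambda>x. f s x - f t x)) 0 < e"
        using \<open>e > 0\<close> tendstoD[of _ "C * 0" _ e] by simp
      then obtain d where d: "d > 0" "\<And>s. s \<in> {0..T} \<Longrightarrow> s \<noteq> t \<Longrightarrow> dist s t < d \<Longrightarrow>
          \<bar>C * Hw_norm \<mu> m (\<lambda>x. f s x - f t x)\<bar> < e"
        unfolding eventually_at by auto
      \<comment> \<open>The limit in time says nothing about the time \<open>t\<close> itself; there
        the difference is 0.\<close>
      have "dist (F (fst p) (snd p) - F t (snd p)) 0 < e"
        if "p \<in> {0..T} \<times> {-1..1}" "dist p (t, x) < d" for p
      proof (cases "fst p = t")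
        case False
        have "dist (fst p) t < d" using that dist_fst_le[of p "(t, x)"] by simp
        then have "\<bar>C * Hw_norm \<mu> m (\<lambda>x. f (fst p) x - f t x)\<bar> < e"
          using d(2)[of "fst p"] False that by auto
        then show ?thesis using lip[of "fst p" t "snd p"] that t by auto
      qed (use \<open>e > 0\<close> in simp)
      then show "\<forall>\<^sub>F p in ?A. dist (F (fst p) (snd p) - F t (snd p)) 0 < e"
        unfolding eventually_at using d(1) by blast
    qed
    ultimately have "((\<lambda>p. F t (snd p) + (F (fst p) (snd p) - F t (snd p))) \<longlongrightarrow> F t x + 0) ?A"
      by (rule tendsto_add)
    then show ?thesis by (simp add: case_prod_beta')
  qed
  then have "continuous_on ({0..T} \<times> {-1..1}) (\<lambda>(t, x). F t x)"
    by (auto simp: continuous_on_def)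
  with F show ?thesis by blast
qed

text \<open>This provides continuity in time of \<open>A_D\<close> applied to the second derivative
  of \<open>\<eta>\<close>, which has no continuous representative; \<open>A_D\<close> is bounded
  from L1, so L1 continuity suffices.\<close>

lemma CT_weak_deriv_tendsto:
  assumes f: "f \<in> CT \<mu> m T" and j: "1 \<le> j" "j \<le> m" and \<mu>: "\<mu> < 1" and t: "t \<in> {0..T}"
  shows "((\<lambda>s. LINT x|lebesgue_on \<Omega>. \<bar>weak_deriv j (f s) x - weak_deriv j (f t) x\<bar>) \<longlongrightarrow> 0) (at t within {0..T})"
proof -
  define K where "K = (1 + (LINT x|lebesgue_on \<Omega>. weight (- \<mu>) x)) / 2"
  have "K \<ge> 0" unfolding K_def
    by (auto intro!: add_nonneg_nonneg Bochner_Integration.integral_nonneg less_imp_le[OF weight_pos])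
  have fH: "f t \<in> Hw \<mu> m" if "t \<in> {0..T}" for t using f that by (auto simp: CT_def)
  have le: "(LINT x|lebesgue_on \<Omega>. \<bar>weak_deriv j (f s) x - weak_deriv j (f t) x\<bar>) \<le> K * Hw_norm \<mu> m (\<lambda>x. f s x - f t x)"
    if s: "s \<in> {0..T}" for s
  proof -
    let ?d = "weak_deriv j (\<lambda>x. f s x - f t x)"
    have d: "?d \<in> L2w \<mu>" by (rule weak_deriv_in_L2w(1)[OF Hw_diff[OF fH fH] j]) (use s t in auto)
    have "(LINT x|lebesgue_on \<Omega>. \<bar>weak_deriv j (f s) x - weak_deriv j (f t) x\<bar>) = (LINT x|lebesgue_on \<Omega>. \<bar>?d x\<bar>)"
    proof (rule integral_cong_AE)
      show "AE x in lebesgue_on \<Omega>. \<bar>weak_deriv j (f s) x - weak_deriv j (f t) x\<bar> = \<bar>?d x\<bar>"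
        using weak_deriv_diff[OF fH[OF s] fH[OF t] j] by eventually_elim simp
    qed (use d weak_deriv_in_L2w(1)[OF fH[OF s] j] weak_deriv_in_L2w(1)[OF fH[OF t] j] in \<open>auto simp: L2w_def\<close>)
    also have "\<dots> \<le> K * L2w_norm \<mu> ?d" unfolding K_def by (rule L2w_imp_integrable(2)[OF d \<mu>])
    also have "\<dots> \<le> K * Hw_norm \<mu> m (\<lambda>x. f s x - f t x)"
      using \<open>K \<ge> 0\<close> by (intro mult_left_mono L2w_norm_weak_deriv_le j)
    finally show ?thesis .
  qed
  show ?thesis
  proof (rule Lim_null_comparison)
    show "\<forall>\<^sub>F s in at t within {0..T}. norm (LINT x|lebesgue_on \<Omega>. \<bar>weak_deriv j (f s) x - weak_deriv j (f t) x\<bar>) \<le> K * Hw_norm \<mu> m (\<lambda>x. f s x - f t x)"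
      using le by (auto simp: eventually_at_filter abs_of_nonneg)
    have "((\<lambda>s. K * Hw_norm \<mu> m (\<lambda>x. f s x - f t x)) \<longlongrightarrow> K * 0) (at t within {0..T})"
      using f t by (intro tendsto_intros) (auto simp: CT_def)
    then show "((\<lambda>s. K * Hw_norm \<mu> m (\<lambda>x. f s x - f t x)) \<longlongrightarrow> 0) (at t within {0..T})" by simp
  qed
qed

subsection \<open>The operator \<open>A\<^sub>D\<close>\<close>

definition dw1 :: "real \<Rightarrow> real \<Rightarrow> real" where
  "dw1 b x = cosh ((1 + x) / sqrt b) / sqrt b"

definition dw2 :: "real \<Rightarrow> real \<Rightarrow> real" where
  "dw2 b x = - cosh ((1 - x) / sqrt b) / sqrt b"

text \<open>The prefactor -1/(bW) of the Green function, with the constant Wronskian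
  evaluated.\<close>

definition Green_factor :: "real \<Rightarrow> real" where
  "Green_factor b = 1 / (sqrt b * sinh (2 / sqrt b))"

lemma DERIV_w1: "b > 0 \<Longrightarrow> (w1 b has_real_derivative dw1 b x) (at x within S)"
  and DERIV_w2: "b > 0 \<Longrightarrow> (w2 b has_real_derivative dw2 b x) (at x within S)"
  and DERIV_dw1: "b > 0 \<Longrightarrow> (dw1 b has_real_derivative w1 b x / b) (at x within S)"
  and DERIV_dw2: "b > 0 \<Longrightarrow> (dw2 b has_real_derivative w2 b x / b) (at x within S)"
  unfolding w1_def[abs_def] w2_def[abs_def] dw1_def[abs_def] dw2_def[abs_def]
  by (auto intro!: derivative_eq_intros simp: field_simps)

lemma continuous_on_w:
  assumes "b > 0"
  shows "continuous_on S (w1 b)" "continuous_on S (w2 b)" "continuous_on S (dw1 b)" "continuous_on S (dw2 b)"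
  using DERIV_w1[OF assms] DERIV_w2[OF assms] DERIV_dw1[OF assms] DERIV_dw2[OF assms]
  by (meson DERIV_continuous continuous_on_eq_continuous_within)+

lemma Wronskian_w: "b > 0 \<Longrightarrow> dw1 b x * w2 b x - w1 b x * dw2 b x = 1 / (b * Green_factor b)"
proof -
  assume b: "b > 0"
  have "sinh (2 / sqrt b) = sinh ((1 + x) / sqrt b + (1 - x) / sqrt b)"
    by (simp add: add_divide_distrib [symmetric])
  then have "dw1 b x * w2 b x - w1 b x * dw2 b x = sinh (2 / sqrt b) / sqrt b"
    by (simp add: w1_def w2_def dw1_def dw2_def sinh_add add_divide_distrib mult.commute)
  also have "\<dots> = 1 / (b * Green_factor b)"
    using b by (simp add: Green_factor_def field_simps)
  finally show ?thesis .
qed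

lemma Green_factor_pos: "b > 0 \<Longrightarrow> Green_factor b > 0"
  by (simp add: Green_factor_def)

text \<open>The three summands take care of the functions \<open>w1\<close>, \<open>w2\<close>, of
  their first and of their second derivatives, so that one constant serves for all on
  [-1,1].\<close>

definition w_bound :: "real \<Rightarrow> real" where
  "w_bound b = cosh (2 / sqrt b) * (1 + 1 / sqrt b + 1 / b)"

lemma w_bound:
  assumes b: "b > 0" and x: "x \<in> {-1..1}"
  shows "\<bar>w1 b x\<bar> \<le> w_bound b" "\<bar>w2 b x\<bar> \<le> w_bound b" "\<bar>dw1 b x\<bar> \<le> w_bound b" "\<bar>dw2 b x\<bar> \<le> w_bound b"
    "\<bar>w1 b x / b\<bar> \<le> w_bound b" "\<bar>w2 b x / b\<bar> \<le> w_bound b"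
proof -
  let ?c = "cosh (2 / sqrt b)"
  have c: "cosh y \<le> ?c" "\<bar>sinh y\<bar> \<le> ?c" if "0 \<le> y" "y \<le> 2 / sqrt b" for y
  proof -
    show *: "cosh y \<le> ?c" using that b by (subst cosh_real_nonneg_le_iff) auto
    show "\<bar>sinh y\<bar> \<le> ?c" using sinh_le_cosh_real[of y] that * by simp
  qed
  have s: "sqrt b > 0" using b by simp
  have y: "0 \<le> (1 + x) / sqrt b" "(1 + x) / sqrt b \<le> 2 / sqrt b" "0 \<le> (1 - x) / sqrt b" "(1 - x) / sqrt b \<le> 2 / sqrt b"
    using x s by (auto simp: divide_right_mono)
  have w: "?c \<le> w_bound b" "?c / sqrt b \<le> w_bound b" "?c / b \<le> w_bound b"
    unfolding w_bound_def using b by (auto simp: distrib_left divide_inverse)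
  show "\<bar>w1 b x\<bar> \<le> w_bound b" "\<bar>w2 b x\<bar> \<le> w_bound b"
    using c(2)[OF y(1,2)] c(2)[OF y(3,4)] w(1) by (auto simp: w1_def w2_def)
  have "cosh ((1 + x) / sqrt b) / sqrt b \<le> ?c / sqrt b" "cosh ((1 - x) / sqrt b) / sqrt b \<le> ?c / sqrt b"
    using c(1)[OF y(1,2)] c(1)[OF y(3,4)] s by (auto intro: divide_right_mono)
  then show "\<bar>dw1 b x\<bar> \<le> w_bound b" "\<bar>dw2 b x\<bar> \<le> w_bound b"
    using w(2) s by (auto simp: dw1_def dw2_def)
  have "\<bar>w1 b x\<bar> / b \<le> ?c / b" "\<bar>w2 b x\<bar> / b \<le> ?c / b"
    using c(2)[OF y(1,2)] c(2)[OF y(3,4)] b by (auto simp: w1_def w2_def intro: divide_right_mono)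
  then show "\<bar>w1 b x / b\<bar> \<le> w_bound b" "\<bar>w2 b x / b\<bar> \<le> w_bound b"
    using w(3) b by auto
qed

lemma w_bound_nonneg: "b > 0 \<Longrightarrow> w_bound b \<ge> 0"
  using w_bound(1)[of b 0] by force

text \<open>The derivative of the Green function in its second argument, off the diagonal; at the
  kink the left branch is taken, an arbitrary value on a null set.\<close>

definition dGreen :: "real \<Rightarrow> real \<Rightarrow> real \<Rightarrow> real" where
  "dGreen b x \<xi> = Green_factor b * (if \<xi> \<le> x then dw1 b \<xi> * w2 b x else w1 b x * dw2 b \<xi>)"

lemma deriv_Green:
  assumes b: "b > 0" and ne: "\<xi> \<noteq> x"
  shows "deriv (Green b x) \<xi> = dGreen b x \<xi>"
proof -
  have k: "- 1 / (b * Wronskian b x) = Green_factor b"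
    using b by (simp add: Wronskian_const Green_factor_def field_simps)
  have G: "Green b x y = Green_factor b * (if y \<le> x then w1 b y * w2 b x else w1 b x * w2 b y)" for y
    unfolding Green_def k ..
  have "(Green b x has_real_derivative dGreen b x \<xi>) (at \<xi>)"
  proof (cases "\<xi> < x")
    case True
    have "((\<lambda>y. Green_factor b * (w1 b y * w2 b x)) has_real_derivative dGreen b x \<xi>) (at \<xi>)"
      using True by (auto intro!: derivative_eq_intros DERIV_w1[OF b] simp: dGreen_def)
    then show ?thesis
      by (rule has_field_derivative_transform_within_open[of _ _ _ "{..<x}"]) (use True G in auto)
  next
    case False
    have "((\<lambda>y. Green_factor b * (w1 b x * w2 b y)) has_real_derivative dGreen b x \<xi>) (at \<xi>)"
      using False ne by (auto intro!: derivative_eq_intros DERIV_w2[OF b] simp: dGreen_def)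
    then show ?thesis
      by (rule has_field_derivative_transform_within_open[of _ _ _ "{x<..}"]) (use False ne G in auto)
  qed
  then show ?thesis by (rule DERIV_imp_deriv)
qed

lemma dGreen_measurable: "b > 0 \<Longrightarrow> dGreen b x \<in> borel_measurable (lebesgue_on \<Omega>)"
proof -
  assume b: "b > 0"
  have [measurable]: "dw1 b \<in> borel_measurable borel" "dw2 b \<in> borel_measurable borel"
    by (auto intro!: borel_measurable_continuous_onI continuous_on_w b)
  have "dGreen b x \<in> borel_measurable borel" unfolding dGreen_def[abs_def] by measurable
  then have "dGreen b x \<in> borel_measurable lebesgue" by (simp add: measurable_completion)
  then show ?thesis by (rule measurable_restrict_space1)
qed

lemma dGreen_bound:
  assumes "b > 0" "x \<in> {-1..1}" "\<xi> \<in> {-1..1}"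
  shows "\<bar>dGreen b x \<xi>\<bar> \<le> Green_factor b * (w_bound b * w_bound b)"
proof -
  note w = w_bound[OF assms(1,2)] w_bound[OF assms(1,3)]
  have "\<bar>dw1 b \<xi>\<bar> * \<bar>w2 b x\<bar> \<le> w_bound b * w_bound b" "\<bar>w1 b x\<bar> * \<bar>dw2 b \<xi>\<bar> \<le> w_bound b * w_bound b"
    by (intro mult_mono w w_bound_nonneg assms abs_ge_zero)+
  then have "\<bar>if \<xi> \<le> x then dw1 b \<xi> * w2 b x else w1 b x * dw2 b \<xi>\<bar> \<le> w_bound b * w_bound b"
    by (simp add: abs_mult)
  then show ?thesis
    unfolding dGreen_def abs_mult using Green_factor_pos[OF assms(1)] by (simp add: mult_left_mono)
qed

lemma A_D_eq_dGreen:
  assumes b: "b > 0" and x: "x \<in> {-1..1}" and f: "integrable (lebesgue_on \<Omega>) f"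
  shows "integrable (lebesgue_on \<Omega>) (\<lambda>\<xi>. f \<xi> * dGreen b x \<xi>)"
    and "A_D b f x = (LINT \<xi>|lebesgue_on \<Omega>. f \<xi> * dGreen b x \<xi>)"
proof -
  show i: "integrable (lebesgue_on \<Omega>) (\<lambda>\<xi>. f \<xi> * dGreen b x \<xi>)"
    by (rule integrable_mult_bounded[OF f dGreen_measurable[OF b]]) (rule dGreen_bound[OF b x], simp)
  have "AE \<xi> in lebesgue. \<xi> \<noteq> x" by (intro AE_completion AE_lborel_singleton)
  then have "AE \<xi> in lebesgue_on \<Omega>. \<xi> \<noteq> x"
    by (subst AE_restrict_space_iff) (auto elim: eventually_mono)
  then have ae: "AE \<xi> in lebesgue_on \<Omega>. f \<xi> * dGreen b x \<xi> = deriv (Green b x) \<xi> * f \<xi>"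
    by eventually_elim (simp add: deriv_Green[OF b])
  show "A_D b f x = (LINT \<xi>|lebesgue_on \<Omega>. f \<xi> * dGreen b x \<xi>)"
    unfolding A_D_def
    by (rule integral_cong_AE[OF measurable_lebesgue_on_cong_AE[OF borel_measurable_integrable[OF i] ae]
          borel_measurable_integrable[OF i]])
      (use ae in \<open>auto elim: eventually_mono\<close>)
qed

text \<open>Splitting at the kink separates x from the integration variable: only smooth functions
  of x and variable limits remain, which can be differentiated, and on each side the kernel is
  smooth.\<close>

lemma A_D_eq:
  assumes b: "b > 0" and x: "x \<in> {-1..1}" and f: "integrable (lebesgue_on \<Omega>) f"
  shows "A_D b f x = Green_factor b *
    (w2 b x * integral {-1..x} (\<lambda>\<xi>. f \<xi> * dw1 b \<xi>) + w1 b x * integral {x..1} (\<lambda>\<xi>. f \<xi> * dw2 b \<xi>))"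
proof -
  note i = A_D_eq_dGreen[OF assms]
  have "(\<lambda>\<xi>. f \<xi> * dGreen b x \<xi>) integrable_on {-1..1}"
    using integrable_lebesgue_on_Icc[OF i(1), of "-1" 1] by (intro integrable_on_lebesgue_on) auto
  then have "integral {-1..1} (\<lambda>\<xi>. f \<xi> * dGreen b x \<xi>) =
    integral {-1..x} (\<lambda>\<xi>. f \<xi> * dGreen b x \<xi>) + integral {x..1} (\<lambda>\<xi>. f \<xi> * dGreen b x \<xi>)"
    using x by (intro Henstock_Kurzweil_Integration.integral_combine[symmetric]) auto
  also have "integral {-1..x} (\<lambda>\<xi>. f \<xi> * dGreen b x \<xi>) = integral {-1..x} (\<lambda>\<xi>. (Green_factor b * w2 b x) * (f \<xi> * dw1 b \<xi>))"
    by (rule Henstock_Kurzweil_Integration.integral_cong) (auto simp: dGreen_def)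
  also have "integral {x..1} (\<lambda>\<xi>. f \<xi> * dGreen b x \<xi>) = integral {x..1} (\<lambda>\<xi>. (Green_factor b * w1 b x) * (f \<xi> * dw2 b \<xi>))"
    by (rule integral_spike[of "{x}"]) (auto simp: dGreen_def)
  finally show ?thesis
    unfolding i(2) LINT_Omega_eq_integral[OF i(1)] by (simp add: distrib_left mult.assoc)
qed

lemma A_D_bound_L1:
  assumes b: "b > 0" and x: "x \<in> {-1..1}" and f: "integrable (lebesgue_on \<Omega>) f"
  shows "\<bar>A_D b f x\<bar> \<le> Green_factor b * (w_bound b * w_bound b) * (LINT \<xi>|lebesgue_on \<Omega>. \<bar>f \<xi>\<bar>)"
proof -
  have "\<bar>A_D b f x\<bar> \<le> (LINT \<xi>|lebesgue_on \<Omega>. \<bar>f \<xi> * dGreen b x \<xi>\<bar>)"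
    unfolding A_D_eq_dGreen(2)[OF assms] by (rule integral_abs_bound)
  also have "\<dots> \<le> (LINT \<xi>|lebesgue_on \<Omega>. \<bar>f \<xi>\<bar> * (Green_factor b * (w_bound b * w_bound b)))"
  proof (rule Bochner_Integration.integral_mono)
    fix \<xi> assume "\<xi> \<in> space (lebesgue_on \<Omega>)"
    then show "\<bar>f \<xi> * dGreen b x \<xi>\<bar> \<le> \<bar>f \<xi>\<bar> * (Green_factor b * (w_bound b * w_bound b))"
      using dGreen_bound[OF b x, of \<xi>] by (simp add: abs_mult mult_left_mono)
  qed (use A_D_eq_dGreen(1)[OF assms] f in auto)
  finally show ?thesis by (simp add: mult.commute)
qed

lemma A_D_bound:
  assumes b: "b > 0" and x: "x \<in> {-1..1}" and f: "continuous_on {-1..1} f" and B: "\<And>\<xi>. \<xi> \<in> {-1..1} \<Longrightarrow> \<bar>f \<xi>\<bar> \<le> B"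
  shows "\<bar>A_D b f x\<bar> \<le> 2 * Green_factor b * (w_bound b * w_bound b) * B"
proof -
  have fi: "integrable (lebesgue_on \<Omega>) f" by (rule continuous_integrable_Omega[OF f])
  have "(LINT \<xi>|lebesgue_on \<Omega>. \<bar>f \<xi>\<bar>) = integral {-1..1} (\<lambda>\<xi>. \<bar>f \<xi>\<bar>)"
    using fi by (intro LINT_Omega_eq_integral) simp
  also have "\<dots> \<le> integral {-1..1} (\<lambda>\<xi>::real. B)"
    by (intro integral_le integrable_continuous_interval continuous_intros f B)
  finally have "(LINT \<xi>|lebesgue_on \<Omega>. \<bar>f \<xi>\<bar>) \<le> 2 * B" by simp
  then have "Green_factor b * (w_bound b * w_bound b) * (LINT \<xi>|lebesgue_on \<Omega>. \<bar>f \<xi>\<bar>) \<le> Green_factor b * (w_bound b * w_bound b) * (2 * B)"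
    using b by (intro mult_left_mono) (auto intro!: mult_nonneg_nonneg w_bound_nonneg less_imp_le[OF Green_factor_pos])
  then show ?thesis using A_D_bound_L1[OF b x fi] by linarith
qed

lemma A_D_linear:
  assumes b: "b > 0" and x: "x \<in> {-1..1}" and f: "integrable (lebesgue_on \<Omega>) f" and g: "integrable (lebesgue_on \<Omega>) g"
  shows "A_D b (\<lambda>\<xi>. c * f \<xi> + g \<xi>) x = c * A_D b f x + A_D b g x"
proof -
  have i: "integrable (lebesgue_on \<Omega>) (\<lambda>\<xi>. c * f \<xi> + g \<xi>)" using f g by auto
  show ?thesis
    unfolding A_D_eq_dGreen(2)[OF b x i] A_D_eq_dGreen(2)[OF b x f] A_D_eq_dGreen(2)[OF b x g]
    using A_D_eq_dGreen(1)[OF b x f] A_D_eq_dGreen(1)[OF b x g]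
    by (simp add: distrib_right mult.assoc)
qed

lemma A_D_diff:
  assumes b: "b > 0" and x: "x \<in> {-1..1}" and f: "integrable (lebesgue_on \<Omega>) f" and g: "integrable (lebesgue_on \<Omega>) g"
  shows "A_D b (\<lambda>\<xi>. f \<xi> - g \<xi>) x = A_D b f x - A_D b g x"
  using A_D_linear[OF b x g f, of "-1"] by simp

text \<open>The equality holds at every point x, not just almost every one. Hence representatives
  may be exchanged at every time under a time integral at a fixed x, although the exceptional sets
  vary with time.\<close>

lemma A_D_cong_AE:
  assumes b: "b > 0" and x: "x \<in> {-1..1}" and f: "integrable (lebesgue_on \<Omega>) f"
    and ae: "AE \<xi> in lebesgue_on \<Omega>. f \<xi> = g \<xi>"
  shows "A_D b f x = A_D b g x"
proof -
  have g: "integrable (lebesgue_on \<Omega>) g"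
    by (rule integrable_cong_AE_imp[OF f measurable_lebesgue_on_cong_AE[OF borel_measurable_integrable[OF f] ae]])
      (use ae in \<open>auto elim: eventually_mono\<close>)
  have "A_D b (\<lambda>\<xi>. f \<xi> - g \<xi>) x = 0"
  proof -
    have "(LINT \<xi>|lebesgue_on \<Omega>. \<bar>f \<xi> - g \<xi>\<bar>) = 0"
      by (rule integral_eq_zero_AE) (use ae in \<open>auto elim: eventually_mono\<close>)
    then show ?thesis using A_D_bound_L1[OF b x, of "\<lambda>\<xi>. f \<xi> - g \<xi>"] f g by simp
  qed
  then show ?thesis using A_D_diff[OF b x f g] by simp
qed

section \<open>Continuity in time, exchange with the time integral, and smoothing in space\<close>

lemma continuous_on_A_D_L1:
  assumes b: "b > 0" and x: "x \<in> {-1..1}" and f: "\<And>t. t \<in> S \<Longrightarrow> integrable (lebesgue_on \<Omega>) (f t)"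
    and lim: "\<And>t. t \<in> S \<Longrightarrow> ((\<lambda>s. LINT \<xi>|lebesgue_on \<Omega>. \<bar>f s \<xi> - f t \<xi>\<bar>) \<longlongrightarrow> 0) (at t within S)"
  shows "continuous_on S (\<lambda>t. A_D b (f t) x)"
  unfolding continuous_on_def
proof
  fix t assume t: "t \<in> S"
  let ?C = "Green_factor b * (w_bound b * w_bound b)"
  have "((\<lambda>s. A_D b (f s) x - A_D b (f t) x) \<longlongrightarrow> 0) (at t within S)"
  proof (rule Lim_null_comparison)
    show "\<forall>\<^sub>F s in at t within S. norm (A_D b (f s) x - A_D b (f t) x) \<le> ?C * (LINT \<xi>|lebesgue_on \<Omega>. \<bar>f s \<xi> - f t \<xi>\<bar>)"
      unfolding eventually_at_filter
    proof (intro always_eventually allI impI)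
      fix s assume s: "s \<in> S"
      have "integrable (lebesgue_on \<Omega>) (\<lambda>\<xi>. f s \<xi> - f t \<xi>)" using f s t by auto
      from A_D_bound_L1[OF b x this]
      show "norm (A_D b (f s) x - A_D b (f t) x) \<le> ?C * (LINT \<xi>|lebesgue_on \<Omega>. \<bar>f s \<xi> - f t \<xi>\<bar>)"
        by (simp add: A_D_diff[OF b x f[OF s] f[OF t]])
    qed
    show "((\<lambda>s. ?C * (LINT \<xi>|lebesgue_on \<Omega>. \<bar>f s \<xi> - f t \<xi>\<bar>)) \<longlongrightarrow> 0) (at t within S)"
      using tendsto_mult_left[OF lim[OF t], of ?C] by simp
  qed
  then show "((\<lambda>s. A_D b (f s) x) \<longlongrightarrow> A_D b (f t) x) (at t within S)"
    by (simp add: LIM_zero_iff)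
qed

lemma continuous_on_slice:
  assumes "continuous_on (S \<times> K) (\<lambda>(t, x). f t x)" "t \<in> S"
  shows "continuous_on K (f t)"
proof -
  have "continuous_on K (\<lambda>x. (\<lambda>(t, x). f t x) (t, x))"
    by (rule continuous_on_compose2[OF assms(1)]) (use assms(2) in \<open>auto intro!: continuous_intros\<close>)
  then show ?thesis by simp
qed

lemma continuous_on_A_D:
  assumes b: "b > 0" and x: "x \<in> {-1..1}" and f: "continuous_on (S \<times> {-1..1}) (\<lambda>(t, \<xi>). f t \<xi>)"
  shows "continuous_on S (\<lambda>t. A_D b (f t) x)"
proof -
  have *: "continuous_on S (\<lambda>t. integral {c..d} (\<lambda>\<xi>. f t \<xi> * h \<xi>))"
    if "{c..d} \<subseteq> {-1..1}" "continuous_on UNIV h" for c d h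
  proof -
    have "continuous_on (S \<times> cbox c d) (\<lambda>p. (case p of (t, \<xi>) \<Rightarrow> f t \<xi>) * h (snd p))"
      by (intro continuous_intros continuous_on_subset[OF f] continuous_on_compose2[OF that(2)]) (use that(1) in auto)
    then have "continuous_on (S \<times> cbox c d) (\<lambda>(t, \<xi>). f t \<xi> * h \<xi>)"
      by (simp add: case_prod_beta')
    from integral_continuous_on_param[OF this] show ?thesis by simp
  qed
  have "continuous_on S (\<lambda>t. Green_factor b *
    (w2 b x * integral {-1..x} (\<lambda>\<xi>. f t \<xi> * dw1 b \<xi>) + w1 b x * integral {x..1} (\<lambda>\<xi>. f t \<xi> * dw2 b \<xi>)))"
    by (intro continuous_intros * continuous_on_w b) (use x in auto)
  also have "?this \<longleftrightarrow> ?thesis"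
    by (intro continuous_on_cong refl A_D_eq[symmetric] b x continuous_integrable_Omega continuous_on_slice[OF f])
  finally show ?thesis .
qed

text \<open>On each side of the kink the integrand is jointly continuous, so the order of
  integration can be exchanged there. This yields the representation of the first difference as
  \<open>A_D\<close> of the time-integrated flux.\<close>

lemma integral_A_D:
  fixes f :: "real \<Rightarrow> real \<Rightarrow> real"
  assumes b: "b > 0" and x: "x \<in> {-1..1}" and f: "continuous_on ({0..t} \<times> {-1..1}) (\<lambda>(\<tau>, \<xi>). f \<tau> \<xi>)"
  shows "continuous_on {-1..1} (\<lambda>\<xi>. integral {0..t} (\<lambda>\<tau>. f \<tau> \<xi>))"
    and "integral {0..t} (\<lambda>\<tau>. A_D b (f \<tau>) x) = A_D b (\<lambda>\<xi>. integral {0..t} (\<lambda>\<tau>. f \<tau> \<xi>)) x"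
proof -
  let ?F = "\<lambda>\<xi>. integral {0..t} (\<lambda>\<tau>. f \<tau> \<xi>)"
  have "continuous_on ({-1..1} \<times> cbox 0 t) (\<lambda>p. (\<lambda>(\<tau>, \<xi>). f \<tau> \<xi>) (snd p, fst p))"
    by (intro continuous_on_compose2[OF f] continuous_intros) (auto simp: cbox_interval)
  then have "continuous_on ({-1..1} \<times> cbox 0 t) (\<lambda>(\<xi>, \<tau>). f \<tau> \<xi>)" by (simp add: case_prod_beta')
  from integral_continuous_on_param[OF this] show Fc: "continuous_on {-1..1} ?F" by simp
  have *: "integral {0..t} (\<lambda>\<tau>. integral {c..d} (\<lambda>\<xi>. f \<tau> \<xi> * h \<xi>)) = integral {c..d} (\<lambda>\<xi>. ?F \<xi> * h \<xi>)"
    and **: "(\<lambda>\<tau>. integral {c..d} (\<lambda>\<xi>. f \<tau> \<xi> * h \<xi>)) integrable_on {0..t}"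
    if cd: "{c..d} \<subseteq> {-1..1}" and h: "continuous_on UNIV h" for c d h
  proof -
    have "continuous_on ({0..t} \<times> {c..d}) (\<lambda>p. (case p of (t, \<xi>) \<Rightarrow> f t \<xi>) * h (snd p))"
      by (intro continuous_intros continuous_on_subset[OF f] continuous_on_compose2[OF h]) (use cd in auto)
    then have c: "continuous_on ({0..t} \<times> {c..d}) (\<lambda>(t, \<xi>). f t \<xi> * h \<xi>)"
      by (simp add: case_prod_beta')
    then show "(\<lambda>\<tau>. integral {c..d} (\<lambda>\<xi>. f \<tau> \<xi> * h \<xi>)) integrable_on {0..t}"
      using integral_continuous_on_param[of "{0..t}" c d "\<lambda>t \<xi>. f t \<xi> * h \<xi>"]
      by (intro integrable_continuous_interval) simp
    have "continuous_on (cbox (0, c) (t, d)) (\<lambda>(t, \<xi>). f t \<xi> * h \<xi>)"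
      using c by (simp add: cbox_Pair_eq)
    from integral_swap_continuous[OF this]
    show "integral {0..t} (\<lambda>\<tau>. integral {c..d} (\<lambda>\<xi>. f \<tau> \<xi> * h \<xi>)) = integral {c..d} (\<lambda>\<xi>. ?F \<xi> * h \<xi>)"
      by simp
  qed
  have sub: "{-1..x} \<subseteq> {-1..1}" "{x..1} \<subseteq> {-1..1}" using x by auto
  have "integral {0..t} (\<lambda>\<tau>. A_D b (f \<tau>) x) = integral {0..t} (\<lambda>\<tau>. Green_factor b *
    (w2 b x * integral {-1..x} (\<lambda>\<xi>. f \<tau> \<xi> * dw1 b \<xi>) + w1 b x * integral {x..1} (\<lambda>\<xi>. f \<tau> \<xi> * dw2 b \<xi>)))"
    by (intro Henstock_Kurzweil_Integration.integral_cong A_D_eq b x continuous_integrable_Omega continuous_on_slice[OF f])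
  also have "\<dots> = Green_factor b * (w2 b x * integral {0..t} (\<lambda>\<tau>. integral {-1..x} (\<lambda>\<xi>. f \<tau> \<xi> * dw1 b \<xi>))
     + w1 b x * integral {0..t} (\<lambda>\<tau>. integral {x..1} (\<lambda>\<xi>. f \<tau> \<xi> * dw2 b \<xi>)))"
    by (intro integral_unique has_integral_mult_right has_integral_add integrable_integral
        **[OF sub(1) continuous_on_w(3)[OF b]] **[OF sub(2) continuous_on_w(4)[OF b]])
  also have "\<dots> = A_D b ?F x"
    unfolding A_D_eq[OF b x continuous_integrable_Omega[OF Fc]]
      *[OF sub(1) continuous_on_w(3)[OF b]] *[OF sub(2) continuous_on_w(4)[OF b]] ..
  finally show "integral {0..t} (\<lambda>\<tau>. A_D b (f \<tau>) x) = A_D b ?F x" .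
qed

text \<open>The last factor bounds the derivative of \<open>A_D b F\<close> relative to the supremum
  of \<open>F\<close>. The 12 is 2 * 3 * 2: two halves of the kernel, a factor 3 from integrating by
  parts, and a factor 2 because increments of that derivative are at most twice its
  supremum.\<close>

definition A_D_bound2 :: "real \<Rightarrow> real" where
  "A_D_bound2 b = 12 * Green_factor b * (w_bound b * w_bound b) * (4 * Green_factor b * (w_bound b * w_bound b) + 1 / b)"

text \<open>Differentiating the variable limits gives terms with \<open>F x\<close> itself, and the
  Wronskian identity collapses them to \<open>F x / b\<close>; no derivative of \<open>F\<close>
  appears. The 4 counts two integrals over intervals of length at most 2.\<close>

lemma A_D_has_derivative:
  assumes b: "b > 0" and F: "continuous_on {-1..1} F" and B: "\<And>x. x \<in> {-1..1} \<Longrightarrow> \<bar>F x\<bar> \<le> B"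
  obtains V1 where "continuous_on {-1..1} V1"
    "\<And>x. x \<in> {-1..1} \<Longrightarrow> (A_D b F has_real_derivative V1 x) (at x within {-1..1})"
    "\<And>x. x \<in> {-1..1} \<Longrightarrow> \<bar>V1 x\<bar> \<le> (4 * Green_factor b * (w_bound b * w_bound b) + 1 / b) * B"
proof -
  let ?k = "Green_factor b" and ?M = "w_bound b"
  let ?I1 = "\<lambda>x. integral {-1..x} (\<lambda>\<xi>. F \<xi> * dw1 b \<xi>)" and ?I2 = "\<lambda>x. integral {x..1} (\<lambda>\<xi>. F \<xi> * dw2 b \<xi>)"
  have c1: "continuous_on {-1..1} (\<lambda>\<xi>. F \<xi> * dw1 b \<xi>)" and c2: "continuous_on {-1..1} (\<lambda>\<xi>. F \<xi> * dw2 b \<xi>)"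
    by (intro continuous_intros F continuous_on_w b)+
  define V1 where "V1 x = ?k * (dw2 b x * ?I1 x + dw1 b x * ?I2 x) + F x / b" for x
  have d: "(A_D b F has_real_derivative V1 x) (at x within {-1..1})" if x: "x \<in> {-1..1}" for x
  proof -
    have "((\<lambda>x. ?k * (w2 b x * ?I1 x + w1 b x * ?I2 x)) has_real_derivative
       ?k * ((dw2 b x * ?I1 x + (F x * dw1 b x) * w2 b x) + (dw1 b x * ?I2 x + (- (F x * dw2 b x)) * w1 b x))) (at x within {-1..1})"
      by (intro DERIV_cmult DERIV_add DERIV_mult DERIV_w1[OF b] DERIV_w2[OF b]
          integral_has_real_derivative[OF c1 x] integral_has_real_derivative'[OF c2 x])
    also have "?k * ((dw2 b x * ?I1 x + (F x * dw1 b x) * w2 b x) + (dw1 b x * ?I2 x + (- (F x * dw2 b x)) * w1 b x))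
       = ?k * (dw2 b x * ?I1 x + dw1 b x * ?I2 x) + ?k * F x * (dw1 b x * w2 b x - w1 b x * dw2 b x)"
      by (simp add: algebra_simps)
    also have "\<dots> = V1 x"
      unfolding Wronskian_w[OF b] V1_def using Green_factor_pos[OF b] by simp
    finally show ?thesis
      by (rule has_field_derivative_transform_within[where d = 1])
        (use x in \<open>auto simp: A_D_eq[OF b _ continuous_integrable_Omega[OF F]]\<close>)
  qed
  have "continuous_on {-1..1} ?I1" "continuous_on {-1..1} ?I2"
    using integral_has_real_derivative[OF c1] integral_has_real_derivative'[OF c2]
    by (meson DERIV_continuous continuous_on_eq_continuous_within)+
  then have "continuous_on {-1..1} V1"
    unfolding V1_def by (intro continuous_intros continuous_on_w b F) (use b in auto)
  moreover have "\<bar>V1 x\<bar> \<le> (4 * ?k * (?M * ?M) + 1 / b) * B" if x: "x \<in> {-1..1}" for x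
  proof -
    have M: "?M \<ge> 0" by (rule w_bound_nonneg[OF b])
    have B0: "B \<ge> 0" using B[of 0] by force
    have est: "\<bar>integral {c..d} (\<lambda>\<xi>. F \<xi> * h \<xi>)\<bar> \<le> 2 * (B * ?M)"
      if cd: "{c..d} \<subseteq> {-1..1}" "c \<le> d" and h: "\<And>\<xi>. \<xi> \<in> {-1..1} \<Longrightarrow> \<bar>h \<xi>\<bar> \<le> ?M" "continuous_on {-1..1} (\<lambda>\<xi>. F \<xi> * h \<xi>)" for c d h
    proof -
      have "norm (integral {c..d} (\<lambda>\<xi>. F \<xi> * h \<xi>)) \<le> (B * ?M) * (d - c)"
      proof (rule integral_bound)
        show "continuous_on {c..d} (\<lambda>\<xi>. F \<xi> * h \<xi>)" using h(2) cd(1) by (rule continuous_on_subset)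
        fix \<xi> assume "\<xi> \<in> {c..d}"
        then have "\<xi> \<in> {-1..1}" using cd by blast
        then show "norm (F \<xi> * h \<xi>) \<le> B * ?M"
          unfolding real_norm_def abs_mult by (intro mult_mono B h B0 abs_ge_zero)
      qed (rule cd)
      also have "\<dots> \<le> (B * ?M) * 2" using cd B0 M by (intro mult_left_mono) auto
      finally show ?thesis by simp
    qed
    have I: "\<bar>?I1 x\<bar> \<le> 2 * (B * ?M)" "\<bar>?I2 x\<bar> \<le> 2 * (B * ?M)"
      by (rule est; use x w_bound[OF b] c1 c2 in auto)+
    have "\<bar>dw2 b x * ?I1 x\<bar> \<le> ?M * (2 * (B * ?M))" "\<bar>dw1 b x * ?I2 x\<bar> \<le> ?M * (2 * (B * ?M))"
      unfolding abs_mult by (intro mult_mono I w_bound b x M abs_ge_zero)+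
    then have "\<bar>dw2 b x * ?I1 x + dw1 b x * ?I2 x\<bar> \<le> 4 * (?M * ?M) * B" by (simp add: algebra_simps)
    then have "\<bar>?k * (dw2 b x * ?I1 x + dw1 b x * ?I2 x)\<bar> \<le> ?k * (4 * (?M * ?M) * B)"
      unfolding abs_mult using Green_factor_pos[OF b] by (simp add: mult_left_mono)
    moreover have "\<bar>F x / b\<bar> \<le> B / b" using B[OF x] b by (simp add: divide_right_mono)
    ultimately have "\<bar>V1 x\<bar> \<le> ?k * (4 * (?M * ?M) * B) + B / b" unfolding V1_def by linarith
    then show ?thesis by (simp add: algebra_simps)
  qed
  ultimately show thesis using that d by blast
qed

text \<open>One of the two derivatives is classical, so the product of \<open>V\<close> and
  \<open>deriv \<phi>\<close> can be integrated exactly; its boundary values vanish, which moves one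
  derivative back from the test function.\<close>

lemma has_weak_deriv_of_derivative:
  assumes V: "\<And>x. x \<in> {-1..1} \<Longrightarrow> (V has_real_derivative V1 x) (at x within {-1..1})"
    and V1: "continuous_on {-1..1} V1"
    and g: "has_weak_deriv 2 V g"
  shows "has_weak_deriv 1 V1 g"
  unfolding has_weak_deriv_def
proof (intro conjI allI impI)
  show l1: "locally_integrable V1" by (intro integrable_imp_locally_integrable continuous_integrable_Omega V1)
  show "locally_integrable g" using g by (simp add: has_weak_deriv_def)
  have lV: "locally_integrable V" using g by (simp add: has_weak_deriv_def)
  fix \<phi> assume \<phi>: "test_function \<phi>"
  have \<phi>': "test_function (deriv \<phi>)" and \<phi>'': "test_function (deriv (deriv \<phi>))"
    by (intro test_function_deriv \<phi>)+
  obtain a c where ac: "-1 < a" "a < c" "c < 1" "\<And>x. x \<notin> {a..c} \<Longrightarrow> deriv \<phi> x = 0" and s: "smooth (deriv \<phi>)"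
    using \<phi>' test_function_iff by auto
  have i: "integrable (lebesgue_on \<Omega>) (\<lambda>x. V1 x * deriv \<phi> x)" "integrable (lebesgue_on \<Omega>) (\<lambda>x. V x * deriv (deriv \<phi>) x)"
    by (intro locally_integrable_mult_test l1 lV \<phi>' \<phi>'')+
  have "((\<lambda>x. V1 x * deriv \<phi> x + V x * deriv (deriv \<phi>) x) has_integral (V 1 * deriv \<phi> 1 - V (-1) * deriv \<phi> (-1))) {-1..1}"
  proof (rule fundamental_theorem_of_calculus)
    fix x :: real assume x: "x \<in> {-1..1}"
    have "((\<lambda>x. V x * deriv \<phi> x) has_real_derivative (V1 x * deriv \<phi> x + deriv (deriv \<phi>) x * V x)) (at x within {-1..1})"
      by (intro DERIV_mult V x has_field_derivative_at_within[OF smooth_has_deriv[OF s]])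
    then show "((\<lambda>x. V x * deriv \<phi> x) has_vector_derivative (V1 x * deriv \<phi> x + V x * deriv (deriv \<phi>) x)) (at x within {-1..1})"
      by (simp add: has_real_derivative_iff_has_vector_derivative mult.commute)
  qed simp
  then have "integral {-1..1} (\<lambda>x. V1 x * deriv \<phi> x + V x * deriv (deriv \<phi>) x) = 0"
    using ac by (simp add: integral_unique)
  then have "(LINT x|lebesgue_on \<Omega>. V1 x * deriv \<phi> x + V x * deriv (deriv \<phi>) x) = 0"
    using i by (subst LINT_Omega_eq_integral) auto
  then have "(LINT x|lebesgue_on \<Omega>. V1 x * deriv \<phi> x) = - (LINT x|lebesgue_on \<Omega>. V x * deriv (deriv \<phi>) x)"
    using i by simp
  also have "(LINT x|lebesgue_on \<Omega>. V x * deriv (deriv \<phi>) x) = (LINT x|lebesgue_on \<Omega>. g x * \<phi> x)"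
    using g \<phi> by (simp add: has_weak_deriv_def eval_nat_numeral)
  finally show "(LINT x|lebesgue_on \<Omega>. V1 x * (deriv ^^ 1) \<phi> x) = (-1) ^ 1 * (LINT x|lebesgue_on \<Omega>. g x * \<phi> x)"
    by simp
qed

text \<open>The bound involves only primitives of \<open>g\<close>, not its L1 norm. The 3 is 1 for
  the boundary term plus 2 for the length of the interval.\<close>

lemma integral_mult_bound_by_parts:
  assumes g: "integrable (lebesgue_on \<Omega>) g"
    and P: "\<And>x. x \<in> {c..d} \<Longrightarrow> \<bar>integral {c..x} g\<bar> \<le> B"
    and \<phi>: "\<And>x. (\<phi> has_real_derivative \<phi>' x) (at x within {c..d})" "continuous_on {c..d} \<phi>'"
    and M: "\<And>x. x \<in> {c..d} \<Longrightarrow> \<bar>\<phi> x\<bar> \<le> M" "\<And>x. x \<in> {c..d} \<Longrightarrow> \<bar>\<phi>' x\<bar> \<le> M"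
    and cd: "-1 \<le> c" "c \<le> d" "d \<le> 1"
  shows "\<bar>integral {c..d} (\<lambda>x. g x * \<phi> x)\<bar> \<le> 3 * (B * M)"
proof -
  have gi: "integrable (lebesgue_on {c..d}) g" by (rule integrable_lebesgue_on_Icc[OF g]) (use cd in auto)
  have Pc: "continuous_on {c..d} (\<lambda>x. integral {c..x} g)"
    using gi by (intro indefinite_integral_continuous_1 integrable_on_lebesgue_on) auto
  have BM: "B \<ge> 0" "M \<ge> 0" using P[of c] M(1)[of c] cd by force+
  have 1: "\<bar>integral {c..d} g * \<phi> d\<bar> \<le> B * M"
    unfolding abs_mult by (intro mult_mono P M BM) (use cd in auto)
  have "norm (integral {c..d} (\<lambda>x. integral {c..x} g * \<phi>' x)) \<le> (B * M) * (d - c)"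
  proof (rule integral_bound)
    fix x assume "x \<in> {c..d}"
    then show "norm (integral {c..x} g * \<phi>' x) \<le> B * M"
      unfolding real_norm_def abs_mult by (intro mult_mono P M BM abs_ge_zero)
  qed (intro continuous_intros Pc \<phi> cd)+
  also have "\<dots> \<le> (B * M) * 2" using cd BM by (intro mult_left_mono) auto
  finally have 2: "\<bar>integral {c..d} (\<lambda>x. integral {c..x} g * \<phi>' x)\<bar> \<le> 2 * (B * M)" by simp
  show ?thesis
    unfolding integration_by_parts_indefinite[OF gi cd(2) \<phi>] using 1 2 by linarith
qed

text \<open>No derivative of \<open>F\<close> is lost: one integration by parts leaves only the first derivative of
  \<open>A_D b F\<close>, which is controlled by the supremum of \<open>F\<close>.\<close>

lemma A_D_weak_deriv_2_bound:
  assumes b: "b > 0" and x: "x \<in> {-1..1}" and F: "continuous_on {-1..1} F"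
    and B: "\<And>x. x \<in> {-1..1} \<Longrightarrow> \<bar>F x\<bar> \<le> B"
    and g: "integrable (lebesgue_on \<Omega>) g" "has_weak_deriv 2 (A_D b F) g"
  shows "\<bar>A_D b g x\<bar> \<le> A_D_bound2 b * B"
proof -
  let ?k = "Green_factor b" and ?M = "w_bound b"
  define C where "C = (4 * ?k * (?M * ?M) + 1 / b) * B"
  obtain V1 where V1: "continuous_on {-1..1} V1"
    "\<And>x. x \<in> {-1..1} \<Longrightarrow> (A_D b F has_real_derivative V1 x) (at x within {-1..1})"
    "\<And>x. x \<in> {-1..1} \<Longrightarrow> \<bar>V1 x\<bar> \<le> C"
    using A_D_has_derivative[OF b F B] unfolding C_def by blast
  have "has_weak_deriv 1 V1 g" using has_weak_deriv_of_derivative[OF V1(2,1) g(2)] .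
  then obtain c where "AE x in lebesgue_on \<Omega>. V1 x = c + integral {-1..x} g"
    using has_weak_deriv_1_representative g(1) by blast
  \<comment> \<open>Both sides are continuous, so the almost everywhere identity holds everywhere.
    Integrals of \<open>g\<close> thereby become increments of \<open>V1\<close>, which the supremum
    of \<open>F\<close> controls.\<close>
  then have V1_eq: "V1 y = c + integral {-1..y} g" if "y \<in> {-1..1}" for y
    using continuous_AE_eq[OF V1(1) _ _ that, of "\<lambda>x. c + integral {-1..x} g"]
    by (simp add: indefinite_integral_continuous_on[OF g(1)] continuous_on_add)
  have int: "integral {y..z} g = V1 z - V1 y" if "-1 \<le> y" "y \<le> z" "z \<le> 1" for y z
  proof -
    have "integrable (lebesgue_on {-1..z}) g" by (rule integrable_lebesgue_on_Icc[OF g(1)]) (use that in auto)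
    then have "g integrable_on {-1..z}" by (intro integrable_on_lebesgue_on) auto
    then have "integral {-1..y} g + integral {y..z} g = integral {-1..z} g"
      using that by (intro Henstock_Kurzweil_Integration.integral_combine) auto
    then show ?thesis using V1_eq[of y] V1_eq[of z] that by simp
  qed
  have P: "\<bar>integral {y..z} g\<bar> \<le> 2 * C" if "-1 \<le> y" "y \<le> z" "z \<le> 1" for y z
    using int[OF that] V1(3)[of y] V1(3)[of z] that by auto
  have I1: "\<bar>integral {-1..x} (\<lambda>\<xi>. g \<xi> * dw1 b \<xi>)\<bar> \<le> 3 * (2 * C * ?M)"
  proof (rule integral_mult_bound_by_parts[OF g(1) _ DERIV_dw1[OF b]])
    show "continuous_on {-1..x} (\<lambda>x. w1 b x / b)" using b by (intro continuous_intros continuous_on_w b) auto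
  qed (use x P w_bound[OF b] in auto)
  have I2: "\<bar>integral {x..1} (\<lambda>\<xi>. g \<xi> * dw2 b \<xi>)\<bar> \<le> 3 * (2 * C * ?M)"
  proof (rule integral_mult_bound_by_parts[OF g(1) _ DERIV_dw2[OF b]])
    show "continuous_on {x..1} (\<lambda>x. w2 b x / b)" using b by (intro continuous_intros continuous_on_w b) auto
  qed (use x P w_bound[OF b] in auto)
  have "\<bar>w2 b x * integral {-1..x} (\<lambda>\<xi>. g \<xi> * dw1 b \<xi>)\<bar> \<le> ?M * (3 * (2 * C * ?M))"
    "\<bar>w1 b x * integral {x..1} (\<lambda>\<xi>. g \<xi> * dw2 b \<xi>)\<bar> \<le> ?M * (3 * (2 * C * ?M))"
    unfolding abs_mult by (intro mult_mono I1 I2 w_bound b x w_bound_nonneg abs_ge_zero)+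
  then have "\<bar>w2 b x * integral {-1..x} (\<lambda>\<xi>. g \<xi> * dw1 b \<xi>) + w1 b x * integral {x..1} (\<lambda>\<xi>. g \<xi> * dw2 b \<xi>)\<bar> \<le> 12 * (?M * ?M) * C"
    by (simp add: algebra_simps)
  then have "\<bar>A_D b g x\<bar> \<le> ?k * (12 * (?M * ?M) * C)"
    unfolding A_D_eq[OF b x g(1)] abs_mult using Green_factor_pos[OF b] by (simp add: mult_left_mono)
  then show ?thesis by (simp add: A_D_bound2_def C_def algebra_simps)
qed

subsection \<open>Uniqueness\<close>

lemma A_D_continuous:
  assumes b: "b > 0" and F: "continuous_on {-1..1} F"
  shows "continuous_on {-1..1} (A_D b F)"
proof -
  have "compact (F ` {-1..1})" by (intro compact_continuous_image F) simp
  then obtain B where B: "\<And>x. x \<in> {-1..1} \<Longrightarrow> \<bar>F x\<bar> \<le> B"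
    by (metis bounded_real compact_imp_bounded imageI)
  show ?thesis
  proof (rule A_D_has_derivative[OF b F B])
    fix V1 assume "\<And>x. x \<in> {-1..1} \<Longrightarrow> (A_D b F has_real_derivative V1 x) (at x within {-1..1})"
    then show ?thesis by (meson DERIV_continuous continuous_on_eq_continuous_within)
  qed
qed

text \<open>The factor 1/l gained here is the only source of smallness in the uniqueness
  argument.\<close>

lemma integral_exp_bound:
  fixes h :: "real \<Rightarrow> real"
  assumes h: "continuous_on {0..t} h" and bd: "\<And>\<tau>. \<tau> \<in> {0..t} \<Longrightarrow> \<bar>h \<tau>\<bar> \<le> C * exp (l * \<tau>)"
    and l: "l > 0" and C: "C \<ge> 0" and t: "t \<ge> 0"
  shows "\<bar>integral {0..t} h\<bar> \<le> C / l * exp (l * t)"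
proof -
  have I: "((\<lambda>\<tau>. C * exp (l * \<tau>)) has_integral (C / l * exp (l * t) - C / l * exp (l * 0))) {0..t}"
    using l t by (intro fundamental_theorem_of_calculus)
      (auto intro!: derivative_eq_intros simp: has_real_derivative_iff_has_vector_derivative[symmetric])
  then have "norm (integral {0..t} h) \<le> integral {0..t} (\<lambda>\<tau>. C * exp (l * \<tau>))"
    using bd by (intro Henstock_Kurzweil_Integration.integral_norm_bound_integral
        [OF integrable_continuous_interval[OF h] has_integral_integrable]) auto
  then show ?thesis unfolding integral_unique[OF I] using divide_nonneg_pos[OF C l] by simp
qed

lemma A_D_eta_flux_cong:
  assumes b: "b > 0" and x: "x \<in> {-1..1}" and E: "continuous_on {-1..1} E" and U: "continuous_on {-1..1} U"
    and ae: "AE \<xi> in lebesgue_on \<Omega>. \<eta> \<xi> = E \<xi>" "AE \<xi> in lebesgue_on \<Omega>. u \<xi> = U \<xi>"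
  shows "A_D b (\<lambda>\<xi>. u \<xi> + \<eta> \<xi> * u \<xi>) x = A_D b (\<lambda>\<xi>. U \<xi> + E \<xi> * U \<xi>) x"
proof (rule A_D_cong_AE[OF b x, symmetric])
  show "integrable (lebesgue_on \<Omega>) (\<lambda>\<xi>. U \<xi> + E \<xi> * U \<xi>)"
    by (intro continuous_integrable_Omega continuous_intros E U)
  show "AE \<xi> in lebesgue_on \<Omega>. U \<xi> + E \<xi> * U \<xi> = u \<xi> + \<eta> \<xi> * u \<xi>"
    using ae by eventually_elim simp
qed

text \<open>The second derivative is merely integrable; it is split off so that the rest of the flux
  can be replaced by a continuous function.\<close>

lemma A_D_u_flux_cong:
  assumes b: "b > 0" and x: "x \<in> {-1..1}" and E: "continuous_on {-1..1} E" and U: "continuous_on {-1..1} U"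
    and ae: "AE \<xi> in lebesgue_on \<Omega>. \<eta> \<xi> = E \<xi>" "AE \<xi> in lebesgue_on \<Omega>. u \<xi> = U \<xi>"
    and g: "integrable (lebesgue_on \<Omega>) g"
  shows "A_D b (\<lambda>\<xi>. c * g \<xi> + \<eta> \<xi> + (u \<xi>)\<^sup>2 / 2) x = c * A_D b g x + A_D b (\<lambda>\<xi>. E \<xi> + (U \<xi>)\<^sup>2 / 2) x"
proof -
  have q: "integrable (lebesgue_on \<Omega>) (\<lambda>\<xi>. E \<xi> + (U \<xi>)\<^sup>2 / 2)"
    by (intro continuous_integrable_Omega continuous_intros E U) auto
  have "A_D b (\<lambda>\<xi>. c * g \<xi> + (E \<xi> + (U \<xi>)\<^sup>2 / 2)) x = A_D b (\<lambda>\<xi>. c * g \<xi> + \<eta> \<xi> + (u \<xi>)\<^sup>2 / 2) x"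
  proof (rule A_D_cong_AE[OF b x])
    show "integrable (lebesgue_on \<Omega>) (\<lambda>\<xi>. c * g \<xi> + (E \<xi> + (U \<xi>)\<^sup>2 / 2))"
      by (rule Bochner_Integration.integrable_add[OF integrable_mult_right q]) (rule g)
    show "AE \<xi> in lebesgue_on \<Omega>. c * g \<xi> + (E \<xi> + (U \<xi>)\<^sup>2 / 2) = c * g \<xi> + \<eta> \<xi> + (u \<xi>)\<^sup>2 / 2"
      using ae by eventually_elim simp
  qed
  then show ?thesis using A_D_linear[OF b x g q, of c] by simp
qed

text \<open>Both solutions have the same data terms, which cancel on subtraction. The
  representatives are arguments, so that the conclusions for all times speak of the same continuous
  functions.\<close>

lemma solution_difference:
  assumes b: "b > 0" and \<mu>: "\<mu> < 1" and m: "1 \<le> m"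
    and \<eta>: "\<eta> \<in> CT \<mu> 2 T" and u: "u \<in> CT \<mu> m T" and sol: "solves_system b c T \<eta>0 u0 h1 h2 v1 v2 \<eta> u"
    and \<eta>': "\<eta>' \<in> CT \<mu> 2 T" and u': "u' \<in> CT \<mu> m T" and sol': "solves_system b c T \<eta>0 u0 h1 h2 v1 v2 \<eta>' u'"
    and E: "continuous_on ({0..T} \<times> {-1..1}) (\<lambda>(t, x). E t x)" "\<forall>t\<in>{0..T}. AE x in lebesgue_on \<Omega>. \<eta> t x = E t x"
    and U: "continuous_on ({0..T} \<times> {-1..1}) (\<lambda>(t, x). U t x)" "\<forall>t\<in>{0..T}. AE x in lebesgue_on \<Omega>. u t x = U t x"
    and E': "continuous_on ({0..T} \<times> {-1..1}) (\<lambda>(t, x). E' t x)" "\<forall>t\<in>{0..T}. AE x in lebesgue_on \<Omega>. \<eta>' t x = E' t x"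
    and U': "continuous_on ({0..T} \<times> {-1..1}) (\<lambda>(t, x). U' t x)" "\<forall>t\<in>{0..T}. AE x in lebesgue_on \<Omega>. u' t x = U' t x"
    and t: "t \<in> {0..T}"
    and f_def: "f = (\<lambda>\<tau> \<xi>. (U \<tau> \<xi> + E \<tau> \<xi> * U \<tau> \<xi>) - (U' \<tau> \<xi> + E' \<tau> \<xi> * U' \<tau> \<xi>))"
    and q_def: "q = (\<lambda>\<tau> \<xi>. (E \<tau> \<xi> + (U \<tau> \<xi>)\<^sup>2 / 2) - (E' \<tau> \<xi> + (U' \<tau> \<xi>)\<^sup>2 / 2))"
    and g_def: "g = (\<lambda>\<tau> \<xi>. weak_deriv 2 (\<eta> \<tau>) \<xi> - weak_deriv 2 (\<eta>' \<tau>) \<xi>)"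
  shows "AE x in lebesgue_on \<Omega>. E t x - E' t x = integral {0..t} (\<lambda>\<tau>. A_D b (f \<tau>) x)"
    and "AE x in lebesgue_on \<Omega>. U t x - U' t x = integral {0..t} (\<lambda>\<tau>. c * A_D b (g \<tau>) x + A_D b (q \<tau>) x)"
    and "\<And>x. x \<in> {-1..1} \<Longrightarrow> continuous_on {0..T} (\<lambda>\<tau>. c * A_D b (g \<tau>) x + A_D b (q \<tau>) x)"
    and "integrable (lebesgue_on \<Omega>) (g t)"
    and "has_weak_deriv 2 (\<lambda>x. \<eta> t x - \<eta>' t x) (g t)"
proof -
  have gi: "integrable (lebesgue_on \<Omega>) (weak_deriv 2 (\<eta> \<tau>))" "integrable (lebesgue_on \<Omega>) (weak_deriv 2 (\<eta>' \<tau>))"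
    if "\<tau> \<in> {0..T}" for \<tau>
    using \<eta> \<eta>' that weak_deriv_in_L2w(1)[of _ \<mu> 2 2] L2w_imp_integrable(1)[OF _ \<mu>] by (auto simp: CT_def)
  then show "integrable (lebesgue_on \<Omega>) (g t)" using t by (simp add: g_def)
  show "has_weak_deriv 2 (\<lambda>x. \<eta> t x - \<eta>' t x) (g t)"
    unfolding g_def using \<eta> \<eta>' t
    by (intro has_weak_deriv_diff weak_deriv_in_L2w(2)[of _ \<mu> 2 2]) (auto simp: CT_def)
  define f1 where "f1 = (\<lambda>\<tau> \<xi>. U \<tau> \<xi> + E \<tau> \<xi> * U \<tau> \<xi>)"
  define f1' where "f1' = (\<lambda>\<tau> \<xi>. U' \<tau> \<xi> + E' \<tau> \<xi> * U' \<tau> \<xi>)"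
  define q1 where "q1 = (\<lambda>\<tau> \<xi>. E \<tau> \<xi> + (U \<tau> \<xi>)\<^sup>2 / 2)"
  define q1' where "q1' = (\<lambda>\<tau> \<xi>. E' \<tau> \<xi> + (U' \<tau> \<xi>)\<^sup>2 / 2)"
  note cc = E(1) U(1) E'(1) U'(1)
  have f1c: "continuous_on ({0..T} \<times> {-1..1}) (\<lambda>(t, x). f1 t x)" "continuous_on ({0..T} \<times> {-1..1}) (\<lambda>(t, x). f1' t x)"
    and q1c: "continuous_on ({0..T} \<times> {-1..1}) (\<lambda>(t, x). q1 t x)" "continuous_on ({0..T} \<times> {-1..1}) (\<lambda>(t, x). q1' t x)"
    using cc unfolding f1_def f1'_def q1_def q1'_def case_prod_beta' by (auto intro!: continuous_intros)
  have fi: "integrable (lebesgue_on \<Omega>) (f1 \<tau>)" "integrable (lebesgue_on \<Omega>) (f1' \<tau>)"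
    "integrable (lebesgue_on \<Omega>) (q1 \<tau>)" "integrable (lebesgue_on \<Omega>) (q1' \<tau>)" if "\<tau> \<in> {0..T}" for \<tau>
    by (intro continuous_integrable_Omega continuous_on_slice[OF f1c(1) that] continuous_on_slice[OF f1c(2) that]
      continuous_on_slice[OF q1c(1) that] continuous_on_slice[OF q1c(2) that])+
  have Af: "A_D b (f \<tau>) x = A_D b (f1 \<tau>) x - A_D b (f1' \<tau>) x"
    and Aq: "A_D b (q \<tau>) x = A_D b (q1 \<tau>) x - A_D b (q1' \<tau>) x"
    and Ag: "A_D b (g \<tau>) x = A_D b (weak_deriv 2 (\<eta> \<tau>)) x - A_D b (weak_deriv 2 (\<eta>' \<tau>)) x"
    if "\<tau> \<in> {0..T}" "x \<in> {-1..1}" for \<tau> x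
    using A_D_diff[OF b that(2) fi(1,2)[OF that(1)]] A_D_diff[OF b that(2) fi(3,4)[OF that(1)]]
      A_D_diff[OF b that(2) gi[OF that(1)]]
    by (simp_all add: f_def q_def g_def f1_def f1'_def q1_def q1'_def)
  have cf: "continuous_on {0..T} (\<lambda>\<tau>. A_D b (f1 \<tau>) x)" "continuous_on {0..T} (\<lambda>\<tau>. A_D b (f1' \<tau>) x)"
    "continuous_on {0..T} (\<lambda>\<tau>. A_D b (q1 \<tau>) x)" "continuous_on {0..T} (\<lambda>\<tau>. A_D b (q1' \<tau>) x)"
    "continuous_on {0..T} (\<lambda>\<tau>. A_D b (weak_deriv 2 (\<eta> \<tau>)) x)" "continuous_on {0..T} (\<lambda>\<tau>. A_D b (weak_deriv 2 (\<eta>' \<tau>)) x)"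
    if x: "x \<in> {-1..1}" for x
    by (intro continuous_on_A_D[OF b x] f1c q1c
       continuous_on_A_D_L1[OF b x] gi CT_weak_deriv_tendsto[OF \<eta> _ _ \<mu>] CT_weak_deriv_tendsto[OF \<eta>' _ _ \<mu>]; simp)+
  have cg: "continuous_on {0..T} (\<lambda>\<tau>. c * A_D b (weak_deriv 2 (\<eta> \<tau>)) x + A_D b (q1 \<tau>) x)"
    "continuous_on {0..T} (\<lambda>\<tau>. c * A_D b (weak_deriv 2 (\<eta>' \<tau>)) x + A_D b (q1' \<tau>) x)"
    if x: "x \<in> {-1..1}" for x
    by (intro continuous_intros cf x)+
  have Aqg: "c * A_D b (g \<tau>) x + A_D b (q \<tau>) x = (c * A_D b (weak_deriv 2 (\<eta> \<tau>)) x + A_D b (q1 \<tau>) x)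
     - (c * A_D b (weak_deriv 2 (\<eta>' \<tau>)) x + A_D b (q1' \<tau>) x)" if "\<tau> \<in> {0..T}" "x \<in> {-1..1}" for \<tau> x
    unfolding Aq[OF that] Ag[OF that] by (simp add: algebra_simps)
  show "continuous_on {0..T} (\<lambda>\<tau>. c * A_D b (g \<tau>) x + A_D b (q \<tau>) x)" if x: "x \<in> {-1..1}" for x
    using continuous_on_diff[OF cg[OF x]] Aqg[OF _ x] by (simp cong: continuous_on_cong_simp)
  have sub: "\<tau> \<in> {0..T}" if "\<tau> \<in> {0..t}" for \<tau> using that t by auto
  \<comment> \<open>Subtracting the two systems splits a gauge integral of a difference, which needs
    both parts integrable in time; the continuity facts above provide this.\<close>
  have int: "h integrable_on {0..t}" if "continuous_on {0..T} h" for h :: "real \<Rightarrow> real"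
    using that t by (intro integrable_continuous_interval) (auto elim: continuous_on_subset)
  have space: "AE x in lebesgue_on \<Omega>. x \<in> {-1..1}"
    by (rule AE_I2) auto
  have ae: "AE x in lebesgue_on \<Omega>. \<eta> t x = data_term b \<eta>0 h1 h2 t x + integral {0..t} (\<lambda>\<tau>. A_D b (\<lambda>\<xi>. u \<tau> \<xi> + \<eta> \<tau> \<xi> * u \<tau> \<xi>) x)"
    "AE x in lebesgue_on \<Omega>. \<eta>' t x = data_term b \<eta>0 h1 h2 t x + integral {0..t} (\<lambda>\<tau>. A_D b (\<lambda>\<xi>. u' \<tau> \<xi> + \<eta>' \<tau> \<xi> * u' \<tau> \<xi>) x)"
    "AE x in lebesgue_on \<Omega>. u t x = data_term b u0 v1 v2 t x + integral {0..t} (\<lambda>\<tau>. A_D b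
             (\<lambda>\<xi>. c * weak_deriv 2 (\<eta> \<tau>) \<xi> + \<eta> \<tau> \<xi> + (u \<tau> \<xi>)\<^sup>2 / 2) x)"
    "AE x in lebesgue_on \<Omega>. u' t x = data_term b u0 v1 v2 t x + integral {0..t} (\<lambda>\<tau>. A_D b
             (\<lambda>\<xi>. c * weak_deriv 2 (\<eta>' \<tau>) \<xi> + \<eta>' \<tau> \<xi> + (u' \<tau> \<xi>)\<^sup>2 / 2) x)"
    using sol sol' t by (auto simp: solves_system_def)
  show "AE x in lebesgue_on \<Omega>. E t x - E' t x = integral {0..t} (\<lambda>\<tau>. A_D b (f \<tau>) x)"
    using ae(1,2) E(2)[rule_format, OF t] E'(2)[rule_format, OF t] space
  proof eventually_elim
    case (elim x)
    have "integral {0..t} (\<lambda>\<tau>. A_D b (\<lambda>\<xi>. u \<tau> \<xi> + \<eta> \<tau> \<xi> * u \<tau> \<xi>) x) = integral {0..t} (\<lambda>\<tau>. A_D b (f1 \<tau>) x)"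
      unfolding f1_def
      by (intro Henstock_Kurzweil_Integration.integral_cong A_D_eta_flux_cong b elim(5) E(2)[rule_format] U(2)[rule_format]
          continuous_on_slice[OF E(1)] continuous_on_slice[OF U(1)] sub)
    moreover have "integral {0..t} (\<lambda>\<tau>. A_D b (\<lambda>\<xi>. u' \<tau> \<xi> + \<eta>' \<tau> \<xi> * u' \<tau> \<xi>) x) = integral {0..t} (\<lambda>\<tau>. A_D b (f1' \<tau>) x)"
      unfolding f1'_def
      by (intro Henstock_Kurzweil_Integration.integral_cong A_D_eta_flux_cong b elim(5) E'(2)[rule_format] U'(2)[rule_format]
          continuous_on_slice[OF E'(1)] continuous_on_slice[OF U'(1)] sub)
    moreover have "integral {0..t} (\<lambda>\<tau>. A_D b (f \<tau>) x) = integral {0..t} (\<lambda>\<tau>. A_D b (f1 \<tau>) x - A_D b (f1' \<tau>) x)"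
      by (intro Henstock_Kurzweil_Integration.integral_cong Af sub elim(5))
    moreover have "\<dots> = integral {0..t} (\<lambda>\<tau>. A_D b (f1 \<tau>) x) - integral {0..t} (\<lambda>\<tau>. A_D b (f1' \<tau>) x)"
      by (intro Henstock_Kurzweil_Integration.integral_diff int cf elim(5))
    ultimately show ?case using elim by simp
  qed
  show "AE x in lebesgue_on \<Omega>. U t x - U' t x = integral {0..t} (\<lambda>\<tau>. c * A_D b (g \<tau>) x + A_D b (q \<tau>) x)"
    using ae(3,4) U(2)[rule_format, OF t] U'(2)[rule_format, OF t] space
  proof eventually_elim
    case (elim x)
    have "integral {0..t} (\<lambda>\<tau>. A_D b (\<lambda>\<xi>. c * weak_deriv 2 (\<eta> \<tau>) \<xi> + \<eta> \<tau> \<xi> + (u \<tau> \<xi>)\<^sup>2 / 2) x)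
        = integral {0..t} (\<lambda>\<tau>. c * A_D b (weak_deriv 2 (\<eta> \<tau>)) x + A_D b (q1 \<tau>) x)"
      unfolding q1_def
      by (intro Henstock_Kurzweil_Integration.integral_cong A_D_u_flux_cong b elim(5) E(2)[rule_format] U(2)[rule_format] gi
          continuous_on_slice[OF E(1)] continuous_on_slice[OF U(1)] sub)
    moreover have "integral {0..t} (\<lambda>\<tau>. A_D b (\<lambda>\<xi>. c * weak_deriv 2 (\<eta>' \<tau>) \<xi> + \<eta>' \<tau> \<xi> + (u' \<tau> \<xi>)\<^sup>2 / 2) x)
        = integral {0..t} (\<lambda>\<tau>. c * A_D b (weak_deriv 2 (\<eta>' \<tau>)) x + A_D b (q1' \<tau>) x)"
      unfolding q1'_def
      by (intro Henstock_Kurzweil_Integration.integral_cong A_D_u_flux_cong b elim(5) E'(2)[rule_format] U'(2)[rule_format] gi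
          continuous_on_slice[OF E'(1)] continuous_on_slice[OF U'(1)] sub)
    moreover have "integral {0..t} (\<lambda>\<tau>. c * A_D b (g \<tau>) x + A_D b (q \<tau>) x)
       = integral {0..t} (\<lambda>\<tau>. (c * A_D b (weak_deriv 2 (\<eta> \<tau>)) x + A_D b (q1 \<tau>) x) - (c * A_D b (weak_deriv 2 (\<eta>' \<tau>)) x + A_D b (q1' \<tau>) x))"
      by (intro Henstock_Kurzweil_Integration.integral_cong Aqg sub elim(5))
    moreover have "\<dots> = integral {0..t} (\<lambda>\<tau>. c * A_D b (weak_deriv 2 (\<eta> \<tau>)) x + A_D b (q1 \<tau>) x)
       - integral {0..t} (\<lambda>\<tau>. c * A_D b (weak_deriv 2 (\<eta>' \<tau>)) x + A_D b (q1' \<tau>) x)"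
      by (intro Henstock_Kurzweil_Integration.integral_diff int cg elim(5))
    ultimately show ?case using elim by simp
  qed
qed

text \<open>A bound \<open>K * exp (l * t)\<close> on both differences improves to half of itself:
  the fluxes inherit it up to a constant, \<open>A_D\<close> preserves suprema up to a constant, and
  the time integral contributes 1/l. Keeping \<open>m\<close> general covers both regularity classes
  of \<open>u\<close>.\<close>

lemma solution_unique:
  assumes b: "b > 0" and \<mu>: "\<mu> < 1" and m: "1 \<le> m"
    and \<eta>: "\<eta> \<in> CT \<mu> 2 T" and u: "u \<in> CT \<mu> m T" and sol: "solves_system b c T \<eta>0 u0 h1 h2 v1 v2 \<eta> u"
    and \<eta>': "\<eta>' \<in> CT \<mu> 2 T" and u': "u' \<in> CT \<mu> m T" and sol': "solves_system b c T \<eta>0 u0 h1 h2 v1 v2 \<eta>' u'"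
  shows "\<forall>t\<in>{0..T}. AE x in lebesgue_on \<Omega>. \<eta> t x = \<eta>' t x \<and> u t x = u' t x"
proof -
  have "(1::nat) \<le> 2" by simp
  obtain E where E: "continuous_on ({0..T} \<times> {-1..1}) (\<lambda>(t, x). E t x)" "\<forall>t\<in>{0..T}. AE x in lebesgue_on \<Omega>. \<eta> t x = E t x"
    using CT_representative[OF \<eta> \<open>1 \<le> 2\<close> \<mu>] by blast
  obtain E' where E': "continuous_on ({0..T} \<times> {-1..1}) (\<lambda>(t, x). E' t x)" "\<forall>t\<in>{0..T}. AE x in lebesgue_on \<Omega>. \<eta>' t x = E' t x"
    using CT_representative[OF \<eta>' \<open>1 \<le> 2\<close> \<mu>] by blast
  obtain U where U: "continuous_on ({0..T} \<times> {-1..1}) (\<lambda>(t, x). U t x)" "\<forall>t\<in>{0..T}. AE x in lebesgue_on \<Omega>. u t x = U t x"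
    using CT_representative[OF u m \<mu>] by blast
  obtain U' where U': "continuous_on ({0..T} \<times> {-1..1}) (\<lambda>(t, x). U' t x)" "\<forall>t\<in>{0..T}. AE x in lebesgue_on \<Omega>. u' t x = U' t x"
    using CT_representative[OF u' m \<mu>] by blast
  define f where "f = (\<lambda>\<tau> \<xi>. (U \<tau> \<xi> + E \<tau> \<xi> * U \<tau> \<xi>) - (U' \<tau> \<xi> + E' \<tau> \<xi> * U' \<tau> \<xi>))"
  define q where "q = (\<lambda>\<tau> \<xi>. (E \<tau> \<xi> + (U \<tau> \<xi>)\<^sup>2 / 2) - (E' \<tau> \<xi> + (U' \<tau> \<xi>)\<^sup>2 / 2))"
  define g where "g = (\<lambda>\<tau> \<xi>. weak_deriv 2 (\<eta> \<tau>) \<xi> - weak_deriv 2 (\<eta>' \<tau>) \<xi>)"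
  note diff = solution_difference[OF b \<mu> m \<eta> u sol \<eta>' u' sol' E U E' U' _ f_def q_def g_def]
  define F where "F t \<xi> = integral {0..t} (\<lambda>\<tau>. f \<tau> \<xi>)" for t \<xi>
  have fc: "continuous_on ({0..T} \<times> {-1..1}) (\<lambda>(t, x). f t x)" and qc: "continuous_on ({0..T} \<times> {-1..1}) (\<lambda>(t, x). q t x)"
    using E(1) U(1) E'(1) U'(1) unfolding f_def q_def case_prod_beta' by (auto intro!: continuous_intros)
  have fct: "continuous_on ({0..t} \<times> {-1..1}) (\<lambda>(t, x). f t x)" if "t \<in> {0..T}" for t
    by (rule continuous_on_subset[OF fc]) (use that in auto)
  have Fc: "continuous_on {-1..1} (F t)" if "t \<in> {0..T}" for t
    unfolding F_def using integral_A_D(1)[OF b _ fct[OF that], of 0] by simp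
  have eF: "AE x in lebesgue_on \<Omega>. E t x - E' t x = A_D b (F t) x" if "t \<in> {0..T}" for t
  proof -
    have "AE x in lebesgue_on \<Omega>. x \<in> {-1..1}" by (rule AE_I2) auto
    with diff(1)[OF that] show ?thesis
      by eventually_elim (simp add: F_def[abs_def] integral_A_D(2)[OF b _ fct[OF that]])
  qed
  \<comment> \<open>The chosen second derivatives are tied to \<open>A_D b (F t)\<close>, which is
    classically differentiable; only in this form can \<open>A_D b (g t)\<close> be bounded by the
    supremum of \<open>F t\<close>.\<close>
  have g2: "has_weak_deriv 2 (A_D b (F t)) (g t)" if t: "t \<in> {0..T}" for t
  proof (rule has_weak_deriv_cong_AE[OF diff(5)[OF t]])
    show "AE x in lebesgue_on \<Omega>. \<eta> t x - \<eta>' t x = A_D b (F t) x"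
      using eF[OF t] E(2)[rule_format, OF t] E'(2)[rule_format, OF t] by eventually_elim simp
    show "locally_integrable (A_D b (F t))"
      by (intro integrable_imp_locally_integrable continuous_integrable_Omega A_D_continuous[OF b Fc[OF t]])
  qed
  have "compact ({0..T} \<times> {-1..1::real})" by (intro compact_Times) auto
  then have bounded: "\<exists>R. \<forall>p\<in>{0..T} \<times> {-1..1::real}. \<bar>h p\<bar> \<le> R" if "continuous_on ({0..T} \<times> {-1..1}) h" for h :: "real \<times> real \<Rightarrow> real"
    using compact_imp_bounded[OF compact_continuous_image[OF that \<open>compact _\<close>]] unfolding bounded_real by blast
  have "continuous_on ({0..T} \<times> {-1..1}) (\<lambda>(t, x). \<bar>E t x\<bar> + \<bar>U t x\<bar> + \<bar>E' t x\<bar> + \<bar>U' t x\<bar>)"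
    using E(1) U(1) E'(1) U'(1) unfolding case_prod_beta' by (auto intro!: continuous_intros)
  from bounded[OF this] obtain R0 where
    "\<forall>p\<in>{0..T} \<times> {-1..1}. \<bar>case p of (t, x) \<Rightarrow> \<bar>E t x\<bar> + \<bar>U t x\<bar> + \<bar>E' t x\<bar> + \<bar>U' t x\<bar>\<bar> \<le> R0"
    by blast
  then have R0: "\<bar>E t x\<bar> + \<bar>U t x\<bar> + \<bar>E' t x\<bar> + \<bar>U' t x\<bar> \<le> R0" if "t \<in> {0..T}" "x \<in> {-1..1}" for t x
    using that by (auto dest: bspec[of _ _ "(t, x)"])
  \<comment> \<open>If \<open>{0..T}\<close> is empty, \<open>R0\<close> is unconstrained; the
    maximum ensures a nonnegative bound.\<close>
  define R where "R = max R0 0"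
  have "R \<ge> 0" by (simp add: R_def)
  have R: "\<bar>E t x\<bar> \<le> R" "\<bar>U t x\<bar> \<le> R" "\<bar>E' t x\<bar> \<le> R" "\<bar>U' t x\<bar> \<le> R" if "t \<in> {0..T}" "x \<in> {-1..1}" for t x
    using R0[OF that] by (auto simp: R_def)
  define A0 where "A0 = 2 * Green_factor b * (w_bound b * w_bound b)"
  have A0: "A0 \<ge> 0" unfolding A0_def using Green_factor_pos[OF b] w_bound_nonneg[OF b] by simp
  have A2: "A_D_bound2 b \<ge> 0"
    unfolding A_D_bound2_def using Green_factor_pos[OF b] w_bound_nonneg[OF b] b by simp
  \<comment> \<open>A Lipschitz constant shared by both fluxes for arguments bounded by
    \<open>R\<close>; it is what the product \<open>\<eta> u\<close> requires, and the quadratic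
    term in \<open>u\<close> needs only \<open>1 + R\<close>.\<close>
  define Q where "Q = 1 + 2 * R"
  have Q: "Q \<ge> 1" using \<open>R \<ge> 0\<close> by (simp add: Q_def)
  \<comment> \<open>\<open>D\<close> bounds the whole integrand of the second equation relative to
    \<open>K * exp (l * \<tau>)\<close>, and also dominates the constant \<open>A0 * Q\<close> of
    the first. With \<open>l = 2 * D + 1\<close> the gain 1/l beats it by a factor 2.\<close>
  define D where "D = (\<bar>c\<bar> * A_D_bound2 b + A0) * Q"
  define l where "l = 2 * D + 1"
  have D: "D \<ge> 0" "A0 * Q \<le> D" unfolding D_def using A0 A2 Q by (auto intro!: mult_right_mono)
  have l: "l \<ge> 1" "l > 0" "D / l \<le> 1 / 2" using D by (auto simp: l_def field_simps)
  let ?P = "\<lambda>K. \<forall>t\<in>{0..T}. \<forall>x\<in>{-1..1}. \<bar>E t x - E' t x\<bar> \<le> K * exp (l * t) \<and> \<bar>U t x - U' t x\<bar> \<le> K * exp (l * t)"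
  have step: "?P (K / 2)" if K: "K \<ge> 0" and P: "?P K" for K
  proof (intro ballI)
    fix t x :: real assume t: "t \<in> {0..T}" and x: "x \<in> {-1..1}"
    have f: "\<bar>f \<tau> \<xi>\<bar> \<le> Q * K * exp (l * \<tau>)" and q: "\<bar>q \<tau> \<xi>\<bar> \<le> Q * K * exp (l * \<tau>)" if \<tau>\<xi>: "\<tau> \<in> {0..T}" "\<xi> \<in> {-1..1}" for \<tau> \<xi>
    proof -
      let ?X = "K * exp (l * \<tau>)"
      have e: "\<bar>E \<tau> \<xi> - E' \<tau> \<xi>\<bar> \<le> ?X" and v: "\<bar>U \<tau> \<xi> - U' \<tau> \<xi>\<bar> \<le> ?X" using P that by auto
      have X: "?X \<ge> 0" using K by simp
      have "f \<tau> \<xi> = (U \<tau> \<xi> - U' \<tau> \<xi>) + ((E \<tau> \<xi> - E' \<tau> \<xi>) * U \<tau> \<xi> + E' \<tau> \<xi> * (U \<tau> \<xi> - U' \<tau> \<xi>))"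
        by (simp add: f_def algebra_simps)
      moreover have "\<bar>(E \<tau> \<xi> - E' \<tau> \<xi>) * U \<tau> \<xi>\<bar> \<le> ?X * R"
        unfolding abs_mult by (intro mult_mono e R that X abs_ge_zero)
      moreover have "\<bar>E' \<tau> \<xi> * (U \<tau> \<xi> - U' \<tau> \<xi>)\<bar> \<le> R * ?X"
        unfolding abs_mult by (intro mult_mono v R that \<open>R \<ge> 0\<close> abs_ge_zero)
      ultimately have "\<bar>f \<tau> \<xi>\<bar> \<le> ?X + (?X * R + R * ?X)" using v by linarith
      then show "\<bar>f \<tau> \<xi>\<bar> \<le> Q * K * exp (l * \<tau>)" by (simp add: Q_def algebra_simps)
      have "q \<tau> \<xi> = (E \<tau> \<xi> - E' \<tau> \<xi>) + (U \<tau> \<xi> + U' \<tau> \<xi>) * (U \<tau> \<xi> - U' \<tau> \<xi>) / 2"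
        by (simp add: q_def algebra_simps power2_eq_square diff_divide_distrib add_divide_distrib)
      moreover have "\<bar>(U \<tau> \<xi> + U' \<tau> \<xi>) * (U \<tau> \<xi> - U' \<tau> \<xi>)\<bar> \<le> (2 * R) * ?X"
        unfolding abs_mult using R[OF that] \<open>R \<ge> 0\<close> by (intro mult_mono v) auto
      moreover have "0 \<le> (2 * R) * ?X" using X \<open>R \<ge> 0\<close> by simp
      ultimately have "\<bar>q \<tau> \<xi>\<bar> \<le> ?X + (2 * R) * ?X" using e by linarith
      then show "\<bar>q \<tau> \<xi>\<bar> \<le> Q * K * exp (l * \<tau>)" by (simp add: Q_def algebra_simps)
    qed
    have QK: "Q * K \<ge> 0" using Q K by simp
    have F: "\<bar>F \<tau> \<xi>\<bar> \<le> Q * K / l * exp (l * \<tau>)" if \<tau>: "\<tau> \<in> {0..T}" and \<xi>: "\<xi> \<in> {-1..1}" for \<tau> \<xi>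
      unfolding F_def
    proof (rule integral_exp_bound)
      have "continuous_on {0..\<tau>} (\<lambda>s. (\<lambda>(t, x). f t x) (s, \<xi>))"
        by (rule continuous_on_compose2[OF fct[OF \<tau>]]) (use \<xi> in \<open>auto intro!: continuous_intros\<close>)
      then show "continuous_on {0..\<tau>} (\<lambda>s. f s \<xi>)" by simp
    qed (use f \<tau> \<xi> l QK in auto)
    have "\<bar>E t y - E' t y\<bar> \<le> K / 2 * exp (l * t)" if y: "y \<in> {-1..1}" for y
    \<comment> \<open>The system yields this estimate almost everywhere; continuity of the
      representatives extends it to every point, as the next round of the iteration
      requires.\<close>
    proof (rule continuous_AE_bound[OF _ _ y])
      show "continuous_on {-1..1} (\<lambda>x. E t x - E' t x)"
        by (intro continuous_intros continuous_on_slice[OF E(1) t] continuous_on_slice[OF E'(1) t])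
      have bound: "\<bar>A_D b (F t) z\<bar> \<le> K / 2 * exp (l * t)" if z: "z \<in> {-1..1}" for z
      proof -
        have "\<bar>A_D b (F t) z\<bar> \<le> A0 * (Q * K / l * exp (l * t))"
          unfolding A0_def by (rule A_D_bound[OF b z Fc[OF t] F[OF t]])
        also have "\<dots> = (A0 * Q) / l * (K * exp (l * t))" by simp
        also have "\<dots> \<le> D / l * (K * exp (l * t))"
          using D l K by (intro mult_right_mono divide_right_mono) auto
        also have "\<dots> \<le> 1 / 2 * (K * exp (l * t))" using l K by (intro mult_right_mono) auto
        finally show ?thesis by simp
      qed
      have "AE x in lebesgue_on \<Omega>. x \<in> {-1..1}" by (rule AE_I2) auto
      with eF[OF t] show "AE x in lebesgue_on \<Omega>. \<bar>E t x - E' t x\<bar> \<le> K / 2 * exp (l * t)"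
        by eventually_elim (use bound in simp)
    qed
    moreover have "\<bar>U t y - U' t y\<bar> \<le> K / 2 * exp (l * t)" if y: "y \<in> {-1..1}" for y
    proof (rule continuous_AE_bound[OF _ _ y])
      show "continuous_on {-1..1} (\<lambda>x. U t x - U' t x)"
        by (intro continuous_intros continuous_on_slice[OF U(1) t] continuous_on_slice[OF U'(1) t])
      have bound: "\<bar>integral {0..t} (\<lambda>\<tau>. c * A_D b (g \<tau>) z + A_D b (q \<tau>) z)\<bar> \<le> K / 2 * exp (l * t)" if z: "z \<in> {-1..1}" for z
      proof -
        have "\<bar>integral {0..t} (\<lambda>\<tau>. c * A_D b (g \<tau>) z + A_D b (q \<tau>) z)\<bar> \<le> D * K / l * exp (l * t)"
        proof (rule integral_exp_bound)
          show "continuous_on {0..t} (\<lambda>\<tau>. c * A_D b (g \<tau>) z + A_D b (q \<tau>) z)"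
            by (rule continuous_on_subset[OF diff(3)[OF t z]]) (use t in auto)
          fix \<tau> assume "\<tau> \<in> {0..t}"
          then have \<tau>: "\<tau> \<in> {0..T}" using t by auto
          have "\<bar>A_D b (g \<tau>) z\<bar> \<le> A_D_bound2 b * (Q * K / l * exp (l * \<tau>))"
            by (rule A_D_weak_deriv_2_bound[OF b z Fc[OF \<tau>] F[OF \<tau>] diff(4)[OF \<tau>] g2[OF \<tau>]])
          \<comment> \<open>The 1/l contained in the bound on \<open>F\<close> is given away, using
            \<open>l \<ge> 1\<close>; the outer time integral supplies another one, and that one
            suffices.\<close>
          also have "\<dots> \<le> A_D_bound2 b * (Q * K * exp (l * \<tau>))"
          proof -
            have "Q * K / l \<le> Q * K / 1" using l QK by (intro divide_left_mono) auto
            then show ?thesis using A2 by (intro mult_left_mono mult_right_mono) auto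
          qed
          finally have "\<bar>c * A_D b (g \<tau>) z\<bar> \<le> \<bar>c\<bar> * (A_D_bound2 b * (Q * K * exp (l * \<tau>)))"
            by (simp add: abs_mult mult_left_mono)
          moreover have "\<bar>A_D b (q \<tau>) z\<bar> \<le> A0 * (Q * K * exp (l * \<tau>))"
            unfolding A0_def by (rule A_D_bound[OF b z continuous_on_slice[OF qc \<tau>] q[OF \<tau>]])
          ultimately have "\<bar>c * A_D b (g \<tau>) z + A_D b (q \<tau>) z\<bar>
             \<le> \<bar>c\<bar> * (A_D_bound2 b * (Q * K * exp (l * \<tau>))) + A0 * (Q * K * exp (l * \<tau>))" by linarith
          then show "\<bar>c * A_D b (g \<tau>) z + A_D b (q \<tau>) z\<bar> \<le> D * K * exp (l * \<tau>)"
            by (simp add: D_def algebra_simps)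
        qed (use t l D K in auto)
        also have "\<dots> = D / l * (K * exp (l * t))" by simp
        also have "\<dots> \<le> 1 / 2 * (K * exp (l * t))" using l K by (intro mult_right_mono) auto
        finally show ?thesis by simp
      qed
      have "AE x in lebesgue_on \<Omega>. x \<in> {-1..1}" by (rule AE_I2) auto
      with diff(2)[OF t] show "AE x in lebesgue_on \<Omega>. \<bar>U t x - U' t x\<bar> \<le> K / 2 * exp (l * t)"
        by eventually_elim (use bound in simp)
    qed
    ultimately show "\<bar>E t x - E' t x\<bar> \<le> K / 2 * exp (l * t) \<and> \<bar>U t x - U' t x\<bar> \<le> K / 2 * exp (l * t)"
      using x by blast
  qed
  \<comment> \<open>The starting bound is the trivial one from the triangle inequality, as the
    exponential is at least 1.\<close>
  have base: "?P (2 * R)"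
  proof (intro ballI)
    fix t x :: real assume t: "t \<in> {0..T}" and x: "x \<in> {-1..1}"
    have "2 * R * 1 \<le> 2 * R * exp (l * t)" using t l \<open>R \<ge> 0\<close> by (intro mult_left_mono) auto
    then show "\<bar>E t x - E' t x\<bar> \<le> 2 * R * exp (l * t) \<and> \<bar>U t x - U' t x\<bar> \<le> 2 * R * exp (l * t)"
      using R[OF t x] by auto
  qed
  have Pn: "?P (2 * R / 2 ^ n)" for n
  proof (induction n)
    case 0
    then show ?case using base by simp
  next
    case (Suc n)
    have "?P (2 * R / 2 ^ n / 2)" by (rule step[OF _ Suc]) (use \<open>R \<ge> 0\<close> in simp)
    then show ?case by (simp add: mult.commute)
  qed
  have zero: "a = 0" if "\<And>n. \<bar>a\<bar> \<le> 2 * R / 2 ^ n * C" for a C :: real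
  proof -
    have "(\<lambda>n. 2 * R * C * (1 / 2) ^ n) \<longlonglongrightarrow> 2 * R * C * 0"
      by (intro tendsto_mult_left LIMSEQ_power_zero) simp
    then have "(\<lambda>n. 2 * R / 2 ^ n * C) \<longlonglongrightarrow> 0"
      by (simp add: power_one_over mult.commute mult.left_commute)
    then have "\<bar>a\<bar> \<le> 0"
      by (rule LIMSEQ_le_const) (use that in blast)
    then show ?thesis by simp
  qed
  show ?thesis
  proof
    fix t assume t: "t \<in> {0..T}"
    have eq: "E t x = E' t x" "U t x = U' t x" if "x \<in> {-1..1}" for x
      using zero[of "E t x - E' t x" "exp (l * t)"] zero[of "U t x - U' t x" "exp (l * t)"] Pn t that by auto
    have "AE x in lebesgue_on \<Omega>. x \<in> {-1..1}" by (rule AE_I2) auto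
    then show "AE x in lebesgue_on \<Omega>. \<eta> t x = \<eta>' t x \<and> u t x = u' t x"
      using E(2)[rule_format, OF t] E'(2)[rule_format, OF t] U(2)[rule_format, OF t] U'(2)[rule_format, OF t]
      by eventually_elim (simp add: eq)
  qed
qed

theorem proposition2p1:
  fixes \<theta> b c T \<mu> :: real
    and h1 h2 v1 v2 :: "real \<Rightarrow> real"
    and \<eta>0 u0 :: "real \<Rightarrow> real"
  assumes "2 / 3 \<le> \<theta>\<^sup>2" and "\<theta>\<^sup>2 \<le> 1"
    and "b = (3 * \<theta>\<^sup>2 - 1) / 6" and "c = (2 - 3 * \<theta>\<^sup>2) / 3"
    and "T > 0" and "- 1 < \<mu>" and "\<mu> < 1"
    and "continuous_on {0..T} h1" and "continuous_on {0..T} h2"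
    and "continuous_on {0..T} v1" and "continuous_on {0..T} v2"
  shows "(c < 0 \<and> \<eta>0 \<in> Hw \<mu> 2 \<and> u0 \<in> Hw \<mu> 1 \<longrightarrow>
          (\<forall>\<eta> u \<eta>' u'.
             \<eta> \<in> CT \<mu> 2 T \<and> u \<in> CT \<mu> 1 T \<and> solves_system b c T \<eta>0 u0 h1 h2 v1 v2 \<eta> u \<and>
             \<eta>' \<in> CT \<mu> 2 T \<and> u' \<in> CT \<mu> 1 T \<and> solves_system b c T \<eta>0 u0 h1 h2 v1 v2 \<eta>' u' \<longrightarrow>
             (\<forall>t\<in>{0..T}. AE x in lebesgue_on \<Omega>. \<eta> t x = \<eta>' t x \<and> u t x = u' t x)))
       \<and> (c = 0 \<and> \<eta>0 \<in> Hw \<mu> 2 \<and> u0 \<in> Hw \<mu> 2 \<longrightarrow>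
          (\<forall>\<eta> u \<eta>' u'.
             \<eta> \<in> CT \<mu> 2 T \<and> u \<in> CT \<mu> 2 T \<and> solves_system b c T \<eta>0 u0 h1 h2 v1 v2 \<eta> u \<and>
             \<eta>' \<in> CT \<mu> 2 T \<and> u' \<in> CT \<mu> 2 T \<and> solves_system b c T \<eta>0 u0 h1 h2 v1 v2 \<eta>' u' \<longrightarrow>
             (\<forall>t\<in>{0..T}. AE x in lebesgue_on \<Omega>. \<eta> t x = \<eta>' t x \<and> u t x = u' t x)))"
proof -
  have b: "b > 0" using assms(1,3) by simp
  have 12: "(1::nat) \<le> 2" by simp
  show ?thesis
    \<comment> \<open>The first rule is the instance \<open>m = 1\<close> for c < 0, the second the
      instance \<open>m = 2\<close> for c = 0.\<close>
    by (intro conjI impI allI; elim conjE;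
        (rule solution_unique[OF b \<open>\<mu> < 1\<close> order_refl] solution_unique[OF b \<open>\<mu> < 1\<close> 12]; assumption))
qed

end
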